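(* Let $A \in \mathbb{Z}_{\ge 0}^{k \times n}$ and $b \in \mathbb{Z}^k$, and let $P = [0,1]^n \cap \{x \in \mathbb{R}^n : Ax \le b\}$. Let $L$ be the maximum input encoding length. There is a deterministic algorithm which, given $A$, $b$ and $\varepsilon > 0$, computes $Z' \in \mathbb{R}$ such that \[ \mathrm{vol}(P) \le Z' \le (1+\varepsilon)\,\mathrm{vol}(P), \] using $n^{O(k^2)}\left(\log\frac{n}{\varepsilon} + L\right)^{O(k)}/\varepsilon^{O(k)}$ arithmetic operations on $O\!\left(L(\log(n/\varepsilon) + L)\right)$-bit numbers.
   Context: $\mathrm{vol}$ denotes $n$-dimensional Lebesgue measure. The encoding length of a rational number $p/q$ (with $p\in\mathbb{Z}$, $q\in\mathbb{Z}_{>0}$) is $\lceil \log(|p|+1)\rceil + \lceil \log(q+1)\rceil$.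
   Formalization: ε is a positive rational; the operation and bit bounds use min(ε,1/2) in place of ε (for large ε the stated bounds allow less than one operation); Z' is output as a pair (m,e) meaning m·2^e, since one fraction would exceed the bit bound. *)

theory Defs
  imports "HOL-Analysis.Analysis"
begin

section \<open>Encoding length\<close>

text \<open>All logarithms are to base 2; \<^const>\<open>quotient_of\<close> yields lowest terms with positive denominator.\<close>

definition enc_len :: "rat \<Rightarrow> int" where
  "enc_len r = (let (p, q) = quotient_of r
     in \<lceil>log 2 (real_of_int (\<bar>p\<bar> + 1))\<rceil> + \<lceil>log 2 (real_of_int (q + 1))\<rceil>)"

text \<open>The maximum is over the entries of the matrix and of the right-hand side;
  the accuracy parameter is not included.\<close>

definition max_enc_len :: "nat \<Rightarrow> nat \<Rightarrow> (nat \<Rightarrow> nat \<Rightarrow> int) \<Rightarrow> (nat \<Rightarrow> int) \<Rightarrow> int" where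
  "max_enc_len k n A b =
     Max ((\<lambda>(i, j). enc_len (of_int (A i j))) ` ({..<k} \<times> {..<n})
          \<union> (\<lambda>i. enc_len (of_int (b i))) ` {..<k})"


section \<open>The polytope and its volume\<close>

text \<open>The dimension is a variable, so \<open>\<real>\<^sup>n\<close> is rendered as the functions on \<open>{..<n}\<close>
  that are \<^const>\<open>undefined\<close> elsewhere, with the product Lebesgue measure.\<close>

definition polytope_in_cube ::
    "nat \<Rightarrow> nat \<Rightarrow> (nat \<Rightarrow> nat \<Rightarrow> int) \<Rightarrow> (nat \<Rightarrow> int) \<Rightarrow> (nat \<Rightarrow> real) set" where
  "polytope_in_cube k n A b =
     {x \<in> {..<n} \<rightarrow>\<^sub>E {0..1}.
        \<forall>i<k. (\<Sum>j<n. real_of_int (A i j) * x j) \<le> real_of_int (b i)}"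

definition vol :: "nat \<Rightarrow> (nat \<Rightarrow> real) set \<Rightarrow> real" where
  "vol n S = measure (Pi\<^sub>M {..<n} (\<lambda>_. lborel)) S"


section \<open>Deterministic algorithms\<close>

text \<open>
  A program is a finite while program over two memories, each of them a family of unbounded
  arrays. The memory \<open>num\<close> holds rational numbers, which are the objects of the arithmetic
  operations. The memory \<open>idx\<close> holds the natural numbers used for addressing and loop control.
  Index values are not subject to the bit bound (the number \<open>k\<close> of rows alone may exceed any
  power of two that the bit bound permits), but they can only be set to constants, copied,
  incremented, decremented and compared. After \<open>t\<close> steps an index therefore exceeds the largest
  of \<open>k\<close>, \<open>n\<close> and the constants of the program by at most \<open>t\<close>, and long arithmetic cannot be
  hidden in indices.
\<close>

record store =
  num :: "nat \<times> nat \<Rightarrow> rat"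
  idx :: "nat \<times> nat \<Rightarrow> nat"

text \<open>\<open>Cell a c\<close> is position \<open>c\<close> of array \<open>a\<close>. \<open>Elem a v\<close> is indirect addressing: the position
  in array \<open>a\<close> is the content of cell \<open>v\<close> of index array \<open>0\<close>.\<close>

datatype loc = Cell nat nat | Elem nat nat

fun addr :: "store \<Rightarrow> loc \<Rightarrow> nat \<times> nat" where
  "addr s (Cell a c) = (a, c)"
| "addr s (Elem a v) = (a, idx s (0, v))"

abbreviation numv :: "store \<Rightarrow> loc \<Rightarrow> rat" where
  "numv s l \<equiv> num s (addr s l)"

abbreviation idxv :: "store \<Rightarrow> loc \<Rightarrow> nat" where
  "idxv s l \<equiv> idx s (addr s l)"

definition set_num :: "store \<Rightarrow> loc \<Rightarrow> rat \<Rightarrow> store" where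
  "set_num s l r = s\<lparr>num := (num s)(addr s l := r)\<rparr>"

definition set_idx :: "store \<Rightarrow> loc \<Rightarrow> nat \<Rightarrow> store" where
  "set_idx s l m = s\<lparr>idx := (idx s)(addr s l := m)\<rparr>"

datatype nexp =
  NConst rat | NCopy loc | NFloor loc
| NAdd loc loc | NSub loc loc | NMul loc loc | NDiv loc loc

text \<open>Division by zero yields zero, as in the library.\<close>

fun nval :: "store \<Rightarrow> nexp \<Rightarrow> rat" where
  "nval s (NConst r) = r"
| "nval s (NCopy x) = numv s x"
| "nval s (NFloor x) = of_int \<lfloor>numv s x\<rfloor>"
| "nval s (NAdd x y) = numv s x + numv s y"
| "nval s (NSub x y) = numv s x - numv s y"
| "nval s (NMul x y) = numv s x * numv s y"
| "nval s (NDiv x y) = numv s x / numv s y"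

datatype iexp = IConst nat | ICopy loc | IInc loc | IDec loc

fun ival :: "store \<Rightarrow> iexp \<Rightarrow> nat" where
  "ival s (IConst m) = m"
| "ival s (ICopy x) = idxv s x"
| "ival s (IInc x) = idxv s x + 1"
| "ival s (IDec x) = idxv s x - 1"

datatype cond = LeN loc loc | LessN loc loc | LeI loc loc | LessI loc loc

fun holds :: "store \<Rightarrow> cond \<Rightarrow> bool" where
  "holds s (LeN x y) \<longleftrightarrow> numv s x \<le> numv s y"
| "holds s (LessN x y) \<longleftrightarrow> numv s x < numv s y"
| "holds s (LeI x y) \<longleftrightarrow> idxv s x \<le> idxv s y"
| "holds s (LessI x y) \<longleftrightarrow> idxv s x < idxv s y"

datatype com =
  Skip
| AssignN loc nexp
| AssignI loc iexp
| Seq com com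
| Cond cond com com
| Loop cond com

text \<open>\<open>exec B c s t s'\<close>: started in \<open>s\<close>, the program \<open>c\<close> halts in \<open>s'\<close> after exactly \<open>t\<close> steps,
  where every assignment and every test is one step, and every rational number written during
  the run has encoding length at most \<open>B\<close>.\<close>

inductive exec :: "real \<Rightarrow> com \<Rightarrow> store \<Rightarrow> nat \<Rightarrow> store \<Rightarrow> bool" for B :: real where
  Skip: "exec B Skip s 0 s"
| AssignN: "real_of_int (enc_len (nval s e)) \<le> B \<Longrightarrow>
    exec B (AssignN l e) s 1 (set_num s l (nval s e))"
| AssignI: "exec B (AssignI l e) s 1 (set_idx s l (ival s e))"
| Seq: "exec B c1 s t1 s1 \<Longrightarrow> exec B c2 s1 t2 s2 \<Longrightarrow> exec B (Seq c1 c2) s (t1 + t2) s2"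
| CondT: "holds s g \<Longrightarrow> exec B c1 s t s1 \<Longrightarrow> exec B (Cond g c1 c2) s (t + 1) s1"
| CondF: "\<not> holds s g \<Longrightarrow> exec B c2 s t s1 \<Longrightarrow> exec B (Cond g c1 c2) s (t + 1) s1"
| LoopF: "\<not> holds s g \<Longrightarrow> exec B (Loop g c) s 1 s"
| LoopT: "holds s g \<Longrightarrow> exec B c s t1 s1 \<Longrightarrow> exec B (Loop g c) s1 t2 s2 \<Longrightarrow>
    exec B (Loop g c) s (t1 + t2 + 1) s2"

lemma exec_deterministic:
  assumes "exec B c s t s1" and "exec B' c s t' s2"
  shows "t = t' \<and> s1 = s2"
  using assms
proof (induction arbitrary: t' s2 rule: exec.induct)
  case (Seq c1 s t1 s1 c2 t2 s2)
  from Seq.prems show ?case by (cases rule: exec.cases) (use Seq.IH in blast)+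
next
  case (LoopT s g c t1 s1 t2 s2)
  from LoopT.prems show ?case
    by (cases rule: exec.cases) (use LoopT.IH LoopT.hyps in blast)+
qed (auto elim: exec.cases)

text \<open>Input: \<open>k\<close> and \<open>n\<close> are in cells 0 and 1 of index array 0; the accuracy, the matrix
  (row by row) and the right-hand side are in number arrays 0, 1 and 2; all other cells are 0.\<close>

definition input_store ::
    "nat \<Rightarrow> nat \<Rightarrow> (nat \<Rightarrow> nat \<Rightarrow> int) \<Rightarrow> (nat \<Rightarrow> int) \<Rightarrow> rat \<Rightarrow> store" where
  "input_store k n A b \<epsilon> =
     \<lparr>num = (\<lambda>(a, p).
        if a = 0 \<and> p = 0 then \<epsilon>
        else if a = 1 \<and> p < k * n then of_int (A (p div n) (p mod n))
        else if a = 2 \<and> p < k then of_int (b p)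
        else 0),
      idx = (\<lambda>(a, p).
        if a = 0 \<and> p = 0 then k
        else if a = 0 \<and> p = 1 then n
        else 0)\<rparr>"

text \<open>Output: the number \<open>m * 2\<^sup>e\<close> given by \<open>m\<close> and the integer \<open>e\<close> in cells 0 and 1 of
  number array 3. The volume can be as small as \<open>2\<^bsup>-nL\<^esup>/n!\<close>, and a fraction
  \<open>p/q\<close> of that size is longer than the bit bound allows.\<close>

definition outputs :: "store \<Rightarrow> real \<Rightarrow> bool" where
  "outputs s Z \<longleftrightarrow>
     (\<exists>e::int. num s (3, 1) = of_int e \<and> Z = real_of_rat (num s (3, 0)) * 2 powi e)"

end

theory Submission
  imports Defs
begin

text \<open>
  Put \<open>u\<^sub>j = min 1 (min\<^sub>i b\<^sub>i / A\<^sub>i\<^sub>j)\<close> and substitute \<open>x\<^sub>j = u\<^sub>j z\<^sub>j\<close>. The constraints become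
  \<open>\<Sum>\<^sub>j \<alpha>\<^sub>i\<^sub>j z\<^sub>j \<le> 1\<close> with all coefficients in \<open>[0, 1]\<close>, so an additive error of order \<open>1/M\<close>, with
  \<open>M\<close> of order \<open>n\<^sup>2 / \<epsilon>\<close>, in every coefficient and in every coordinate enlarges the polytope at most to
  its dilate by \<open>1 + 3n/M\<close>, that is, its volume by a factor \<open>(1 + 3n/M)\<^sup>n\<close>. Hence it suffices to count
  the \<open>y \<in> {0..M-1}\<^sup>n\<close> with \<open>\<Sum>\<^sub>j c\<^sub>i\<^sub>j y\<^sub>j \<le> M\<^sup>2\<close> for all \<open>i\<close>, where \<open>c\<^sub>i\<^sub>j = \<lfloor>M \<alpha>\<^sub>i\<^sub>j\<rfloor>\<close>. A dynamic program
  over the \<open>(M\<^sup>2 + 1)\<^sup>k\<close> vectors of right-hand sides counts them. The counts are too long for the bit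
  bound, so they are kept as floating point numbers \<open>m B\<^sup>e\<close>, always rounded up, with \<open>B \<ge> M\<^sup>2\<close>;
  each of the at most \<open>n M\<close> nested additions costs a factor \<open>(1 + 1/B)\<^sup>2\<close>.
\<close>

section \<open>Total correctness with step bounds\<close>

text \<open>The machine model shapes the program. Index values can be neither multiplied nor
  computed from numbers, so the number of states is found by counting, and the state reached from
  \<open>p\<close> by giving a coordinate the value \<open>y\<close> is searched among all states.
  This squares the number of states in the running time, which the exponents of order k absorb.
  Dividing by the side lengths \<open>u\<^sub>j\<close> is what makes the grid independent of L: a
  fixed grid on the cube could miss a polytope as thin as 2^(-L), whereas after scaling every unit
  vector satisfies every single constraint and the right-hand side 1 dominates the sum of n small
  coefficient errors. L then enters the time only through the renormalisation of the product of the
  scaling factors, and the number of steps obtained is in fact of order n^(O(k)) in n. All roundings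
  go upwards, so vol(P) <= Z' survives each of them and only the product of the error factors has to
  be controlled. The accuracy is replaced by a power of 1/2, because the encoding length of
  \<epsilon> itself is not restricted by the bit bound.\<close>

lemma num_set_num [simp]: "num (set_num s l r) x = (if x = addr s l then r else num s x)"
  by (simp add: set_num_def)

lemma idx_set_num [simp]: "idx (set_num s l r) = idx s"
  by (simp add: set_num_def)

lemma num_set_idx [simp]: "num (set_idx s l m) = num s"
  by (simp add: set_idx_def)

lemma idx_set_idx [simp]: "idx (set_idx s l m) x = (if x = addr s l then m else idx s x)"
  by (simp add: set_idx_def)

lemma addr_set_num [simp]: "addr (set_num s l r) l' = addr s l'"
  by (cases l') simp_all

text \<open>An \<open>exec\<close> derivation exists only for a halting run that respects the bit
  bound, so this is total correctness together with both resource bounds.\<close>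

definition run :: "real \<Rightarrow> com \<Rightarrow> store \<Rightarrow> nat \<Rightarrow> (store \<Rightarrow> bool) \<Rightarrow> bool" where
  "run B c s T Q \<longleftrightarrow> (\<exists>t s'. exec B c s t s' \<and> t \<le> T \<and> Q s')"

text \<open>Keeps the simplifier from rewriting programs and step bounds, which are matched syntactically.\<close>

lemma run_cong [cong]: "s = s' \<Longrightarrow> run B c s T Q = run B c s' T Q"
  by simp

lemma run_mono:
  assumes "run B c s T Q" and "T \<le> T'" and "\<And>s'. Q s' \<Longrightarrow> Q' s'"
  shows "run B c s T' Q'"
  using assms unfolding run_def by (meson le_trans)

lemma run_le: "run B c s T Q \<Longrightarrow> T \<le> T' \<Longrightarrow> run B c s T' Q"
  using run_mono by blast

lemma run_Seq:
  assumes "run B c1 s T1 R" and "\<And>s'. R s' \<Longrightarrow> run B c2 s' T2 Q"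
  shows "run B (Seq c1 c2) s (T1 + T2) Q"
  using assms unfolding run_def by (meson add_mono exec.Seq)

lemma run_Skip: "Q s \<Longrightarrow> run B Skip s T Q"
  unfolding run_def using exec.Skip by blast

lemma run_Cond:
  assumes "holds s g \<Longrightarrow> run B c1 s T Q" and "\<not> holds s g \<Longrightarrow> run B c2 s T Q"
  shows "run B (Cond g c1 c2) s (T + 1) Q"
proof (cases "holds s g")
  case True
  with assms(1) show ?thesis unfolding run_def by (meson CondT add_le_mono1)
next
  case False
  with assms(2) show ?thesis unfolding run_def by (meson CondF add_le_mono1)
qed

text \<open>The invariant carries the number of completed rounds. Since the guard can hold only
  while that number is below \<open>N\<close>, one invariant yields termination, the step count and
  the result. The extra steps are the tests, one per round and one that fails.\<close>

lemma run_Loop: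
  fixes I :: "nat \<Rightarrow> store \<Rightarrow> bool"
  assumes init: "I 0 s"
    and step: "\<And>i s. I i s \<Longrightarrow> holds s g \<Longrightarrow> i < N \<and> run B c s T (I (Suc i))"
    and exit: "\<And>i s. I i s \<Longrightarrow> \<not> holds s g \<Longrightarrow> Q s"
  shows "run B (Loop g c) s (N * (T + 1) + 1) Q"
proof -
  \<comment> \<open>Induction on the number \<open>d\<close> of rounds still possible, since fewer
    than \<open>N\<close> rounds may take place.\<close>
  have "run B (Loop g c) s (d * (T + 1) + 1) Q" if "I i s" "i + d = N" for i d s
    using that
  proof (induction d arbitrary: i s)
    case 0
    then have "\<not> holds s g" using step by fastforce
    with 0 show ?case unfolding run_def using exec.LoopF exit by fastforce
  next
    case (Suc d)
    show ?case
    proof (cases "holds s g")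
      case False
      with Suc.prems show ?thesis unfolding run_def using exec.LoopF exit by fastforce
    next
      case True
      obtain t s' where 1: "exec B c s t s'" "t \<le> T" "I (Suc i) s'"
        using step[OF Suc.prems(1) True] unfolding run_def by blast
      obtain t2 s2 where 2: "exec B (Loop g c) s' t2 s2" "t2 \<le> d * (T + 1) + 1" "Q s2"
        using Suc.IH[OF 1(3)] Suc.prems(2) unfolding run_def by auto
      have "exec B (Loop g c) s (t + t2 + 1) s2"
        using True 1(1) 2(1) by (rule exec.LoopT)
      moreover have "t + t2 + 1 \<le> Suc d * (T + 1) + 1" using 1(2) 2(2) by simp
      ultimately show ?thesis unfolding run_def using 2(3) by blast
    qed
  qed
  from this[OF init] show ?thesis by simp
qed

section \<open>Weakest preconditions of straight-line code\<close>

text \<open>Loops get the precondition \<open>False\<close>: the simplifier discharges straight-line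
  code, and every loop has to go through \<open>run_Loop\<close>.\<close>

fun wp :: "real \<Rightarrow> com \<Rightarrow> (store \<Rightarrow> bool) \<Rightarrow> store \<Rightarrow> bool" where
  "wp B Skip Q s = Q s"
| "wp B (AssignN l e) Q s \<longleftrightarrow>
     real_of_int (enc_len (nval s e)) \<le> B \<and> Q (set_num s l (nval s e))"
| "wp B (AssignI l e) Q s = Q (set_idx s l (ival s e))"
| "wp B (Seq c1 c2) Q s = wp B c1 (wp B c2 Q) s"
| "wp B (Cond g c1 c2) Q s = (if holds s g then wp B c1 Q s else wp B c2 Q s)"
| "wp B (Loop g c) Q s = False"

fun cost :: "com \<Rightarrow> nat" where
  "cost (Seq c1 c2) = cost c1 + cost c2"
| "cost (Cond g c1 c2) = max (cost c1) (cost c2) + 1"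
| "cost Skip = 0"
| "cost (AssignN l e) = 1"
| "cost (AssignI l e) = 1"
| "cost (Loop g c) = 0"

lemma wp_run: "wp B c Q s \<Longrightarrow> run B c s (cost c) Q"
proof (induction c arbitrary: Q s)
  case Skip
  then show ?case by (simp add: run_Skip)
next
  case (AssignN l e)
  then show ?case unfolding run_def by (auto intro!: exI exec.AssignN)
next
  case (AssignI l e)
  then show ?case unfolding run_def by (auto intro!: exI exec.AssignI)
next
  case (Seq c1 c2)
  then show ?case using run_Seq by (metis cost.simps(1) wp.simps(4))
next
  case (Cond g c1 c2)
  have "run B (Cond g c1 c2) s (max (cost c1) (cost c2) + 1) Q"
  proof (rule run_Cond)
    assume "holds s g"
    then have "run B c1 s (cost c1) Q" using Cond by simp
    then show "run B c1 s (max (cost c1) (cost c2)) Q" by (rule run_mono) simp_all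
  next
    assume "\<not> holds s g"
    then have "run B c2 s (cost c2) Q" using Cond by simp
    then show "run B c2 s (max (cost c1) (cost c2)) Q" by (rule run_mono) simp_all
  qed
  then show ?case unfolding cost.simps .
qed auto

lemma wp_runI: "wp B c Q s \<Longrightarrow> cost c \<le> T \<Longrightarrow> run B c s T Q"
  using run_mono wp_run by blast

lemma run_wp_Seq:
  "wp B c1 (\<lambda>s'. run B c2 s' Tb Q) s \<Longrightarrow> cost c1 + Tb \<le> T \<Longrightarrow> run B (Seq c1 c2) s T Q"
  by (rule run_mono[OF run_Seq[OF wp_run]])

lemma run_AssignI_Seq:
  "run B c (set_idx s l (ival s e)) T Q \<Longrightarrow> run B (Seq (AssignI l e) c) s (Suc T) Q"
  by (rule run_wp_Seq[where Tb = T]) simp_all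

lemma run_AssignN_Seq:
  "run B c (set_num s l (nval s e)) T Q \<Longrightarrow> real_of_int (enc_len (nval s e)) \<le> B
    \<Longrightarrow> run B (Seq (AssignN l e) c) s (Suc T) Q"
  by (rule run_wp_Seq[where Tb = T]) simp_all

lemma run_Seq_wp:
  "run B c1 s Ta R \<Longrightarrow> (\<And>s'. R s' \<Longrightarrow> wp B c2 Q s') \<Longrightarrow> Ta + cost c2 \<le> T
    \<Longrightarrow> run B (Seq c1 c2) s T Q"
  by (rule run_mono[OF run_Seq[OF _ wp_run]])

section \<open>Frame conditions\<close>

text \<open>\<open>V\<close> and \<open>W\<close> are the number and index cells that a piece of
  code may have changed. Supersets are allowed, so the frames of consecutive pieces can be joined
  under one pair of sets.\<close>

definition agree :: "(nat \<times> nat) set \<Rightarrow> (nat \<times> nat) set \<Rightarrow> store \<Rightarrow> store \<Rightarrow> bool" where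
  "agree V W s s' \<longleftrightarrow>
     (\<forall>x. x \<notin> V \<longrightarrow> num s' x = num s x) \<and> (\<forall>x. x \<notin> W \<longrightarrow> idx s' x = idx s x)"

lemma agree_refl [simp]: "agree V W s s"
  by (simp add: agree_def)

lemma agree_num: "agree V W s s' \<Longrightarrow> x \<notin> V \<Longrightarrow> num s' x = num s x"
  and agree_idx: "agree V W s s' \<Longrightarrow> x \<notin> W \<Longrightarrow> idx s' x = idx s x"
  unfolding agree_def by blast+

lemma agree_trans:
  "agree V W s s' \<Longrightarrow> agree V' W' s' s'' \<Longrightarrow> V' \<subseteq> V \<Longrightarrow> W' \<subseteq> W \<Longrightarrow> agree V W s s''"
  unfolding agree_def by (metis subsetD)

lemma agree_mono: "agree V W s s' \<Longrightarrow> V \<subseteq> V' \<Longrightarrow> W \<subseteq> W' \<Longrightarrow> agree V' W' s s'"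
  unfolding agree_def by blast

lemma agree_set_num [simp]: "addr s l \<in> V \<Longrightarrow> agree V W s0 (set_num s l r) = agree V W s0 s"
  unfolding agree_def num_set_num idx_set_num num_set_idx idx_set_idx by metis

lemma agree_set_idx [simp]: "addr s l \<in> W \<Longrightarrow> agree V W s0 (set_idx s l r) = agree V W s0 s"
  unfolding agree_def num_set_num idx_set_num num_set_idx idx_set_idx by metis

section \<open>Volumes\<close>

abbreviation cube_measure :: "nat \<Rightarrow> (nat \<Rightarrow> real) measure" where
  "cube_measure n \<equiv> Pi\<^sub>M {..<n} (\<lambda>_. lborel)"

interpretation lborel_product: product_sigma_finite "\<lambda>_::nat. lborel :: real measure"
  by standard

section \<open>Dilates and boxes under product Lebesgue measure\<close>

lemma emeasure_lborel_scale:
  fixes r :: real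
  assumes "r > 0" and [measurable]: "A \<in> sets borel"
  shows "ennreal r * emeasure lborel ((*) r -` A) = emeasure lborel A"
proof -
  have "emeasure lborel A = emeasure (density (distr lborel borel ((*) r)) (\<lambda>_. \<bar>r\<bar>)) A"
    using lborel_distr_mult'[of r] assms by simp
  also have "\<dots> = ennreal r * emeasure lborel ((*) r -` A)"
    using assms by (simp add: emeasure_density_const emeasure_distr)
  finally show ?thesis by simp
qed

text \<open>Both sides are measures in \<open>A\<close>. On boxes they agree by the one-dimensional
  case in each coordinate, and boxes determine a product measure.\<close>

lemma emeasure_scale:
  assumes r: "r > 0" and A: "A \<in> sets (cube_measure n)"
  shows "ennreal (r ^ n) * emeasure (cube_measure n)
           ((\<lambda>x. \<lambda>j\<in>{..<n}. r * x j) -` A \<inter> space (cube_measure n)) = emeasure (cube_measure n) A"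
proof -
  let ?T = "\<lambda>x. \<lambda>j\<in>{..<n}. r * x j"
  let ?P = "scale_measure (ennreal (r ^ n)) (distr (cube_measure n) (cube_measure n) ?T)"
  have T [measurable]: "?T \<in> measurable (cube_measure n) (cube_measure n)"
    by measurable
  have "?P = cube_measure n"
  proof (rule lborel_product.PiM_eqI)
    fix C :: "nat \<Rightarrow> real set"
    assume C: "\<And>i. i \<in> {..<n} \<Longrightarrow> C i \<in> sets lborel"
    have m: "Pi\<^sub>E {..<n} C \<in> sets (cube_measure n)"
      using C by (intro sets_PiM_I_finite) auto
    have "?T -` Pi\<^sub>E {..<n} C \<inter> space (cube_measure n) = (\<Pi>\<^sub>E i\<in>{..<n}. (*) r -` C i)"
      by (auto simp: space_PiM PiE_def Pi_def)
    then have "emeasure ?P (Pi\<^sub>E {..<n} C)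
        = ennreal (r ^ n) * emeasure (cube_measure n) (\<Pi>\<^sub>E i\<in>{..<n}. (*) r -` C i)"
      using m by (simp add: emeasure_distr)
    also have "emeasure (cube_measure n) (\<Pi>\<^sub>E i\<in>{..<n}. (*) r -` C i)
        = (\<Prod>i<n. emeasure lborel ((*) r -` C i))"
    proof (rule lborel_product.emeasure_PiM)
      fix i assume "i \<in> {..<n}"
      then have "C i \<in> sets borel" using C by simp
      then have "(*) r -` C i \<inter> space borel \<in> sets borel" by (intro measurable_sets) auto
      then show "(*) r -` C i \<in> sets lborel" by simp
    qed simp
    also have "ennreal (r ^ n) * \<dots> = (\<Prod>i<n. ennreal r * emeasure lborel ((*) r -` C i))"
      using r by (simp add: prod.distrib ennreal_power)
    also have "\<dots> = (\<Prod>i<n. emeasure lborel (C i))"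
      using C r by (intro prod.cong refl emeasure_lborel_scale) auto
    finally show "emeasure ?P (Pi\<^sub>E {..<n} C) = (\<Prod>i<n. emeasure lborel (C i))" .
  qed simp_all
  then have "emeasure (cube_measure n) A = emeasure ?P A" by simp
  also have "\<dots> = ennreal (r ^ n) * emeasure (cube_measure n) (?T -` A \<inter> space (cube_measure n))"
    using A by (simp add: emeasure_distr)
  finally show ?thesis by simp
qed

text \<open>Closed boxes serve to cover the polytope, half-open ones to pack disjoint cells into a
  dilate of it.\<close>

lemma emeasure_box:
  assumes "\<And>j. j < n \<Longrightarrow> l j \<le> r j"
  shows "emeasure (cube_measure n) (\<Pi>\<^sub>E j\<in>{..<n}. {l j..r j}) = ennreal (\<Prod>j<n. r j - l j)"
    and "emeasure (cube_measure n) (\<Pi>\<^sub>E j\<in>{..<n}. {l j..<r j}) = ennreal (\<Prod>j<n. r j - l j)"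
proof -
  have p: "(\<Prod>j<n. ennreal (r j - l j)) = ennreal (\<Prod>j<n. r j - l j)"
    using assms by (intro prod_ennreal) auto
  show "emeasure (cube_measure n) (\<Pi>\<^sub>E j\<in>{..<n}. {l j..r j}) = ennreal (\<Prod>j<n. r j - l j)"
    using assms by (subst lborel_product.emeasure_PiM) (simp_all flip: p)
  show "emeasure (cube_measure n) (\<Pi>\<^sub>E j\<in>{..<n}. {l j..<r j}) = ennreal (\<Prod>j<n. r j - l j)"
    using assms by (subst lborel_product.emeasure_PiM) (simp_all flip: p)
qed

lemma sets_polytope_in_cube [measurable]:
  "polytope_in_cube k n A b \<in> sets (cube_measure n)"
proof -
  have "polytope_in_cube k n A b = {x \<in> space (cube_measure n).
      (\<forall>j\<in>{..<n}. 0 \<le> x j \<and> x j \<le> 1) \<and>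
      (\<forall>i\<in>{..<k}. (\<Sum>j<n. real_of_int (A i j) * x j) \<le> real_of_int (b i))}"
    by (auto simp: polytope_in_cube_def space_PiM PiE_def Pi_def extensional_def)
  also have "\<dots> \<in> sets (cube_measure n)"
    by measurable
  finally show ?thesis .
qed

lemma emeasure_polytope_in_cube:
  "emeasure (cube_measure n) (polytope_in_cube k n A b) = ennreal (vol n (polytope_in_cube k n A b))"
proof -
  have "emeasure (cube_measure n) (polytope_in_cube k n A b)
      \<le> emeasure (cube_measure n) (\<Pi>\<^sub>E j\<in>{..<n}. {0..1})"
  proof (rule emeasure_mono)
    show "(\<Pi>\<^sub>E j\<in>{..<n}. {0..1}) \<in> sets (cube_measure n)"
      by (intro sets_PiM_I_finite) auto
  qed (auto simp: polytope_in_cube_def)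
  also have "\<dots> = 1" using emeasure_box(1)[of n "\<lambda>_. 0" "\<lambda>_. 1"] by simp
  finally show ?thesis
    unfolding vol_def by (intro emeasure_eq_ennreal_measure) (auto simp: top_unique)
qed

section \<open>Degenerate polytopes\<close>

lemma vol_eq_0_if_negative:
  assumes "\<forall>i<k. \<forall>j<n. 0 \<le> A i j" and "i < k" and "b i < 0"
  shows "vol n (polytope_in_cube k n A b) = 0"
proof -
  have "polytope_in_cube k n A b = {}"
  proof (rule equals0I)
    fix x assume x: "x \<in> polytope_in_cube k n A b"
    then have "0 \<le> (\<Sum>j<n. real_of_int (A i j) * x j)"
      using assms by (intro sum_nonneg mult_nonneg_nonneg) (auto simp: polytope_in_cube_def)
    with x assms show False by (fastforce simp: polytope_in_cube_def)
  qed
  then show ?thesis by (simp add: vol_def)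
qed

text \<open>All terms of the row are nonnegative, so the term of \<open>j\<close> alone is at most
  0. This confines the polytope to a box whose side \<open>j\<close> is a point.\<close>

lemma vol_eq_0_if_flat:
  assumes A: "\<forall>i<k. \<forall>j<n. 0 \<le> A i j" and i: "i < k" and "b i \<le> 0" and j: "j < n" and "0 < A i j"
  shows "vol n (polytope_in_cube k n A b) = 0"
proof -
  have "polytope_in_cube k n A b \<subseteq> (\<Pi>\<^sub>E m\<in>{..<n}. if m = j then {0..0} else {0..1})"
  proof
    fix x assume x: "x \<in> polytope_in_cube k n A b"
    have 01: "0 \<le> x m" "x m \<le> 1" if "m < n" for m
      using x that by (auto simp: polytope_in_cube_def PiE_def Pi_def)
    have "real_of_int (A i j) * x j \<le> (\<Sum>m<n. real_of_int (A i m) * x m)"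
      using A i j 01 by (intro member_le_sum) auto
    also have "\<dots> \<le> 0" using x i \<open>b i \<le> 0\<close> by (force simp: polytope_in_cube_def)
    finally have "x j \<le> 0" using \<open>0 < A i j\<close> by (simp add: mult_le_0_iff)
    with 01 j have "x j = 0" by (simp add: order_antisym)
    with x 01 show "x \<in> (\<Pi>\<^sub>E m\<in>{..<n}. if m = j then {0..0} else {0..1})"
      by (auto simp: polytope_in_cube_def PiE_def Pi_def)
  qed
  moreover have "(\<Pi>\<^sub>E m\<in>{..<n}. if m = j then {0..0} else {0..1}) \<in> sets (cube_measure n)"
    by (intro sets_PiM_I_finite) auto
  ultimately have "emeasure (cube_measure n) (polytope_in_cube k n A b)
      \<le> emeasure (cube_measure n) (\<Pi>\<^sub>E m\<in>{..<n}. if m = j then {0..0::real} else {0..1})"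
    by (rule emeasure_mono)
  also have "(\<lambda>m. if m = j then {0..0::real} else {0..1}) = (\<lambda>m. {0..if m = j then 0 else 1})"
    by (rule ext) simp
  also have "emeasure (cube_measure n) (Pi\<^sub>E {..<n} \<dots>) = ennreal (\<Prod>m<n. if m = j then 0 else 1)"
    by (subst emeasure_box) auto
  also have "(\<Prod>m<n. if m = j then 0 else 1) = (0::real)"
    using j by (intro prod_zero) auto
  finally show ?thesis by (simp add: vol_def measure_def)
qed

section \<open>Comparison of the volume with a count of grid cells\<close>

text \<open>Each \<open>y\<close> in \<open>W\<close> names a grid cell with sides
  \<open>u j / M\<close>. Rounding a point of \<open>P\<close> down lands in \<open>W\<close>,
  because coefficients and coordinates both shrink, so the cells cover \<open>P\<close>. Conversely,
  rounding back up costs at most \<open>3 * M\<close> per term against the right-hand side M^2, so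
  the cells without their upper faces fit disjointly into the dilate of \<open>P\<close> by
  \<open>1 + 3 * n / M\<close>.\<close>

lemma vol_approx_by_count:
  fixes u :: "nat \<Rightarrow> real" and c :: "nat \<Rightarrow> nat \<Rightarrow> nat" and k n M :: nat
    and A :: "nat \<Rightarrow> nat \<Rightarrow> int" and b :: "nat \<Rightarrow> int"
  defines "P \<equiv> polytope_in_cube k n A b"
  defines "W \<equiv> {y \<in> {..<n} \<rightarrow>\<^sub>E {..<M}. \<forall>i<k. (\<Sum>j<n. c i j * y j) \<le> M\<^sup>2}"
  assumes A: "\<forall>i<k. \<forall>j<n. 0 \<le> A i j" and b: "\<forall>i<k. 0 \<le> b i" and M: "M \<ge> 1"
    and u: "\<And>j. j < n \<Longrightarrow> 0 < u j \<and> u j \<le> 1"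
    and Au: "\<And>i j. i < k \<Longrightarrow> j < n \<Longrightarrow> A i j * u j \<le> b i"
    and Pu: "\<And>x j. x \<in> P \<Longrightarrow> j < n \<Longrightarrow> x j \<le> u j"
    and c: "\<And>i j. i < k \<Longrightarrow> j < n \<Longrightarrow>
        real (c i j) \<le> real M * real_of_int (A i j) * u j / b i
        \<and> real M * real_of_int (A i j) * u j / b i < real (c i j) + 1"
  shows "vol n P \<le> card W * (\<Prod>j<n. u j / M)"
    and "card W * (\<Prod>j<n. u j / M) \<le> (1 + 3 * n / M) ^ n * vol n P"
proof -
  have M0: "real M > 0" using M by simp
  have P: "P \<in> sets (cube_measure n)" unfolding P_def by measurable
  have finW: "finite W" unfolding W_def
    by (rule finite_subset[of _ "{..<n} \<rightarrow>\<^sub>E {..<M}"]) (auto intro: finite_PiE)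
  have Wlt: "y j < M" if "y \<in> W" "j < n" for y j
    using that by (auto simp: W_def PiE_def Pi_def)
  define lo hi where "lo y j = u j * real (y j) / M" and "hi y j = u j * (real (y j) + 1) / M"
    for y :: "nat \<Rightarrow> nat" and j
  have lohi: "lo y j \<le> hi y j" if "j < n" for y j
    using u[OF that] by (simp add: lo_def hi_def divide_right_mono)
  have diff: "hi y j - lo y j = u j / M" for y j
    by (simp add: lo_def hi_def distrib_left add_divide_distrib)
  have nonneg: "0 \<le> (\<Prod>j<n. u j / M)"
    using u by (intro prod_nonneg) (auto simp: less_imp_le)

  define Q where "Q y = (\<Pi>\<^sub>E j\<in>{..<n}. {lo y j..hi y j})" for y
  have Qs: "Q y \<in> sets (cube_measure n)" for y
    unfolding Q_def by (intro sets_PiM_I_finite) auto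
  have "P \<subseteq> (\<Union>y\<in>W. Q y)"
  proof
    fix x assume x: "x \<in> P"
    then have 01: "0 \<le> x j" "x j \<le> 1" if "j < n" for j
      using that by (auto simp: P_def polytope_in_cube_def PiE_def Pi_def)
    have Ax: "(\<Sum>j<n. real_of_int (A i j) * x j) \<le> real_of_int (b i)" if "i < k" for i
      using x that by (auto simp: P_def polytope_in_cube_def)
    \<comment> \<open>The cap \<open>M - 1\<close> puts points with \<open>x j = u j\<close> into
      the last cell; for their sake the covering cells are closed.\<close>
    define y where "y = (\<lambda>j\<in>{..<n}. min (M - 1) (nat \<lfloor>M * x j / u j\<rfloor>))"
    have q: "0 \<le> M * x j / u j" "M * x j / u j \<le> M" if "j < n" for j
      using 01[OF that] u[OF that] Pu[OF x that] by (auto simp: divide_le_eq intro: mult_left_mono)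
    have y1: "real (y j) \<le> M * x j / u j" and y2: "M * x j / u j \<le> real (y j) + 1" and y3: "y j < M"
      if j: "j < n" for j
    proof -
      have "real (y j) \<le> real (nat \<lfloor>M * x j / u j\<rfloor>)" using j by (simp add: y_def)
      also have "\<dots> \<le> M * x j / u j" using q[OF j] by simp
      finally show "real (y j) \<le> M * x j / u j" .
      show "M * x j / u j \<le> real (y j) + 1"
        using q[OF j] j M by (auto simp: y_def min_def of_nat_diff) linarith?
      show "y j < M" using j M by (simp add: y_def min_less_iff_disj)
    qed
    have "(\<Sum>j<n. c i j * y j) \<le> M\<^sup>2" if i: "i < k" for i
    proof (cases "b i = 0")
      case True
      \<comment> \<open>Division by zero gives zero, so the hypothesis on \<open>c\<close> bounds
        the coefficients of this row by 0.\<close>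
      then have "c i j = 0" if "j < n" for j using c[OF i that] by simp
      then show ?thesis by simp
    next
      case False
      then have bi: "real_of_int (b i) > 0" using b i by (metis of_int_0_less_iff order_le_less)
      have "real (\<Sum>j<n. c i j * y j) \<le> (\<Sum>j<n. (real M * real_of_int (A i j) * u j / b i) * (M * x j / u j))"
        unfolding of_nat_sum of_nat_mult
        using c[OF i] y1 01 u by (intro sum_mono mult_mono) (force intro: order_trans[of 0])+
      also have "\<dots> = (\<Sum>j<n. (M\<^sup>2 / b i) * (A i j * x j))"
        using u by (intro sum.cong refl) (fastforce simp: power2_eq_square)
      also have "\<dots> = (M\<^sup>2 / b i) * (\<Sum>j<n. A i j * x j)" by (simp add: sum_distrib_left)
      also have "\<dots> \<le> (M\<^sup>2 / b i) * b i"
        using Ax[OF i] bi by (intro mult_left_mono) auto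
      also have "\<dots> = real (M\<^sup>2)" using bi by simp
      finally show ?thesis using of_nat_le_iff by blast
    qed
    then have "y \<in> W" using y3 by (auto simp: W_def y_def)
    moreover have "x \<in> Q y"
      unfolding Q_def
    proof (rule PiE_I)
      fix j assume "j \<in> {..<n}"
      then have j: "j < n" by simp
      have u0: "u j > 0" using u[OF j] by simp
      show "x j \<in> {lo y j..hi y j}"
        using y1[OF j] y2[OF j] u0 M0 by (simp add: lo_def hi_def field_simps)
    qed (use x in \<open>auto simp: P_def polytope_in_cube_def\<close>)
    ultimately show "x \<in> (\<Union>y\<in>W. Q y)" by blast
  qed
  then have "emeasure (cube_measure n) P \<le> emeasure (cube_measure n) (\<Union>y\<in>W. Q y)"
    using Qs finW by (intro emeasure_mono) auto
  also have "\<dots> \<le> (\<Sum>y\<in>W. emeasure (cube_measure n) (Q y))"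
    using Qs finW by (intro emeasure_subadditive_finite) auto
  also have "\<dots> = (\<Sum>y\<in>W. ennreal (\<Prod>j<n. u j / M))"
    unfolding Q_def using lohi by (intro sum.cong refl) (simp add: emeasure_box diff)
  also have "\<dots> = ennreal (card W * (\<Prod>j<n. u j / M))"
    using nonneg by (simp add: ennreal_mult ennreal_of_nat_eq_real_of_nat)
  finally show "vol n P \<le> card W * (\<Prod>j<n. u j / M)"
    using nonneg unfolding P_def emeasure_polytope_in_cube by simp

  define r where "r = 1 + 3 * n / M"
  have r1: "r \<ge> 1" using M0 by (simp add: r_def)
  let ?T = "\<lambda>x. \<lambda>j\<in>{..<n}. r * x j"
  define Q' where "Q' y = (\<Pi>\<^sub>E j\<in>{..<n}. {lo y j..<hi y j})" for y
  have Q's: "Q' y \<in> sets (cube_measure n)" for y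
    unfolding Q'_def by (intro sets_PiM_I_finite) auto
  have disj: "disjoint_family_on Q' W"
    unfolding disjoint_family_on_def
  proof (intro ballI impI)
    fix y y' assume y: "y \<in> W" "y' \<in> W" "y \<noteq> y'"
    have "y \<in> {..<n} \<rightarrow>\<^sub>E {..<M}" "y' \<in> {..<n} \<rightarrow>\<^sub>E {..<M}"
      using y by (simp_all add: W_def)
    with y(3) have "\<exists>j<n. y j \<noteq> y' j" by (metis PiE_ext lessThan_iff)
    then obtain j where j: "j < n" "y j \<noteq> y' j" by blast
    have le: "hi z j \<le> lo z' j" if "z j < z' j" for z z' :: "nat \<Rightarrow> nat"
      using that u[OF j(1)] M0 unfolding hi_def lo_def
      by (intro divide_right_mono mult_left_mono) auto
    show "Q' y \<inter> Q' y' = {}"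
    proof (rule equals0I)
      fix x assume "x \<in> Q' y \<inter> Q' y'"
      then have "lo y j \<le> x j" "x j < hi y j" "lo y' j \<le> x j" "x j < hi y' j"
        using j(1) by (auto simp: Q'_def PiE_def Pi_def)
      then show False using j(2) le[of y y'] le[of y' y] by linarith
    qed
  qed
  \<comment> \<open>The preimage under shrinking by \<open>r\<close> is the dilate of
    \<open>P\<close> by \<open>r\<close>; \<open>emeasure_scale\<close> relates its measure to that
    of \<open>P\<close>.\<close>
  let ?S = "(\<lambda>x. \<lambda>j\<in>{..<n}. (1/r) * x j) -` P \<inter> space (cube_measure n)"
  have S: "?S \<in> sets (cube_measure n)"
    by (rule measurable_sets[OF _ P]) measurable
  have sub: "(\<Union>y\<in>W. Q' y) \<subseteq> ?S"
  proof
    fix x assume "x \<in> (\<Union>y\<in>W. Q' y)"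
    then obtain y where y: "y \<in> W" "x \<in> Q' y" by blast
    have lo: "lo y j \<le> x j" and hi: "x j \<le> hi y j" if "j < n" for j
      using y that by (auto simp: Q'_def PiE_def Pi_def less_imp_le)
    have x0: "0 \<le> x j" if "j < n" for j
      using lo[OF that] u[OF that] M0 by (auto simp: lo_def intro: order_trans[rotated])
    have x1: "x j \<le> u j" if "j < n" for j
    proof -
      have "hi y j \<le> u j * M / M"
        using Wlt[OF y(1) that] u[OF that] unfolding hi_def
        by (intro divide_right_mono mult_left_mono) auto
      with hi[OF that] M0 show ?thesis by simp
    qed
    have sum: "(\<Sum>j<n. A i j * x j) \<le> r * b i" if i: "i < k" for i
    proof (cases "b i = 0")
      case True
      \<comment> \<open>With right-hand side 0, \<open>Au\<close> and \<open>u j > 0\<close> leave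
        only zero entries in the row.\<close>
      have "A i j = 0" if j: "j < n" for j
      proof -
        have "real_of_int (A i j) * u j \<le> 0" using Au[OF i j] True by simp
        then have "A i j \<le> 0" using u[OF j] by (simp add: mult_le_0_iff)
        then show ?thesis using A i j by (simp add: order_antisym)
      qed
      then show ?thesis using True by simp
    next
      case False
      then have bi: "real_of_int (b i) > 0" using b i by (metis of_int_0_less_iff order_le_less)
      have cM: "c i j \<le> M" if j: "j < n" for j
      proof -
        have "real M * A i j * u j / b i \<le> M"
          using Au[OF i j] bi M0 by (simp add: field_simps)
        with c[OF i j] have "real (c i j) \<le> real M" by linarith
        then show ?thesis by simp
      qed
      \<comment> \<open>\<open>c i j + 1\<close> bounds the unrounded coefficient and
        \<open>y j + 1\<close> the upper corner of the cell. The product exceeds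
        \<open>c i j * y j\<close> by at most \<open>2 * M + 1\<close>, which is at most
        \<open>3 * M\<close>: the origin of the factor 3.\<close>
      have "(\<Sum>j<n. (real (c i j) + 1) * (real (y j) + 1))
          \<le> (\<Sum>j<n. real (c i j * y j) + real M + real M + 1)"
      proof (rule sum_mono)
        fix j assume "j \<in> {..<n}"
        then have "c i j \<le> M" "y j < M" using cM Wlt[OF y(1)] by auto
        then show "(real (c i j) + 1) * (real (y j) + 1) \<le> real (c i j * y j) + real M + real M + 1"
          by (simp add: algebra_simps)
      qed
      also have "\<dots> = real (\<Sum>j<n. c i j * y j) + real (n * (2 * M + 1))"
        by (simp add: sum.distrib algebra_simps)
      also have "\<dots> \<le> real (M\<^sup>2) + real (n * (3 * M))"
      proof (rule add_mono)
        show "real (\<Sum>j<n. c i j * y j) \<le> real (M\<^sup>2)"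
          using y(1) i unfolding of_nat_le_iff by (simp add: W_def)
        have "n * (2 * M + 1) \<le> n * (3 * M)" using M by (intro mult_le_mono2) simp
        then show "real (n * (2 * M + 1)) \<le> real (n * (3 * M))" unfolding of_nat_le_iff .
      qed
      also have "\<dots> = (real M)\<^sup>2 * r" using M0 by (simp add: r_def power2_eq_square field_simps)
      finally have *: "(\<Sum>j<n. (real (c i j) + 1) * (real (y j) + 1)) \<le> (real M)\<^sup>2 * r" .
      have "(\<Sum>j<n. A i j * x j) \<le> (\<Sum>j<n. (b i / M\<^sup>2) * ((real (c i j) + 1) * (real (y j) + 1)))"
      proof (rule sum_mono)
        fix j assume "j \<in> {..<n}"
        then have j: "j < n" by simp
        have "A i j * x j \<le> A i j * hi y j"
          using A i j hi[OF j] by (intro mult_left_mono) auto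
        also have "\<dots> = (b i / M\<^sup>2) * ((real M * real_of_int (A i j) * u j / b i) * (real (y j) + 1))"
          using bi M0 by (simp add: hi_def power2_eq_square)
        also have "\<dots> \<le> (b i / M\<^sup>2) * ((real (c i j) + 1) * (real (y j) + 1))"
          using c[OF i j] bi by (intro mult_left_mono mult_right_mono) auto
        finally show "A i j * x j \<le> (b i / M\<^sup>2) * ((real (c i j) + 1) * (real (y j) + 1))" .
      qed
      also have "\<dots> = (b i / M\<^sup>2) * (\<Sum>j<n. (real (c i j) + 1) * (real (y j) + 1))"
        by (simp add: sum_distrib_left)
      also have "\<dots> \<le> (b i / M\<^sup>2) * ((real M)\<^sup>2 * r)"
        using * bi by (intro mult_left_mono) auto
      also have "\<dots> = r * b i" using M0 by simp
      finally show ?thesis .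
    qed
    have "(\<lambda>j\<in>{..<n}. (1/r) * x j) \<in> P"
      unfolding P_def polytope_in_cube_def
    proof (intro CollectI conjI allI impI PiE_I)
      fix j assume "j \<in> {..<n}"
      then have j: "j < n" by simp
      have "x j \<le> r" using x1[OF j] u[OF j] r1 by linarith
      then show "(\<lambda>j\<in>{..<n}. (1/r) * x j) j \<in> {0..1}"
        using j x0[OF j] r1 by simp
    next
      fix i assume i: "i < k"
      have "(\<Sum>j<n. A i j * (\<lambda>j\<in>{..<n}. (1/r) * x j) j) = (1/r) * (\<Sum>j<n. A i j * x j)"
        by (simp add: sum_distrib_left)
      also have "\<dots> \<le> (1/r) * (r * b i)" using sum[OF i] r1 by (intro mult_left_mono) auto
      also have "\<dots> = b i" using r1 by simp
      finally show "(\<Sum>j<n. A i j * (\<lambda>j\<in>{..<n}. (1/r) * x j) j) \<le> b i" .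
    qed simp
    moreover have "x \<in> space (cube_measure n)" using y(2) by (auto simp: Q'_def space_PiM)
    ultimately show "x \<in> ?S" by simp
  qed
  have "ennreal (card W * (\<Prod>j<n. u j / M)) = (\<Sum>y\<in>W. ennreal (\<Prod>j<n. u j / M))"
    using nonneg by (simp add: ennreal_mult ennreal_of_nat_eq_real_of_nat)
  also have "\<dots> = (\<Sum>y\<in>W. emeasure (cube_measure n) (Q' y))"
    unfolding Q'_def using lohi by (intro sum.cong refl) (simp add: emeasure_box diff)
  also have "\<dots> = emeasure (cube_measure n) (\<Union>y\<in>W. Q' y)"
    using Q's finW disj by (intro sum_emeasure) auto
  also have "\<dots> \<le> emeasure (cube_measure n) ?S"
    using S sub by (intro emeasure_mono)
  also have "\<dots> = ennreal (r ^ n) * (ennreal ((1/r) ^ n) * emeasure (cube_measure n) ?S)"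
    using r1 by (simp flip: mult.assoc ennreal_mult add: power_one_over)
  also have "\<dots> = ennreal (r ^ n) * emeasure (cube_measure n) P"
    using emeasure_scale[OF _ P, of "1/r"] r1 by simp
  also have "\<dots> = ennreal (r ^ n * vol n P)"
    using r1 unfolding P_def emeasure_polytope_in_cube by (simp add: ennreal_mult vol_def)
  finally show "card W * (\<Prod>j<n. u j / M) \<le> (1 + 3 * n / M) ^ n * vol n P"
    using r1 by (simp add: r_def vol_def)
qed

section \<open>Counting lattice points with floating point numbers\<close>

definition digit :: "nat \<Rightarrow> nat \<Rightarrow> nat \<Rightarrow> nat" where
  "digit S p i = p div S ^ i mod S"

lemma digit_less: "S > 0 \<Longrightarrow> digit S p i < S"
  by (simp add: digit_def)

lemma digit_0 [simp]: "digit S 0 i = 0"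
  by (simp add: digit_def)

lemma power_split:
  "i < k \<Longrightarrow> (S::nat) ^ k = S ^ i * (S * S ^ (k - Suc i))"
  by (metis Suc_diff_Suc le_add_diff_inverse less_imp_le_nat power_Suc power_add)

lemma digit_power [simp]: "S > 0 \<Longrightarrow> i < k \<Longrightarrow> digit S (S ^ k) i = 0"
  unfolding digit_def by (subst power_split[of i k]) simp_all

text \<open>The last state has the largest digit everywhere. With \<open>S = M * M + 1\<close> these
  digits are the right-hand sides of the full counting problem.\<close>

lemma digit_power_minus_1:
  assumes "S > 0" and "i < k"
  shows "digit S (S ^ k - 1) i = S - 1"
proof -
  define h where "h = S ^ (k - Suc i) - 1"
  have "S ^ (k - Suc i) = h + 1" using assms by (simp add: h_def)
  then have "S ^ k = S ^ i * (S * (h + 1))" using power_split[OF assms(2)] by metis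
  moreover have "S * (h + 1) = Suc (S * h + (S - 1))" using assms by simp
  ultimately have *: "S ^ k = S ^ i * (S * h + (S - 1)) + S ^ i"
    by (simp only: mult_Suc_right add.commute)
  have S: "S ^ i > 0" using assms by simp
  define z where "z = S * h + (S - 1)"
  have "S ^ k - 1 = S ^ i * z + (S ^ i - 1)"
    using S * unfolding z_def by linarith
  then have "(S ^ k - 1) div S ^ i = (S ^ i * z + (S ^ i - 1)) div S ^ i"
    by simp
  also have "\<dots> = z" using S by simp
  finally have "digit S (S ^ k - 1) i = z mod S" by (simp add: digit_def)
  then show ?thesis using assms(1) unfolding z_def by (simp only: mod_mult_self4) simp
qed

text \<open>A carry arrives at digit \<open>i\<close> exactly if all lower digits were maximal, that
  is, if \<open>S ^ i\<close> divides \<open>Suc p\<close>. Together with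
  \<open>digit_Suc_no_carry\<close> this describes one round of the odometer.\<close>

lemma digit_Suc_carry:
  assumes "S > 1" and "S ^ i dvd Suc p"
  shows "digit S (Suc p) i = (if digit S p i + 1 = S then 0 else digit S p i + 1)"
    and "S ^ Suc i dvd Suc p \<longleftrightarrow> digit S p i + 1 = S"
proof -
  have d: "Suc p div S ^ i = Suc (p div S ^ i)"
    using assms(2) by (simp add: div_Suc dvd_eq_mod_eq_0)
  show 1: "digit S (Suc p) i = (if digit S p i + 1 = S then 0 else digit S p i + 1)"
    unfolding digit_def d by (simp add: mod_Suc)
  have "S ^ Suc i dvd Suc p \<longleftrightarrow> S dvd Suc p div S ^ i"
    using assms by (simp add: dvd_div_iff_mult)
  also have "\<dots> \<longleftrightarrow> digit S (Suc p) i = 0" by (simp add: digit_def dvd_eq_mod_eq_0)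
  also have "\<dots> \<longleftrightarrow> digit S p i + 1 = S" by (simp add: 1)
  finally show "S ^ Suc i dvd Suc p \<longleftrightarrow> digit S p i + 1 = S" .
qed

lemma digit_Suc_no_carry:
  assumes "\<not> S ^ i dvd Suc p"
  shows "digit S (Suc p) i = digit S p i" and "\<not> S ^ Suc i dvd Suc p"
proof -
  show "digit S (Suc p) i = digit S p i"
    using assms unfolding digit_def div_Suc dvd_eq_mod_eq_0 by (simp only: if_False)
  show "\<not> S ^ Suc i dvd Suc p"
    using assms dvd_mult_right[of S "S ^ i" "Suc p"] by (simp only: power_Suc) blast
qed

lemma digit_exists:
  assumes "\<And>i. i < k \<Longrightarrow> v i < S"
  shows "\<exists>p < S ^ k. \<forall>i<k. digit S p i = v i"
  using assms
proof (induction k)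
  case (Suc k)
  then obtain p where p: "p < S ^ k" "\<forall>i<k. digit S p i = v i" by force
  have S: "S > 0" "v k < S" using Suc.prems[of k] by simp_all
  let ?p = "p + S ^ k * v k"
  have "?p < S ^ k + S ^ k * v k" using p by simp
  also have "\<dots> = S ^ k * Suc (v k)" by simp
  also have "\<dots> \<le> S ^ k * S" using S by (intro mult_left_mono) auto
  finally have "?p < S ^ Suc k" by (simp add: mult.commute)
  moreover have "digit S ?p i = v i" if "i < Suc k" for i
  proof (cases "i = k")
    case True
    then show ?thesis using p S by (simp add: digit_def)
  next
    case False
    with that have i: "i < k" by simp
    have "S ^ k * v k = S ^ i * (S * (S ^ (k - Suc i) * v k))"
      by (subst power_split[OF i]) (simp only: mult.assoc)
    moreover have "(p + S ^ i * z) div S ^ i = p div S ^ i + z" for z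
      using S by simp
    ultimately have "digit S ?p i = digit S p i"
      unfolding digit_def by (simp only: mod_mult_self2)
    then show ?thesis using p i by simp
  qed
  ultimately show ?case by blast
qed simp

text \<open>By counting: \<open>digit_exists\<close> makes the digit map onto the
  \<open>S ^ k\<close> vectors, and a surjection between finite sets of equal size is
  injective.\<close>

lemma digit_inject:
  assumes "p < S ^ k" and "q < S ^ k" and "\<forall>i<k. digit S p i = digit S q i"
  shows "p = q"
proof (cases "S = 0")
  case True
  with assms show ?thesis by (cases k) auto
next
  case False
  let ?f = "\<lambda>p. \<lambda>i\<in>{..<k}. digit S p i"
  have "?f ` {..<S ^ k} = {..<k} \<rightarrow>\<^sub>E {..<S}"
  proof (intro equalityI subsetI)
    fix v assume v: "v \<in> {..<k} \<rightarrow>\<^sub>E {..<S}"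
    have "v i < S" if "i < k" for i using v that by auto
    from digit_exists[of k v S, OF this] obtain p
      where p: "p < S ^ k" and d: "\<And>i. i < k \<Longrightarrow> digit S p i = v i" by blast
    have "?f p i = v i" for i
      using d[of i] v by (cases "i < k") (simp_all add: PiE_def extensional_def)
    then have "?f p = v" by (rule ext)
    with p have "p \<in> {..<S ^ k}" "v = ?f p" by auto
    then show "v \<in> ?f ` {..<S ^ k}" by blast
  qed (use False in \<open>auto intro: digit_less split: if_splits\<close>)
  then have "card (?f ` {..<S ^ k}) = card {..<S ^ k}" by (simp add: card_PiE)
  then have "inj_on ?f {..<S ^ k}" by (intro eq_card_imp_inj_on) auto
  moreover have "?f p = ?f q" using assms(3) by (intro ext) simp
  ultimately show ?thesis using assms(1,2) by (simp add: inj_on_def)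
qed

section \<open>The recurrence of the dynamic program\<close>

text \<open>The exact table entry after \<open>j\<close> coordinates, with the digits of
  \<open>p\<close> as the right-hand sides still available.\<close>

definition tally :: "nat \<Rightarrow> nat \<Rightarrow> nat \<Rightarrow> (nat \<Rightarrow> nat \<Rightarrow> nat) \<Rightarrow> nat \<Rightarrow> nat \<Rightarrow> nat" where
  "tally k S M c j p = card {y \<in> {..<j} \<rightarrow>\<^sub>E {..<M}. \<forall>i<k. (\<Sum>l<j. c i l * y l) \<le> digit S p i}"

text \<open>A state is a vector of right-hand sides below \<open>S\<close>, encoded as the number with these base-\<open>S\<close> digits;
  the step leads from state \<open>p\<close> to state \<open>q\<close> by giving coordinate \<open>j\<close> the value \<open>y\<close>.\<close>

definition step :: "nat \<Rightarrow> nat \<Rightarrow> (nat \<Rightarrow> nat \<Rightarrow> nat) \<Rightarrow> nat \<Rightarrow> nat \<Rightarrow> nat \<Rightarrow> nat \<Rightarrow> bool" where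
  "step k S c j p y q \<longleftrightarrow> (\<forall>i<k. y * c i j + digit S q i = digit S p i)"

lemma tally_0 [simp]: "tally k S M c 0 p = 1"
proof -
  have "{y \<in> {..<0::nat} \<rightarrow>\<^sub>E {..<M}. \<forall>i<k. (\<Sum>l<0. c i l * y l) \<le> digit S p i} = {\<lambda>_. undefined}"
    by auto
  then show ?thesis by (simp add: tally_def)
qed

lemma step_unique:
  assumes "step k S c j p y q" "step k S c j p y q'" "q < S ^ k" "q' < S ^ k"
  shows "q = q'"
proof (rule digit_inject[OF assms(3,4)], intro allI impI)
  fix i assume "i < k"
  then have "y * c i j + digit S q i = y * c i j + digit S q' i"
    using assms(1,2) by (simp add: step_def)
  then show "digit S q i = digit S q' i" by simp
qed

text \<open>The search for a successor thus performs at most one addition for each value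
  \<open>y\<close>, which keeps the nesting depth of the additions at \<open>M\<close> per
  coordinate.\<close>

lemma card_step_le_1: "Q \<le> S ^ k \<Longrightarrow> card {q \<in> {..<Q}. step k S c j p y q} \<le> 1"
  unfolding One_nat_def by (subst card_le_Suc0_iff_eq) (auto intro: step_unique[where k = k])

text \<open>Fix the value \<open>y\<close> of coordinate \<open>j\<close>; the other coordinates
  must then fit into the reduced right-hand sides. If none of these is negative they form a state,
  the only \<open>q\<close> of the inner sum; otherwise nothing fits and that sum is empty. The form
  as a sum over \<open>q\<close> mirrors the search made by the program.\<close>

lemma tally_Suc:
  assumes S: "S > 0"
  shows "tally k S M c (Suc j) p
    = (\<Sum>y<M. \<Sum>q \<in> {q \<in> {..<S ^ k}. step k S c j p y q}. tally k S M c j q)"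
proof -
  define F where "F y = {f \<in> {..<j} \<rightarrow>\<^sub>E {..<M}. \<forall>i<k. (\<Sum>l<j. c i l * f l) + c i j * y \<le> digit S p i}"
    for y
  have finF: "finite (F y)" for y
    unfolding F_def by (rule finite_subset[of _ "{..<j} \<rightarrow>\<^sub>E {..<M}"]) (auto intro: finite_PiE)
  have sum_upd: "(\<Sum>l<j. c i l * (f(j := y)) l) = (\<Sum>l<j. c i l * f l)" for i f y
    by (intro sum.cong) auto
  have "{y \<in> {..<Suc j} \<rightarrow>\<^sub>E {..<M}. \<forall>i<k. (\<Sum>l<Suc j. c i l * y l) \<le> digit S p i}
      = (\<lambda>(y, f). f(j := y)) ` (SIGMA y:{..<M}. F y)"
  proof (intro equalityI subsetI)
    fix g assume "g \<in> {y \<in> {..<Suc j} \<rightarrow>\<^sub>E {..<M}. \<forall>i<k. (\<Sum>l<Suc j. c i l * y l) \<le> digit S p i}"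
    then have g: "g \<in> {..<Suc j} \<rightarrow>\<^sub>E {..<M}"
      and le: "\<forall>i<k. (\<Sum>l<j. c i l * g l) + c i j * g j \<le> digit S p i" by simp_all
    define f where "f = g(j := undefined)"
    have "(\<Sum>l<j. c i l * f l) = (\<Sum>l<j. c i l * g l)" for i
      unfolding f_def by (rule sum_upd)
    moreover have "f \<in> {..<j} \<rightarrow>\<^sub>E {..<M}"
      using g by (auto simp: f_def PiE_def Pi_def extensional_def)
    ultimately have "f \<in> F (g j)" using le by (simp add: F_def)
    moreover have "g j \<in> {..<M}" using g by (auto simp: PiE_def Pi_def)
    moreover have "g = (\<lambda>(y, f). f(j := y)) (g j, f)" by (simp add: f_def)
    ultimately show "g \<in> (\<lambda>(y, f). f(j := y)) ` (SIGMA y:{..<M}. F y)" by blast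
  next
    fix g assume "g \<in> (\<lambda>(y, f). f(j := y)) ` (SIGMA y:{..<M}. F y)"
    then obtain y f where f: "y < M" "f \<in> F y" "g = f(j := y)" by auto
    have "g \<in> {..<Suc j} \<rightarrow>\<^sub>E {..<M}"
      using f by (auto simp: F_def PiE_def Pi_def extensional_def)
    then show "g \<in> {y \<in> {..<Suc j} \<rightarrow>\<^sub>E {..<M}. \<forall>i<k. (\<Sum>l<Suc j. c i l * y l) \<le> digit S p i}"
      using f by (simp add: F_def sum_upd)
  qed
  moreover have "inj_on (\<lambda>(y, f). f(j := y)) (SIGMA y:{..<M}. F y)"
  proof (rule inj_onI, clarify)
    fix y f y' f'
    assume f: "f \<in> F y" "f' \<in> F y'" "f(j := y) = f'(j := y')"
    then have "y = y'" by (metis fun_upd_same)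
    moreover have "f x = f' x" for x
    proof (cases "x = j")
      case True
      then show ?thesis using f by (auto simp: F_def PiE_def extensional_def)
    next
      case False
      then show ?thesis using f(3) by (metis fun_upd_other)
    qed
    ultimately show "y = y' \<and> f = f'" by auto
  qed
  ultimately have "tally k S M c (Suc j) p = card (SIGMA y:{..<M}. F y)"
    unfolding tally_def by (simp add: card_image)
  also have "\<dots> = (\<Sum>y<M. card (F y))" using finF by simp
  also have "\<dots> = (\<Sum>y<M. \<Sum>q \<in> {q \<in> {..<S ^ k}. step k S c j p y q}. tally k S M c j q)"
  proof (intro sum.cong refl)
    fix y
    show "card (F y) = (\<Sum>q \<in> {q \<in> {..<S ^ k}. step k S c j p y q}. tally k S M c j q)"
    proof (cases "\<exists>q<S ^ k. step k S c j p y q")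
      case True
      then obtain q where q: "q < S ^ k" "step k S c j p y q" by blast
      then have "{q \<in> {..<S ^ k}. step k S c j p y q} = {q}" using step_unique by blast
      moreover have "F y = {f \<in> {..<j} \<rightarrow>\<^sub>E {..<M}. \<forall>i<k. (\<Sum>l<j. c i l * f l) \<le> digit S q i}"
      proof -
        have "a + c i j * y \<le> digit S p i \<longleftrightarrow> a \<le> digit S q i" if "i < k" for a i
        proof -
          have "digit S p i = y * c i j + digit S q i" using q(2) that by (simp add: step_def)
          then show ?thesis by (simp add: mult.commute)
        qed
        then show ?thesis unfolding F_def by auto
      qed
      ultimately show ?thesis by (simp add: tally_def)
    next
      case False
      \<comment> \<open>If no right-hand side were exceeded, the differences would be the digits of
        a successor.\<close>
      have "\<exists>i<k. digit S p i < y * c i j"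
      proof (rule ccontr)
        assume "\<not> (\<exists>i<k. digit S p i < y * c i j)"
        then have le: "y * c i j \<le> digit S p i" if "i < k" for i using that by (meson not_le)
        have "digit S p i - y * c i j < S" for i
          using digit_less[OF S, of p i] by simp
        from digit_exists[of k "\<lambda>i. digit S p i - y * c i j", OF this] obtain q
          where "q < S ^ k" "\<forall>i<k. digit S q i = digit S p i - y * c i j" by blast
        then have "step k S c j p y q" using le by (simp add: step_def)
        with False \<open>q < S ^ k\<close> show False by blast
      qed
      then have "F y = {}" by (force simp: F_def mult.commute)
      moreover from False have "{q \<in> {..<S ^ k}. step k S c j p y q} = {}" by blast
      ultimately show ?thesis by (simp only: card.empty sum.empty)
    qed
  qed
  finally show ?thesis .
qed

section \<open>Floating point addition with upward rounding\<close>

definition fval :: "nat \<Rightarrow> nat \<times> nat \<Rightarrow> real" where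
  "fval B x = real (fst x) * real B ^ snd x"

text \<open>Two digits in base \<open>B\<close>, the leading one nonzero unless the exponent is 0.
  One unit of a positive exponent is therefore at most the fraction \<open>1 / B\<close> of the
  value.\<close>

definition fnorm :: "nat \<Rightarrow> nat \<times> nat \<Rightarrow> bool" where
  "fnorm B x \<longleftrightarrow> fst x < B * B \<and> (snd x = 0 \<or> B \<le> fst x)"

text \<open>When the exponents differ by at least 2, the smaller number is below one unit of the larger
  exponent, because a normalised mantissa is less than \<open>B\<^sup>2\<close>.\<close>

definition align :: "nat \<Rightarrow> nat \<times> nat \<Rightarrow> nat \<Rightarrow> nat" where
  "align B x e = (if snd x < e then if snd x + 1 < e then 1 else fst x div B + 1 else fst x)"

text \<open>\<open>s div B + 1\<close> stands in for the ceiling: a single floor computes it, and it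
  is never too small.\<close>

definition fadd :: "nat \<Rightarrow> nat \<times> nat \<Rightarrow> nat \<times> nat \<Rightarrow> nat \<times> nat" where
  "fadd B x y = (let e = max (snd x) (snd y); s = align B x e + align B y e
     in if B * B \<le> s then (s div B + 1, e + 1) else (s, e))"

lemma div_plus_1_bounds:
  assumes "B > 0"
  shows "real m \<le> real (m div B + 1) * B" and "real (m div B + 1) * B \<le> real m + B"
proof -
  have "m < (m div B + 1) * B" using assms by (metis add.commute dividend_less_div_times mult.commute mult_Suc_right plus_1_eq_Suc)
  then have "real m \<le> real ((m div B + 1) * B)" by linarith
  then show "real m \<le> real (m div B + 1) * B" by (simp only: of_nat_mult)
  have "(m div B + 1) * B \<le> m + B" by (simp add: algebra_simps)
  then have "real ((m div B + 1) * B) \<le> real (m + B)" by linarith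
  then show "real (m div B + 1) * B \<le> real m + B" by (simp only: of_nat_mult of_nat_add)
qed

text \<open>The exponents are equal, differ by 1 or differ by more. The error is at most one unit of
  exponent \<open>e\<close> and occurs only if a shift takes place. For \<open>B = 1\<close> even
  the mantissa 1 is not below \<open>B * B\<close>, whence the exception.\<close>

lemma align_bounds:
  assumes B: "B > 0" and x: "fnorm B x" and le: "snd x \<le> e"
  shows "fval B x \<le> real (align B x e) * B ^ e"
    and "real (align B x e) * B ^ e \<le> fval B x + (if snd x < e then B ^ e else 0)"
    and "align B x e < B * B \<or> B = 1"
proof -
  consider "snd x = e" | "e = snd x + 1" | "snd x + 2 \<le> e" using le by linarith
  then have "fval B x \<le> real (align B x e) * B ^ e \<and>
    real (align B x e) * B ^ e \<le> fval B x + (if snd x < e then B ^ e else 0) \<and>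
    (align B x e < B * B \<or> B = 1)"
  proof cases
    case 1
    then show ?thesis using x by (simp add: align_def fval_def fnorm_def)
  next
    case 2
    have *: "real (fst x) * B ^ snd x \<le> (real (fst x div B + 1) * B) * B ^ snd x"
      "(real (fst x div B + 1) * B) * B ^ snd x \<le> (real (fst x) + B) * B ^ snd x"
      using div_plus_1_bounds[OF B, of "fst x"] by (intro mult_right_mono; simp)+
    have "fst x div B < B" using x B by (simp add: fnorm_def less_mult_imp_div_less)
    then have "fst x div B + 1 \<le> B" by simp
    moreover have "B < B * B \<or> B = 1" using B by (cases "B = 1") auto
    ultimately have "fst x div B + 1 < B * B \<or> B = 1" by linarith
    then show ?thesis using * 2 by (auto simp: align_def fval_def algebra_simps)
  next
    case 3
    have "real (fst x) \<le> real (B * B)" using x unfolding fnorm_def of_nat_le_iff by simp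
    then have "fval B x \<le> real (B * B) * real B ^ snd x"
      unfolding fval_def by (rule mult_right_mono) simp
    also have "\<dots> = real B ^ (snd x + 2)" by (simp add: power_add power2_eq_square)
    also have "\<dots> \<le> real B ^ e" using B 3 by (intro power_increasing) auto
    finally have "fval B x \<le> real B ^ e" .
    moreover have "0 \<le> fval B x" by (simp add: fval_def)
    moreover have "1 < B * B \<or> B = 1" using B one_less_mult[of B B] by linarith
    ultimately show ?thesis using 3 by (auto simp: align_def)
  qed
  then show "fval B x \<le> real (align B x e) * B ^ e"
    and "real (align B x e) * B ^ e \<le> fval B x + (if snd x < e then B ^ e else 0)"
    and "align B x e < B * B \<or> B = 1" by blast+
qed

lemma fnorm_fadd:
  assumes B: "B \<ge> 3" and x: "fnorm B x" and y: "fnorm B y"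
  shows "fnorm B (fadd B x y)"
proof -
  define e where "e = max (snd x) (snd y)"
  define s where "s = align B x e + align B y e"
  have "s < 2 * (B * B)"
    using align_bounds(3)[OF _ x, of e] align_bounds(3)[OF _ y, of e] B by (auto simp: s_def e_def)
  then have "s div B < 2 * B" using B by (intro less_mult_imp_div_less) simp
  \<comment> \<open>Here \<open>B\<close> must be at least 3: \<open>s div B + 1\<close> can be as
    large as \<open>2 * B\<close> and has to stay below \<open>B * B\<close>.\<close>
  moreover have "3 * B \<le> B * B" using B by simp
  ultimately have "s div B + 1 < B * B" using B by linarith
  moreover have "B \<le> s div B + 1" if "B * B \<le> s"
    using div_le_mono[OF that, of B] B by simp
  \<comment> \<open>The operand with the larger exponent is not shifted and already has a mantissa
    of at least \<open>B\<close>.\<close>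
  moreover have "B \<le> s" if "e > 0"
  proof (cases "snd x \<le> snd y")
    case True
    then have "align B y e = fst y" "snd y > 0" using that by (auto simp: align_def e_def)
    then show ?thesis using y by (simp add: s_def fnorm_def)
  next
    case False
    then have "align B x e = fst x" "snd x > 0" using that by (auto simp: align_def e_def)
    then show ?thesis using x by (simp add: s_def fnorm_def)
  qed
  ultimately show ?thesis by (auto simp: fadd_def fnorm_def Let_def simp flip: e_def s_def)
qed

text \<open>There are two roundings, one in aligning the operand with the smaller exponent and one
  in normalising the sum. Each costs at most a factor \<open>1 + 1 / B\<close>, hence the
  square.\<close>

lemma fval_fadd:
  assumes B: "B \<ge> 3" and x: "fnorm B x" and y: "fnorm B y"
  shows "fval B x + fval B y \<le> fval B (fadd B x y)"
    and "fval B (fadd B x y) \<le> (1 + 1 / B)\<^sup>2 * (fval B x + fval B y)"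
proof -
  define e where "e = max (snd x) (snd y)"
  define s where "s = align B x e + align B y e"
  define r where "r = 1 + 1 / real B"
  have B0: "B > 0" using B by simp
  have r1: "r \<ge> 1" by (simp add: r_def)
  have e: "snd x \<le> e" "snd y \<le> e" by (simp_all add: e_def)
  note ax = align_bounds[OF B0 x e(1)] and ay = align_bounds[OF B0 y e(2)]
  have nn: "0 \<le> fval B x" "0 \<le> fval B y" by (simp_all add: fval_def)
  have lo: "fval B x + fval B y \<le> real s * B ^ e"
    using ax(1) ay(1) by (simp add: s_def distrib_right)
  have big: "real B ^ e \<le> fval B z / B" if z: "fnorm B z" "snd z = e" "e > 0" for z
  proof -
    have "real B * real B ^ e \<le> fval B z"
      using z unfolding fval_def fnorm_def by (auto intro: mult_right_mono)
    then show ?thesis using B0 by (simp add: field_simps)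
  qed
  have hi: "real s * B ^ e \<le> r * (fval B x + fval B y)"
  proof -
    have "real s * B ^ e \<le> fval B x + fval B y + (fval B x + fval B y) / B"
    proof (cases "snd x = snd y")
      case True
      then have "real s * B ^ e \<le> fval B x + fval B y"
        using ax(2) ay(2) by (simp add: s_def distrib_right e_def)
      then show ?thesis using nn by (smt (verit) divide_nonneg_nonneg of_nat_0_le_iff)
    next
      case False
      have "real B ^ e \<le> (fval B x + fval B y) / B"
      proof (cases "snd x < snd y")
        case True
        then have "real B ^ e \<le> fval B y / B" by (intro big y) (auto simp: e_def)
        also have "\<dots> \<le> (fval B x + fval B y) / B" using nn by (intro divide_right_mono) auto
        finally show ?thesis .
      next
        case F: False
        then have "real B ^ e \<le> fval B x / B" using False by (intro big x) (auto simp: e_def)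
        also have "\<dots> \<le> (fval B x + fval B y) / B" using nn by (intro divide_right_mono) auto
        finally show ?thesis .
      qed
      moreover have "real s * B ^ e \<le> fval B x + fval B y + B ^ e"
        using ax(2) ay(2) False by (auto simp: s_def distrib_right e_def split: if_splits)
      ultimately show ?thesis by simp
    qed
    then show ?thesis by (simp add: r_def algebra_simps add_divide_distrib)
  qed
  show "fval B x + fval B y \<le> fval B (fadd B x y)"
  proof (cases "B * B \<le> s")
    case True
    have "real s * B ^ e \<le> (real (s div B + 1) * B) * B ^ e"
      using div_plus_1_bounds[OF B0, of s] by (intro mult_right_mono) auto
    with lo True show ?thesis
      by (simp add: fadd_def Let_def fval_def mult.assoc flip: e_def s_def)
  next
    case False
    with lo show ?thesis by (simp add: fadd_def Let_def fval_def flip: e_def s_def)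
  qed
  have "fval B (fadd B x y) \<le> r * (real s * B ^ e)"
  proof (cases "B * B \<le> s")
    case True
    then have "real (B * B) \<le> real s" by (simp only: of_nat_le_iff)
    \<comment> \<open>Scaled back, normalisation adds at most \<open>B\<close> to \<open>s\<close>,
      which is only the fraction \<open>1 / B\<close> of an \<open>s\<close> as large as
      \<open>B * B\<close>.\<close>
    then have "real B \<le> real s / B" using B0 by (simp add: field_simps)
    then have "real (s div B + 1) * B \<le> r * real s"
      using div_plus_1_bounds[OF B0, of s] by (simp add: r_def distrib_right)
    then have "(real (s div B + 1) * B) * B ^ e \<le> (r * real s) * B ^ e"
      by (rule mult_right_mono) simp
    with True show ?thesis
      by (simp add: fadd_def Let_def fval_def mult.assoc flip: e_def s_def)
  next
    case False
    have "1 * (real s * B ^ e) \<le> r * (real s * B ^ e)" using r1 by (intro mult_right_mono) auto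
    with False show ?thesis by (simp add: fadd_def Let_def fval_def flip: e_def s_def)
  qed
  also have "\<dots> \<le> r * (r * (fval B x + fval B y))" using hi r1 by (intro mult_left_mono) auto
  finally show "fval B (fadd B x y) \<le> (1 + 1 / B)\<^sup>2 * (fval B x + fval B y)"
    by (simp add: r_def power2_eq_square mult.assoc)
qed

text \<open>\<open>E\<close> counts nested additions; it bounds both the exponent and the accumulated error.\<close>

definition apx :: "nat \<Rightarrow> nat \<Rightarrow> nat \<times> nat \<Rightarrow> nat \<Rightarrow> bool" where
  "apx B E x v \<longleftrightarrow> fnorm B x \<and> snd x \<le> E \<and> real v \<le> fval B x
     \<and> fval B x \<le> (1 + 1 / B) ^ (2 * E) * real v"

lemma apx_mono:
  assumes "apx B E x v" and "E \<le> E'"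
  shows "apx B E' x v"
proof -
  have "(1 + 1 / real B) ^ (2 * E) * real v \<le> (1 + 1 / real B) ^ (2 * E') * real v"
    using assms(2) by (intro mult_right_mono power_increasing) auto
  then show ?thesis using assms unfolding apx_def by linarith
qed

lemma apx_0: "B > 0 \<Longrightarrow> apx B E (0, 0) 0"
  by (simp add: apx_def fnorm_def fval_def)

lemma apx_1: "B > 1 \<Longrightarrow> apx B 0 (1, 0) 1"
  by (simp add: apx_def fnorm_def fval_def one_less_mult)

text \<open>The error factors of the operands are not multiplied with each other: a sum inherits the
  common factor, which is why only the nesting depth counts.\<close>

lemma apx_fadd:
  assumes B: "B \<ge> 3" and x: "apx B E x v" and y: "apx B E y w"
  shows "apx B (Suc E) (fadd B x y) (v + w)"
proof -
  have "snd (fadd B x y) \<le> Suc E"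
    using x y by (auto simp: fadd_def Let_def apx_def)
  moreover have "fval B (fadd B x y) \<le> (1 + 1 / B)\<^sup>2 * (fval B x + fval B y)"
    using assms by (intro fval_fadd) (auto simp: apx_def)
  moreover have "(1 + 1 / B)\<^sup>2 * (fval B x + fval B y)
      \<le> (1 + 1 / B)\<^sup>2 * ((1 + 1 / B) ^ (2 * E) * real v + (1 + 1 / B) ^ (2 * E) * real w)"
    using x y by (intro mult_left_mono add_mono) (auto simp: apx_def)
  moreover have "\<dots> = (1 + 1 / B) ^ (2 * Suc E) * real (v + w)"
    by (simp only: mult_Suc_right power_add of_nat_add distrib_left mult.assoc)
  moreover have "real (v + w) \<le> fval B (fadd B x y)"
    using fval_fadd(1)[OF B, of x y] x y by (simp add: apx_def)
  ultimately show ?thesis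
    using fnorm_fadd[OF B, of x y] x y unfolding apx_def by linarith
qed

section \<open>The program\<close>

text \<open>In lowest terms the denominator of \<open>r\<close> divides \<open>y\<close>, so it is
  at most \<open>2 ^ x\<close>, and the numerator is at most \<open>2 ^ (2 * x)\<close> in modulus.
  Their lengths, at most \<open>x + 1\<close> and \<open>2 * x + 1\<close>, add up to the
  bound.\<close>

lemma enc_len_le:
  assumes y: "y > 0" "y \<le> 2 ^ x" and r: "\<bar>r\<bar> \<le> 2 ^ x" and int: "r * of_nat y \<in> \<int>"
  shows "enc_len r \<le> 3 * int x + 2"
proof -
  obtain p q where pq: "quotient_of r = (p, q)" by fastforce
  have q: "q > 0" and cop: "coprime p q" and rpq: "r = of_int p / of_int q"
    using pq quotient_of_denom_pos quotient_of_coprime quotient_of_div by blast+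
  obtain m where m: "r * of_nat y = of_int m" using int by (auto elim: Ints_cases)
  have "of_int (p * int y) = (of_int (m * q) :: rat)"
    using m q by (simp add: rpq field_simps)
  then have "p * int y = m * q" by (simp only: of_int_eq_iff)
  then have "q dvd int y" using cop by (metis coprime_commute coprime_dvd_mult_right_iff dvd_triv_right)
  then have "q \<le> int y" using y by (intro zdvd_imp_le) auto
  also have "int y \<le> 2 ^ x" using y(2) by (metis of_nat_le_iff of_nat_numeral of_nat_power)
  finally have qx: "q \<le> 2 ^ x" .
  have "(of_int q :: rat) \<le> of_int (2 ^ x)" using qx by (simp only: of_int_le_iff)
  then have qx': "(of_int q :: rat) \<le> 2 ^ x" by simp
  have "(of_int \<bar>p\<bar> :: rat) = \<bar>r\<bar> * of_int q" using q by (simp add: rpq)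
  also have "\<dots> \<le> 2 ^ x * 2 ^ x" using r qx' q by (intro mult_mono) auto
  finally have "of_int \<bar>p\<bar> \<le> (of_int (2 ^ x * 2 ^ x) :: rat)" by simp
  then have px: "\<bar>p\<bar> \<le> 2 ^ (2 * x)" unfolding of_int_le_iff by (simp add: mult_2 power_add)
  have le: "\<lceil>log 2 (real_of_int (z + 1))\<rceil> \<le> int d + 1" if "0 \<le> z" "z \<le> 2 ^ d" for z d
  proof -
    have "z + 1 \<le> 2 ^ Suc d" using add_mono[OF that(2) one_le_power[of "2::int" d]] by simp
    then have "real_of_int (z + 1) \<le> of_int (2 ^ Suc d)" unfolding of_int_le_iff .
    then have "log 2 (real_of_int (z + 1)) \<le> log 2 (2 ^ Suc d)"
      using that(1) by (simp add: log_le_cancel_iff)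
    also have "\<dots> = real_of_int (int d + 1)" by (subst log_nat_power) auto
    finally show ?thesis by (simp add: ceiling_le_iff)
  qed
  show ?thesis
    using le[of "\<bar>p\<bar>" "2 * x"] le[of q x] px qx q by (simp add: enc_len_def pq)
qed

abbreviation (input) Semi (infixr ";;" 60) where "Semi \<equiv> Seq"

text \<open>
  Number array 10 and index array 0 hold the scalars named below (prefixes \<open>n\<close> and \<open>i\<close>); index cell
  \<open>iZ\<close> is never written and stays 0. The other number arrays are: 5 and 6 the digits of the states
  \<open>p\<close> and \<open>q\<close>, 7 and 8 the current column before and after rounding, 20 and 21 the mantissas and
  exponents of the current table, 22 and 23 those of the next one. The product of the \<open>u\<^sub>j / M\<close> is
  kept as \<open>nZm * 2\<^bsup>nZe\<^esup>\<close>, rounded up.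
\<close>

abbreviation (input) "nZero \<equiv> Cell 10 0"
abbreviation (input) "nOne \<equiv> Cell 10 (Suc 0)"
abbreviation (input) "nTwo \<equiv> Cell 10 2"
abbreviation (input) "nD \<equiv> Cell 10 3"
abbreviation (input) "nN \<equiv> Cell 10 4"
abbreviation (input) "nM \<equiv> Cell 10 5"
abbreviation (input) "nB \<equiv> Cell 10 6"
abbreviation (input) "nP \<equiv> Cell 10 7"
abbreviation (input) "nR \<equiv> Cell 10 8"
abbreviation (input) "nBB \<equiv> Cell 10 9"
abbreviation (input) "nU \<equiv> Cell 10 10"
abbreviation (input) "nT \<equiv> Cell 10 11"
abbreviation (input) "nZm \<equiv> Cell 10 12"
abbreviation (input) "nZe \<equiv> Cell 10 13"
abbreviation (input) "nY \<equiv> Cell 10 14"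
abbreviation (input) "nAm \<equiv> Cell 10 15"
abbreviation (input) "nAe \<equiv> Cell 10 16"
abbreviation (input) "nXm \<equiv> Cell 10 17"
abbreviation (input) "nXe \<equiv> Cell 10 18"
abbreviation (input) "iK \<equiv> Cell 0 0"
abbreviation (input) "iN \<equiv> Cell 0 (Suc 0)"
abbreviation (input) "iI \<equiv> Cell 0 2"
abbreviation (input) "iJ \<equiv> Cell 0 3"
abbreviation (input) "iPtr \<equiv> Cell 0 4"
abbreviation (input) "iT \<equiv> Cell 0 5"
abbreviation (input) "iS \<equiv> Cell 0 6"
abbreviation (input) "iP \<equiv> Cell 0 7"
abbreviation (input) "iQ \<equiv> Cell 0 8"
abbreviation (input) "iZ \<equiv> Cell 0 9"
abbreviation (input) "iBad \<equiv> Cell 0 10"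
abbreviation (input) "iCarry \<equiv> Cell 0 11"
abbreviation (input) "iFlag \<equiv> Cell 0 12"

section \<open>Code that prepares the input\<close>

definition incr :: "loc \<Rightarrow> com" where
  "incr l = AssignI l (IInc l)"

text \<open>The address \<open>i * n + j\<close> cannot be computed by multiplication, so
  \<open>iPtr\<close> moves to the next row by \<open>n\<close> increments.\<close>

definition get_column :: com where
  "get_column = AssignI iPtr (ICopy iJ) ;; AssignI iI (IConst 0) ;;
     Loop (LessI iI iK)
       (AssignN (Elem 7 2) (NCopy (Elem (Suc 0) 4)) ;; AssignI iT (IConst 0) ;;
        Loop (LessI iT iN) (incr iPtr ;; incr iT) ;;
        incr iI)"

definition check_column :: com where
  "check_column = AssignI iI (IConst 0) ;;
     Loop (LessI iI iK)
       (Cond (LessN (Elem 2 2) nZero) (AssignI iBad (IConst 1)) Skip ;;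
        Cond (LeN (Elem 2 2) nZero)
          (Cond (LessN nZero (Elem 7 2)) (AssignI iBad (IConst 1)) Skip) Skip ;;
        incr iI)"

definition scan :: com where
  "scan = AssignI iJ (IConst 0) ;;
     Loop (LessI iJ iN) (get_column ;; check_column ;; incr iJ)"

text \<open>The accuracy is only compared with, never copied: its encoding length is not covered by
  the bit bound, while a power of 1/2 of similar size is short.\<close>

definition set_accuracy :: com where
  "set_accuracy = AssignN nD (NConst (1/2)) ;;
     Loop (LessN (Cell 0 0) nD) (AssignN nD (NDiv nD nTwo))"

text \<open>No instruction moves an index into the number memory, so \<open>n\<close> is counted up
  there.\<close>

definition set_dimension :: com where
  "set_dimension = AssignN nN (NCopy nZero) ;; AssignI iI (IConst 0) ;;
     Loop (LessI iI iN) (AssignN nN (NAdd nN nOne) ;; incr iI)"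

text \<open>The factor 16 comes from the error budget of \<open>error_le\<close>. Dividing by a
  power of 1/2 keeps the value an integer.\<close>

definition set_scale :: com where
  "set_scale = AssignN nM (NConst 16) ;; AssignN nM (NMul nM nN) ;;
     AssignN nM (NMul nM nN) ;; AssignN nM (NDiv nM nD) ;; AssignN nR (NMul nM nM)"

text \<open>The base is a power of 2, with exponent in \<open>nP\<close>, so that base
  \<open>B\<close> exponents can be turned into the base 2 exponent of the output.\<close>

definition set_base :: com where
  "set_base = AssignN nB (NCopy nOne) ;; AssignN nP (NCopy nZero) ;;
     Loop (LessN nB nR) (AssignN nB (NMul nB nTwo) ;; AssignN nP (NAdd nP nOne)) ;;
     AssignN nBB (NMul nB nB)"

text \<open>Either case forces volume 0. In its absence \<open>b\<close> is nonnegative and every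
  row with a positive entry has a positive right-hand side, which makes all scaling factors
  positive.\<close>

definition bad :: "(nat \<Rightarrow> nat \<Rightarrow> int) \<Rightarrow> (nat \<Rightarrow> int) \<Rightarrow> nat \<Rightarrow> nat \<Rightarrow> bool" where
  "bad A b i j \<longleftrightarrow> b i < 0 \<or> b i \<le> 0 \<and> 0 < A i j"

section \<open>Correctness of the preparation\<close>

text \<open>\<open>H\<close> bounds the entries. \<open>X\<close> abstracts from the bit bound
  \<open>Bd\<close>: by \<open>fits\<close>, every rational of modulus at most \<open>X\<close> that
  becomes an integer when multiplied by some positive \<open>y\<close> up to \<open>X\<close> may be
  written. The actual numbers are supplied only in the final proof.\<close>

locale volume_program =
  fixes k n :: nat and A :: "nat \<Rightarrow> nat \<Rightarrow> int" and b :: "nat \<Rightarrow> int"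
    and H X :: nat and Bd :: real
  assumes k: "k \<ge> 1" and n: "n \<ge> 1"
    and A: "\<And>i j. i < k \<Longrightarrow> j < n \<Longrightarrow> 0 \<le> A i j \<and> A i j \<le> int H"
    and b: "\<And>i. i < k \<Longrightarrow> \<bar>b i\<bar> \<le> int H"
    and H: "1 \<le> H" "H \<le> X"
    and fits: "\<And>r y. 0 < y \<Longrightarrow> y \<le> X \<Longrightarrow> \<bar>r\<bar> \<le> of_nat X \<Longrightarrow> r * of_nat y \<in> \<int>
      \<Longrightarrow> enc_len r \<le> Bd"
begin

definition env :: "store \<Rightarrow> bool" where
  "env s \<longleftrightarrow> idx s (0, 0) = k \<and> idx s (0, Suc 0) = n \<and> idx s (0, 9) = 0 \<and>
     num s (10, 0) = 0 \<and> num s (10, Suc 0) = 1 \<and> num s (10, 2) = 2 \<and>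
     (\<forall>i<k. \<forall>j<n. num s (Suc 0, i * n + j) = of_int (A i j)) \<and>
     (\<forall>i<k. num s (2, i) = of_int (b i))"

lemma env_simps [simp]:
  assumes "env s"
  shows "idx s (0, 0) = k" "idx s (0, Suc 0) = n" "idx s (0, 9) = 0"
    "num s (10, 0) = 0" "num s (10, Suc 0) = 1" "num s (10, 2) = 2"
    "i < k \<Longrightarrow> num s (2, i) = of_int (b i)"
  using assms by (auto simp: env_def)

lemma env_A: "env s \<Longrightarrow> i < k \<Longrightarrow> j < n \<Longrightarrow> num s (Suc 0, i * n + j) = of_int (A i j)"
  unfolding env_def by blast

definition env_nums :: "(nat \<times> nat) set" where
  "env_nums = {Suc 0, 2} \<times> UNIV \<union> {10} \<times> {0, Suc 0, 2}"

definition env_idxs :: "(nat \<times> nat) set" where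
  "env_idxs = {0} \<times> {0, Suc 0, 9}"

lemma env_agree: "env s \<Longrightarrow> agree V W s s' \<Longrightarrow> V \<inter> env_nums = {} \<Longrightarrow> W \<inter> env_idxs = {} \<Longrightarrow> env s'"
proof -
  assume s: "env s" and a: "agree V W s s'" and d: "V \<inter> env_nums = {}" "W \<inter> env_idxs = {}"
  have N: "num s' x = num s x" if "x \<in> env_nums" for x
    using that d agree_num[OF a] by blast
  have I: "idx s' x = idx s x" if "x \<in> env_idxs" for x
    using that d agree_idx[OF a] by blast
  have n1: "num s' (Suc 0, x) = num s (Suc 0, x)" "num s' (2, x) = num s (2, x)" for x
    by (rule N, simp add: env_nums_def)+
  have n2: "num s' (10, 0) = num s (10, 0)" "num s' (10, Suc 0) = num s (10, Suc 0)"
    "num s' (10, 2) = num s (10, 2)"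
    by (rule N, simp add: env_nums_def)+
  have i1: "idx s' (0, 0) = idx s (0, 0)" "idx s' (0, Suc 0) = idx s (0, Suc 0)"
    "idx s' (0, 9) = idx s (0, 9)"
    by (rule I, simp add: env_idxs_def)+
  show "env s'" using s unfolding env_def n1 n2 i1 .
qed

lemma env_set_num [simp]: "addr s l \<notin> env_nums \<Longrightarrow> env s \<Longrightarrow> env (set_num s l r)"
  by (erule env_agree[where V = "{addr s l}" and W = "{}"]) auto

lemma env_set_idx [simp]: "addr s l \<notin> env_idxs \<Longrightarrow> env s \<Longrightarrow> env (set_idx s l r)"
  by (erule env_agree[where V = "{}" and W = "{addr s l}"]) auto

lemma fits_nat: "m \<le> X \<Longrightarrow> enc_len (of_nat m) \<le> Bd"
  using H by (intro fits[of 1]) auto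

lemma fits_int: "\<bar>m\<bar> \<le> int X \<Longrightarrow> enc_len (of_int m) \<le> Bd"
proof (intro fits[of 1])
  assume "\<bar>m\<bar> \<le> int X"
  then have "(of_int \<bar>m\<bar> :: rat) \<le> of_int (int X)" by (simp only: of_int_le_iff)
  then show "\<bar>of_int m :: rat\<bar> \<le> of_nat X" by simp
qed (use H in auto)

lemma run_get_column:
  assumes s: "env s" and j: "j < n" "idx s (0, 3) = j"
  shows "run Bd get_column s (k * (3 * n + 5) + 3) (\<lambda>s'.
    agree ({7} \<times> UNIV) {(0, 2), (0, 4), (0, 5)} s s' \<and> env s' \<and>
    (\<forall>i<k. num s' (7, i) = of_int (A i j)))"
proof -
  have inner: "run Bd (Loop (LessI iT iN) (incr iPtr ;; incr iT)) s1 (n * (2 + 1) + 1)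
      (\<lambda>s2. agree {} {(0, 4), (0, 5)} s1 s2 \<and> env s2 \<and> idx s2 (0, 4) = idx s1 (0, 4) + n)"
    if "env s1" "idx s1 (0, 5) = 0" for s1
    by (rule run_Loop[where I = "\<lambda>i s'. agree {} {(0, 4), (0, 5)} s1 s' \<and> env s' \<and>
          idx s' (0, 4) = idx s1 (0, 4) + i \<and> idx s' (0, 5) = i \<and> i \<le> n"])
      (use that in \<open>auto intro!: wp_runI simp: incr_def env_idxs_def env_nums_def\<close>)
  have loop: "run Bd (Loop (LessI iI iK)
      (AssignN (Elem 7 2) (NCopy (Elem (Suc 0) 4)) ;; AssignI iT (IConst 0) ;;
        Loop (LessI iT iN) (incr iPtr ;; incr iT) ;; incr iI)) s1 (k * (3 * n + 4 + 1) + 1)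
      (\<lambda>s'. agree ({7} \<times> UNIV) {(0, 2), (0, 4), (0, 5)} s s' \<and> env s' \<and>
        (\<forall>i<k. num s' (7, i) = of_int (A i j)))"
    if s1: "env s1" "agree ({7} \<times> UNIV) {(0, 2), (0, 4), (0, 5)} s s1" "idx s1 (0, 2) = 0" "idx s1 (0, 4) = j"
    for s1
  proof (rule run_Loop[where I = "\<lambda>i s'. agree ({7} \<times> UNIV) {(0, 2), (0, 4), (0, 5)} s s' \<and> env s' \<and>
       idx s' (0, 2) = i \<and> i \<le> k \<and> idx s' (0, 4) = i * n + j \<and>
       (\<forall>l<i. num s' (7, l) = of_int (A l j))"], goal_cases)
    case (2 i s2)
    then have i: "i < k" and e: "env s2" and ag: "agree ({7} \<times> UNIV) {(0, 2), (0, 4), (0, 5)} s s2"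
      and ix: "idx s2 (0, 2) = i" "idx s2 (0, 4) = i * n + j"
      and col: "\<forall>l<i. num s2 (7, l) = of_int (A l j)" by auto
    have "\<bar>A i j\<bar> \<le> int X" using A[OF i j(1)] H by simp
    from fits_int[OF this] have enc: "enc_len (of_int (A i j)) \<le> Bd" .
    let ?s = "set_idx (set_num s2 (Elem 7 2) (of_int (A i j))) iT 0"
    have e': "env ?s" using e by (simp add: env_nums_def env_idxs_def)
    have ag': "agree ({7} \<times> UNIV) {(0, 2), (0, 4), (0, 5)} s ?s" using ag ix by simp
    have "run Bd (Loop (LessI iT iN) (incr iPtr ;; incr iT) ;; incr iI) ?s (n * (2 + 1) + 1 + 1)
      (\<lambda>s'. agree ({7} \<times> UNIV) {(0, 2), (0, 4), (0, 5)} s s' \<and> env s' \<and>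
       idx s' (0, 2) = Suc i \<and> Suc i \<le> k \<and> idx s' (0, 4) = Suc i * n + j \<and>
       (\<forall>l<Suc i. num s' (7, l) = of_int (A l j)))"
    proof (rule run_Seq_wp[OF inner[OF e']], simp, goal_cases)
      case (1 s')
      then have a: "agree {} {(0, 4), (0, 5)} ?s s'" and e: "env s'"
        and p: "idx s' (0, 4) = idx s2 (0, 4) + n" by auto
      have "agree ({7} \<times> UNIV) {(0, 2), (0, 4), (0, 5)} s s'"
        by (rule agree_trans[OF ag' a]) auto
      with e p i ix col show ?case
        by (auto simp: incr_def env_idxs_def less_Suc_eq agree_num[OF a] agree_idx[OF a])
    qed (simp add: incr_def)
    then show ?case
      using i by (auto intro!: run_wp_Seq simp: ix e enc j env_A)
  qed (use s1 in auto)
  show ?thesis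
    unfolding get_column_def
    by (rule run_le, rule run_AssignI_Seq, rule run_AssignI_Seq, rule loop)
      (use s j in \<open>simp_all add: env_idxs_def\<close>)
qed

lemma run_check_column:
  assumes s: "env s" and j: "j < n" and col: "\<And>i. i < k \<Longrightarrow> num s (7, i) = of_int (A i j)"
  shows "run Bd check_column s (k * 7 + 2) (\<lambda>s'.
    agree {} {(0, 2), (0, 10)} s s' \<and> env s' \<and>
    idx s' (0, 10) = (if \<exists>i<k. bad A b i j then 1 else idx s (0, 10)))"
proof -
  let ?I = "\<lambda>i s'. agree {} {(0, 2), (0, 10)} s s' \<and> env s' \<and> idx s' (0, 2) = i \<and> i \<le> k \<and>
    idx s' (0, 10) = (if \<exists>l<i. bad A b l j then 1 else idx s (0, 10))"
  show ?thesis
    unfolding check_column_def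
  proof (rule run_le, rule run_AssignI_Seq, rule run_Loop[where I = ?I and N = k and T = 6], goal_cases)
    case (2 i s')
    then have i: "i < k" and I: "?I i s'" by auto
    have c: "num s' (7, i) = of_int (A i j)" using I i col agree_num by fastforce
    show ?case
      apply (rule conjI[OF i])
      apply (rule wp_runI)
       apply (use i I c in \<open>auto simp: incr_def env_idxs_def less_Suc_eq bad_def\<close>)
      done
  qed (use s in \<open>auto simp: env_idxs_def\<close>)
qed

lemma run_scan:
  assumes s: "env s" "idx s (0, 10) = 0"
  shows "run Bd scan s (n * (k * (3 * n + 5) + k * 7 + 7) + 2) (\<lambda>s'.
    agree ({7} \<times> UNIV) ({0} \<times> {2, 3, 4, 5, 10}) s s' \<and> env s' \<and>
    idx s' (0, 10) = (if \<exists>j<n. \<exists>i<k. bad A b i j then 1 else 0))"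
proof -
  let ?I = "\<lambda>j s'. agree ({7} \<times> UNIV) ({0} \<times> {2, 3, 4, 5, 10}) s s' \<and> env s' \<and>
    idx s' (0, 3) = j \<and> j \<le> n \<and>
    idx s' (0, 10) = (if \<exists>l<j. \<exists>i<k. bad A b i l then 1 else 0)"
  let ?T = "(k * (3 * n + 5) + 3) + ((k * 7 + 2) + 1)"
  show ?thesis
    unfolding scan_def
  proof (rule run_le, rule run_AssignI_Seq,
      rule run_Loop[where I = ?I and N = n and T = ?T], goal_cases)
    case (2 j s1)
    then have j: "j < n" "idx s1 (0, 3) = j" and e1: "env s1" and I: "?I j s1" by auto
    have "run Bd (get_column ;; check_column ;; incr iJ) s1 ?T (?I (Suc j))"
    proof (rule run_Seq[OF run_get_column[OF e1 j]], elim conjE, goal_cases)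
      case (1 s2)
      then have col: "num s2 (7, i) = of_int (A i j)" if "i < k" for i using that by simp
      have a2: "agree ({7} \<times> UNIV) ({0} \<times> {2, 3, 4, 5, 10}) s s2"
        by (rule agree_trans[OF conjunct1[OF I] 1(1)]) auto
      note i2 = agree_idx[OF 1(1)]
      show ?case
      proof (rule run_Seq_wp[OF run_check_column[OF 1(2) j(1) col]], assumption, elim conjE, goal_cases)
        case (1 s3)
        note i3 = agree_idx[OF 1(1)]
        have "agree ({7} \<times> UNIV) ({0} \<times> {2, 3, 4, 5, 10}) s s3"
          by (rule agree_trans[OF a2 1(1)]) auto
        with 1 I j show ?case
          by (auto simp: incr_def env_idxs_def less_Suc_eq i2 i3)
      qed (simp add: incr_def)
    qed
    with j show ?case by blast
  qed (use s in \<open>auto simp: env_idxs_def algebra_simps\<close>)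
qed

lemma run_set_accuracy:
  assumes s: "env s" "num s (0, 0) = \<epsilon>"
    and q: "(1/2) ^ Suc q \<le> \<epsilon>" "\<And>l. l < q \<Longrightarrow> \<epsilon> < (1/2) ^ Suc l" "2 ^ Suc q \<le> X"
  shows "run Bd set_accuracy s (q * 2 + 2) (\<lambda>s'.
    agree {(10, 3)} {} s s' \<and> env s' \<and> num s' (10, 3) = (1/2) ^ Suc q)"
proof -
  have f: "enc_len ((1/2) ^ Suc l) \<le> Bd" if "l \<le> q" for l
  proof (rule fits[of "2 ^ Suc l"])
    have "(2::nat) ^ Suc l \<le> 2 ^ Suc q" using that by (intro power_increasing) auto
    with q(3) show "(2::nat) ^ Suc l \<le> X" by linarith
    have "\<bar>(1/2) ^ Suc l :: rat\<bar> \<le> 1" unfolding power_abs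
      by (rule power_le_one) auto
    also have "1 \<le> (of_nat X :: rat)" using H by simp
    finally show "\<bar>(1/2) ^ Suc l :: rat\<bar> \<le> of_nat X" .
    show "(1/2) ^ Suc l * of_nat (2 ^ Suc l) \<in> (\<int> :: rat set)"
      by (simp flip: power_mult_distrib)
  qed simp
  show ?thesis
    unfolding set_accuracy_def
  proof (rule run_le, rule run_AssignN_Seq, rule run_Loop[where N = q and T = 1 and
      I = "\<lambda>i s'. agree {(10, 3)} {} s s' \<and> env s' \<and> num s' (10, 3) = (1/2) ^ Suc i \<and> i \<le> q"], goal_cases)
    case (2 i s')
    then have a: "agree {(10, 3)} {} s s'" "env s'" "num s' (10, 3) = (1/2) ^ Suc i" "i \<le> q" by auto
    have "\<epsilon> < (1/2) ^ Suc i" using 2 s(2) agree_num[OF a(1)] by simp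
    then have i: "i < q" using a(4) q(1) by (cases "i = q") auto
    have "enc_len (num s' (10, 3) / 2) \<le> Bd" using f[of "Suc i"] i unfolding a(3) by simp
    with a i show ?case by (auto intro!: wp_runI simp: env_nums_def)
  next
    case (3 i s')
    then have a: "agree {(10, 3)} {} s s'" "env s'" "num s' (10, 3) = (1/2) ^ Suc i" "i \<le> q" by auto
    have "(1/2) ^ Suc i \<le> \<epsilon>" using 3 s(2) agree_num[OF a(1)] by simp
    then have "i = q" using a(4) q(2)[of i] by (cases "i = q") auto
    with a show ?case by blast
  qed (use s f[of 0] in \<open>auto simp: env_nums_def\<close>)
qed

lemma run_set_dimension:
  assumes s: "env s" and n: "n \<le> X"
  shows "run Bd set_dimension s (n * 3 + 3) (\<lambda>s'.
    agree {(10, 4)} {(0, 2)} s s' \<and> env s' \<and> num s' (10, 4) = of_nat n)"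
  unfolding set_dimension_def
proof (rule run_le, rule run_AssignN_Seq, rule run_AssignI_Seq, rule run_Loop[where N = n and T = 2 and
      I = "\<lambda>i s'. agree {(10, 4)} {(0, 2)} s s' \<and> env s' \<and> num s' (10, 4) = of_nat i \<and>
        idx s' (0, 2) = i \<and> i \<le> n"], goal_cases)
  case (2 i s')
  then have "i < n" by auto
  then have "enc_len (of_nat i + 1) \<le> Bd" using fits_nat[of "Suc i"] n by (simp add: add.commute)
  with 2 \<open>i < n\<close> show ?case
    by (auto intro!: wp_runI simp: env_nums_def env_idxs_def incr_def)
qed (use s fits_nat[of 0] in \<open>auto simp: env_nums_def env_idxs_def\<close>)

lemma run_set_scale:
  assumes s: "env s" "num s (10, 4) = of_nat n" "num s (10, 3) = (1/2) ^ Suc q"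
    and M: "M = 16 * n * n * 2 ^ Suc q" "M * M \<le> X"
  shows "run Bd set_scale s 5 (\<lambda>s'.
    agree {(10, 5), (10, 8)} {} s s' \<and> env s' \<and> num s' (10, 5) = of_nat M \<and>
    num s' (10, 8) = of_nat (M * M))"
proof -
  have "16 * n * n * 1 \<le> M" unfolding M(1) by (intro mult_le_mono2) simp
  then have M1: "16 * n * n \<le> M" by simp
  moreover have "M \<le> M * M" by simp
  moreover have "16 * n * 1 \<le> 16 * n * n" using n by (intro mult_le_mono2) simp
  ultimately have le: "16 * n * n \<le> X" "16 * n \<le> X" "16 \<le> X" "M \<le> X"
    using M(2) n by linarith+
  have e: "16 * of_nat n * of_nat n / num s (10, 3) = (of_nat M :: rat)"
    unfolding M(1) s(3) by (simp add: power_one_over)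
  show ?thesis
    unfolding set_scale_def
    using fits_nat[OF le(1)] fits_nat[OF le(2)] fits_nat[OF le(3)] fits_nat[OF le(4)] fits_nat[OF M(2)] s(1,2) e
    by (auto intro!: wp_runI simp: env_nums_def)
qed

lemma run_set_base:
  assumes s: "env s" "num s (10, 8) = of_nat R"
    and p: "\<And>l. l < p \<Longrightarrow> 2 ^ l < R" "R \<le> 2 ^ p" "2 ^ p * 2 ^ p \<le> X"
  shows "run Bd set_base s (p * 3 + 4) (\<lambda>s'.
    agree {(10, 6), (10, 7), (10, 9)} {} s s' \<and> env s' \<and> num s' (10, 6) = of_nat (2 ^ p) \<and>
    num s' (10, 7) = of_nat p \<and> num s' (10, 9) = of_nat (2 ^ p * 2 ^ p))"
proof -
  have le: "2 ^ l \<le> X" "l \<le> X" if "l \<le> p" for l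
  proof -
    have "(2::nat) ^ l \<le> 2 ^ p" using that by (intro power_increasing) auto
    also have "\<dots> \<le> 2 ^ p * 2 ^ p" by simp
    finally show "2 ^ l \<le> X" using p(3) by linarith
    then show "l \<le> X" using less_exp[of l] by linarith
  qed
  let ?I = "\<lambda>i s'. agree {(10, 6), (10, 7), (10, 9)} {} s s' \<and> env s' \<and> num s' (10, 6) = of_nat (2 ^ i) \<and>
        num s' (10, 7) = of_nat i \<and> i \<le> p"
  have loop: "run Bd (Loop (LessN nB nR) (AssignN nB (NMul nB nTwo) ;; AssignN nP (NAdd nP nOne))) s1
     (p * (2 + 1) + 1) (?I p)" if "?I 0 s1" for s1
  proof (rule run_Loop[where I = ?I], goal_cases)
    case (2 i s')
    have r: "num s' (10, 8) = of_nat R" using 2 s(2) agree_num by fastforce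
    have "of_nat (2 ^ i) < (of_nat R :: rat)" using 2 r by auto
    then have "2 ^ i < R" unfolding of_nat_less_iff .
    then have i: "i < p" using p(2) 2 by (cases "i = p") auto
    have "enc_len (of_nat (2 ^ i) * 2) \<le> Bd" using fits_nat[OF le(1)[of "Suc i"]] i by (simp add: mult.commute)
    moreover have "enc_len (of_nat i + 1) \<le> Bd" using fits_nat[OF le(2)[of "Suc i"]] i by (simp add: add.commute)
    ultimately show ?case using 2 i by (auto intro!: wp_runI simp: env_nums_def)
  next
    case (3 i s')
    have r: "num s' (10, 8) = of_nat R" using 3 s(2) agree_num by fastforce
    have "\<not> of_nat (2 ^ i) < (of_nat R :: rat)" using 3 r by auto
    then have "\<not> 2 ^ i < R" unfolding of_nat_less_iff .
    then have "i = p" using p(1)[of i] 3 by (cases "i = p") auto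
    then show ?case using 3 by blast
  qed (use that in blast)
  show ?thesis
    unfolding set_base_def
  proof (rule run_le, rule run_AssignN_Seq, rule run_AssignN_Seq, rule run_Seq_wp[OF loop], goal_cases)
    case (2 s')
    then show ?case using fits_nat[OF p(3)] by (auto simp: env_nums_def)
  qed (use s fits_nat[of 0] fits_nat[of 1] H in \<open>auto simp: env_nums_def\<close>)
qed

end

text \<open>Index registers admit no multiplication, so states are enumerated by counting in base \<open>S\<close> and
  compared digit by digit. After \<open>S ^ k\<close> increments the digits are 0 again, which makes resetting
  them unnecessary.\<close>

definition odometer :: "nat \<Rightarrow> com" where
  "odometer a = AssignI iI (IConst 0) ;; AssignI iCarry (IConst 1) ;;
     Loop (LessI iI iK)
       (Cond (LessI iZ iCarry)
          (AssignN (Elem a 2) (NAdd (Elem a 2) nOne) ;;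
           Cond (LessN nR (Elem a 2)) (AssignN (Elem a 2) (NCopy nZero)) (AssignI iCarry (IConst 0)))
          Skip ;;
        incr iI)"

text \<open>Obtains \<open>S ^ k\<close> in an index register: the odometer reports a carry out of
  its last digit at the moment when it wraps around.\<close>

definition count_states :: com where
  "count_states = AssignI iS (IConst 0) ;; AssignI iCarry (IConst 0) ;;
     Loop (LeI iCarry iZ) (odometer 5 ;; incr iS)"

text \<open>Incrementing the exponent once before comparing again separates a difference of 1 from a
  larger one without computing the difference.\<close>

definition align_code :: "loc \<Rightarrow> loc \<Rightarrow> loc \<Rightarrow> com" where
  "align_code m e e' = Cond (LessN e e')
     (AssignN e (NAdd e nOne) ;;
      Cond (LessN e e')
        (AssignN m (NCopy nOne) ;; AssignN e (NCopy e'))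
        (AssignN m (NDiv m nB) ;; AssignN m (NFloor m) ;; AssignN m (NAdd m nOne)))
     Skip"

definition normalise_code :: com where
  "normalise_code = Cond (LeN nBB nAm)
     (AssignN nAm (NDiv nAm nB) ;; AssignN nAm (NFloor nAm) ;; AssignN nAm (NAdd nAm nOne) ;;
      AssignN nAe (NAdd nAe nOne)) Skip"

text \<open>Each operand is aligned to the other; the one with the larger exponent passes its call
  unchanged.\<close>

definition float_add :: com where
  "float_add = align_code nAm nAe nXe ;; align_code nXm nXe nAe ;;
     AssignN nAm (NAdd nAm nXm) ;; normalise_code"

definition test_step :: com where
  "test_step = AssignI iFlag (IConst 1) ;; AssignI iI (IConst 0) ;;
     Loop (LessI iI iK)
       (AssignN nT (NMul nY (Elem 8 2)) ;; AssignN nT (NAdd nT (Elem 6 2)) ;;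
        Cond (LessN nT (Elem 5 2)) (AssignI iFlag (IConst 0)) Skip ;;
        Cond (LessN (Elem 5 2) nT) (AssignI iFlag (IConst 0)) Skip ;;
        incr iI)"

text \<open>The digits of a successor are numbers and cannot be turned into an address. Hence all
  states \<open>q\<close> are tried, with the index \<open>iQ\<close> and the digits in array 6
  advancing in step.\<close>

definition add_matching :: com where
  "add_matching = AssignI iQ (IConst 0) ;;
     Loop (LessI iQ iS)
       (test_step ;;
        Cond (LessI iZ iFlag)
          (AssignN nXm (NCopy (Elem 20 8)) ;; AssignN nXe (NCopy (Elem 21 8)) ;; float_add) Skip ;;
        odometer 6 ;; incr iQ)"

definition new_entry :: com where
  "new_entry = AssignN nAm (NCopy nZero) ;; AssignN nAe (NCopy nZero) ;; AssignN nY (NCopy nZero) ;;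
     Loop (LessN nY nM) (add_matching ;; AssignN nY (NAdd nY nOne))"

text \<open>The new entries go to separate arrays, because each of them may read any entry of the
  old table.\<close>

definition new_table :: com where
  "new_table = AssignI iP (IConst 0) ;;
     Loop (LessI iP iS)
       (new_entry ;; AssignN (Elem 22 7) (NCopy nAm) ;; AssignN (Elem 23 7) (NCopy nAe) ;;
        odometer 5 ;; incr iP)"

definition copy_table :: com where
  "copy_table = AssignI iP (IConst 0) ;;
     Loop (LessI iP iS)
       (AssignN (Elem 20 7) (NCopy (Elem 22 7)) ;; AssignN (Elem 21 7) (NCopy (Elem 23 7)) ;; incr iP)"

definition init_table :: com where
  "init_table = AssignI iP (IConst 0) ;;
     Loop (LessI iP iS)
       (AssignN (Elem 20 7) (NCopy nOne) ;; AssignN (Elem 21 7) (NCopy nZero) ;; incr iP)"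

definition upper_bound :: com where
  "upper_bound = AssignN nU (NCopy nOne) ;; AssignI iI (IConst 0) ;;
     Loop (LessI iI iK)
       (Cond (LessN nZero (Elem 7 2))
          (AssignN nT (NDiv (Elem 2 2) (Elem 7 2)) ;;
           Cond (LessN nT nU) (AssignN nU (NCopy nT)) Skip) Skip ;;
        incr iI)"

definition round_column :: com where
  "round_column = AssignI iI (IConst 0) ;;
     Loop (LessI iI iK)
       (AssignN (Elem 8 2) (NMul nM (Elem 7 2)) ;; AssignN (Elem 8 2) (NMul (Elem 8 2) nU) ;;
        AssignN (Elem 8 2) (NDiv (Elem 8 2) (Elem 2 2)) ;; AssignN (Elem 8 2) (NFloor (Elem 8 2)) ;;
        incr iI)"

text \<open>Doubling until the mantissa reaches \<open>B\<close> ensures that the final rounding to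
  an integer is a small relative error.\<close>

definition weight :: com where
  "weight = AssignN nZm (NMul nZm nU) ;; AssignN nZm (NDiv nZm nM) ;;
     Loop (LessN nZm nB) (AssignN nZm (NMul nZm nTwo) ;; AssignN nZe (NSub nZe nOne)) ;;
     AssignN nZm (NFloor nZm) ;; AssignN nZm (NAdd nZm nOne)"

definition stage :: com where
  "stage = get_column ;; upper_bound ;; round_column ;; weight ;; new_table ;; copy_table ;; incr iJ"

text \<open>The entry at \<open>S ^ k - 1\<close> belongs to the state with all right-hand sides
  maximal.\<close>

definition finish :: com where
  "finish = AssignI iP (ICopy iS) ;; AssignI iP (IDec iP) ;;
     AssignN (Cell 3 0) (NMul (Elem 20 7) nZm) ;;
     AssignN (Cell 3 (Suc 0)) (NMul nP (Elem 21 7)) ;;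
     AssignN (Cell 3 (Suc 0)) (NAdd (Cell 3 (Suc 0)) nZe)"

definition count_program :: com where
  "count_program = count_states ;; init_table ;; AssignN nZm (NCopy nOne) ;; AssignN nZe (NCopy nZero) ;;
     AssignI iJ (IConst 0) ;; Loop (LessI iJ iN) stage ;; finish"

text \<open>For a bad instance the program simply stops: the output cells still hold zeros, which
  denote the volume 0.\<close>

definition volume_code :: com where
  "volume_code = AssignN nOne (NConst 1) ;; AssignN nTwo (NConst 2) ;; scan ;;
     Cond (LessI iZ iBad) Skip
       (set_accuracy ;; set_dimension ;; set_scale ;; set_base ;; count_program)"

lemma of_nat_plus_1_less: "of_nat x + 1 < (of_nat y :: rat) \<longleftrightarrow> Suc x < y"
  by (metis add.commute of_nat_Suc of_nat_less_iff)

lemma of_nat_less_plus_1: "of_nat x < (of_nat y + 1 :: rat) \<longleftrightarrow> x \<le> y"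
  by (metis add.commute less_Suc_eq_le of_nat_Suc of_nat_less_iff)

section \<open>Correctness of the counting phase\<close>

text \<open>\<open>D\<close> bounds the doublings made for one coordinate in \<open>weight\<close>.
  The bounds on \<open>X\<close> cover the product of the final mantissas, the scaled entries, the
  denominators of exact intermediate values, and the output exponent.\<close>

locale counting_program = volume_program +
  fixes M R B BB p\<^sub>B D :: nat
  assumes B: "B = 2 ^ p\<^sub>B" "R \<le> B" and M: "16 \<le> M" "n \<le> M"
    and R: "R = M * M" and BB: "BB = B * B"
    and good: "\<And>i j. i < k \<Longrightarrow> j < n \<Longrightarrow> \<not> bad A b i j"
    and D: "B * M * H \<le> 2 ^ D"
    and X: "4 * BB * B \<le> X" "H * M \<le> X" "H * H \<le> X" "p\<^sub>B * (n * M) + n * D \<le> X"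
begin

abbreviation "S \<equiv> Suc R"

definition env1 :: "store \<Rightarrow> bool" where
  "env1 s \<longleftrightarrow> env s \<and> num s (10, 5) = of_nat M \<and> num s (10, 6) = of_nat B \<and>
     num s (10, 7) = of_nat p\<^sub>B \<and> num s (10, 8) = of_nat R \<and> num s (10, 9) = of_nat BB"

lemma env1_simps [simp]:
  assumes "env1 s"
  shows "env s" "num s (10, 5) = of_nat M" "num s (10, 6) = of_nat B"
    "num s (10, 7) = of_nat p\<^sub>B" "num s (10, 8) = of_nat R" "num s (10, 9) = of_nat BB"
    "idx s (0, 0) = k" "idx s (0, Suc 0) = n" "idx s (0, 9) = 0"
    "num s (10, 0) = 0" "num s (10, Suc 0) = 1" "num s (10, 2) = 2"
    "i < k \<Longrightarrow> num s (2, i) = of_int (b i)"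
  using assms unfolding env1_def by simp_all

definition fixed_nums :: "(nat \<times> nat) set" where
  "fixed_nums = {Suc 0, 2} \<times> UNIV \<union> {10} \<times> {0, Suc 0, 2, 5, 6, 7, 8, 9}"

lemma env1_agree:
  assumes s: "env1 s" and a: "agree V W s s'" and d: "V \<inter> fixed_nums = {}" "W \<inter> env_idxs = {}"
  shows "env1 s'"
proof -
  have "V \<inter> env_nums = {}" using d(1) by (auto simp: env_nums_def fixed_nums_def)
  then have e: "env s'" using env_agree[OF _ a _ d(2)] s by simp
  have N: "num s' x = num s x" if "x \<in> fixed_nums" for x
    using that d agree_num[OF a] by blast
  have "num s' (10, 5) = num s (10, 5)" "num s' (10, 6) = num s (10, 6)"
    "num s' (10, 7) = num s (10, 7)" "num s' (10, 8) = num s (10, 8)" "num s' (10, 9) = num s (10, 9)"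
    by (rule N, simp add: fixed_nums_def)+
  with e s show ?thesis unfolding env1_def by simp
qed

lemma env1_set_num [simp]: "addr s l \<notin> fixed_nums \<Longrightarrow> env1 s \<Longrightarrow> env1 (set_num s l r)"
  by (erule env1_agree[where V = "{addr s l}" and W = "{}"]) auto

lemma env1_set_idx [simp]: "addr s l \<notin> env_idxs \<Longrightarrow> env1 s \<Longrightarrow> env1 (set_idx s l r)"
  by (erule env1_agree[where V = "{}" and W = "{addr s l}"]) auto

lemma B_ge: "256 \<le> R" "256 \<le> B" "M \<le> R"
proof -
  have "16 * 16 \<le> M * M" using M(1) by (intro mult_le_mono)
  then show "256 \<le> R" by (simp add: R)
  with B show "256 \<le> B" by simp
  show "M \<le> R" using M(1) by (simp add: R)
qed

lemma X_ge: "4 * BB \<le> X" "1024 * B \<le> X" "1024 * R \<le> X" "1024 * M \<le> X"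
proof -
  have "4 * BB * 1 \<le> 4 * BB * B" using B_ge by (intro mult_le_mono2) simp
  then show 1: "4 * BB \<le> X" using X(1) by linarith
  have "256 * B \<le> B * B" using B_ge by (intro mult_le_mono1)
  with 1 show 2: "1024 * B \<le> X" unfolding BB by linarith
  with B B_ge show "1024 * R \<le> X" "1024 * M \<le> X" by linarith+
qed

lemma fits_Suc: "Suc x \<le> X \<Longrightarrow> enc_len (of_nat x + 1) \<le> Bd"
  using fits_nat[of "Suc x"] by (simp add: add.commute)

lemma fits_0_1 [simp]: "enc_len 0 \<le> Bd" "enc_len 1 \<le> Bd"
  using fits_nat[of 0] fits_nat[of 1] H by simp_all

lemma fits_div: "x \<le> X \<Longrightarrow> enc_len (of_nat x / of_nat B) \<le> Bd"
proof (rule fits[of B])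
  assume "x \<le> X"
  have "of_nat x / of_nat B \<le> (of_nat x / 1 :: rat)" using B_ge by (intro divide_left_mono) auto
  also have "\<dots> \<le> of_nat X" using \<open>x \<le> X\<close> by simp
  finally show "\<bar>of_nat x / of_nat B :: rat\<bar> \<le> of_nat X" by simp
qed (use B_ge X_ge in auto)

section \<open>Enumeration of the states\<close>

lemma run_odometer:
  assumes s: "env1 s" and a: "a \<in> {5, 6}"
    and dig: "\<And>i. i < k \<Longrightarrow> num s (a, i) = of_nat (digit S p i)"
  shows "run Bd (odometer a) s (k * 6 + 3) (\<lambda>s'.
    agree ({a} \<times> UNIV) {(0, 2), (0, 11)} s s' \<and> env1 s' \<and>
    (\<forall>i<k. num s' (a, i) = of_nat (digit S (Suc p) i)) \<and>
    idx s' (0, 11) = (if S ^ k dvd Suc p then 1 else 0))"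
proof -
  \<comment> \<open>After \<open>i\<close> rounds the lowest \<open>i\<close> digits are those of
    \<open>Suc p\<close>, the others still those of \<open>p\<close>, and the carry is alive exactly
    if \<open>S ^ i\<close> divides \<open>Suc p\<close>.\<close>
  let ?d = "\<lambda>i l. if l < i then digit S (Suc p) l else digit S p l"
  let ?I = "\<lambda>i s'. agree ({a} \<times> UNIV) {(0, 2), (0, 11)} s s' \<and> env1 s' \<and>
    idx s' (0, 2) = i \<and> i \<le> k \<and> (\<forall>l<k. num s' (a, l) = of_nat (?d i l)) \<and>
    idx s' (0, 11) = (if S ^ i dvd Suc p then 1 else 0)"
  have aa: "(a, i) \<notin> fixed_nums" "a \<noteq> 10" for i using a by (auto simp: fixed_nums_def)
  show ?thesis
    unfolding odometer_def
  proof (rule run_le, rule run_AssignI_Seq, rule run_AssignI_Seq,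
      rule run_Loop[where I = ?I and N = k and T = 5], goal_cases)
    case (2 i s')
    then have i: "i < k" and I: "?I i s'" by auto
    have d: "num s' (a, i) = of_nat (digit S p i)" using I i by simp
    have le: "digit S p i \<le> R" using digit_less[of S p i] by simp
    have f: "enc_len (of_nat (digit S p i) + 1) \<le> Bd" using le X_ge B_ge by (intro fits_Suc) linarith
    show ?case
    proof (cases "S ^ i dvd Suc p")
      case True
      have c: "S ^ Suc i dvd Suc p \<longleftrightarrow> digit S p i = R"
        "digit S (Suc p) i = (if digit S p i = R then 0 else Suc (digit S p i))"
        using digit_Suc_carry[OF _ True] B_ge by auto
      have l: "of_nat R < (of_nat (digit S p i) + 1 :: rat) \<longleftrightarrow> digit S p i = R"
        using le by (auto simp: of_nat_less_plus_1)
      show ?thesis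
        apply (rule conjI[OF i])
        apply (rule wp_runI)
         apply (use i I aa d f True in \<open>auto simp: incr_def env_idxs_def less_Suc_eq l c simp del: power_Suc\<close>)
        done
    next
      case False
      note c = digit_Suc_no_carry[OF False]
      show ?thesis
        apply (rule conjI[OF i])
        apply (rule wp_runI)
         apply (use i I aa d f False c in \<open>auto simp: incr_def env_idxs_def less_Suc_eq simp del: power_Suc\<close>)
        done
    qed
  qed (use s dig in \<open>auto simp: env_idxs_def\<close>)
qed

lemma run_count_states:
  assumes s: "env1 s" and dig: "\<And>i. i < k \<Longrightarrow> num s (5, i) = 0"
  shows "run Bd count_states s (S ^ k * (k * 6 + 5) + 3) (\<lambda>s'.
    agree ({5} \<times> UNIV) {(0, 2), (0, 6), (0, 11)} s s' \<and> env1 s' \<and>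
    (\<forall>i<k. num s' (5, i) = 0) \<and> idx s' (0, 6) = S ^ k)"
proof -
  let ?I = "\<lambda>p s'. agree ({5} \<times> UNIV) {(0, 2), (0, 6), (0, 11)} s s' \<and> env1 s' \<and>
    (\<forall>i<k. num s' (5, i) = of_nat (digit S p i)) \<and> idx s' (0, 6) = p \<and>
    idx s' (0, 11) = (if p = S ^ k then 1 else 0) \<and> p \<le> S ^ k"
  show ?thesis
    unfolding count_states_def
  proof (rule run_le, rule run_AssignI_Seq, rule run_AssignI_Seq,
      rule run_Loop[where I = ?I and N = "S ^ k" and T = "k * 6 + 3 + 1"], goal_cases)
    case (2 p s')
    then have p: "p < S ^ k" and I: "?I p s'" by (auto split: if_splits)
    \<comment> \<open>Within the first \<open>S ^ k\<close> increments a carry leaves the last digit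
      only at the very end.\<close>
    have d: "S ^ k dvd Suc p \<longleftrightarrow> Suc p = S ^ k" using p by (auto dest: dvd_imp_le)
    have "run Bd (odometer 5 ;; incr iS) s' (k * 6 + 3 + 1) (?I (Suc p))"
    proof (rule run_Seq_wp[OF run_odometer[where p = p]], goal_cases)
      case (4 s2)
      then have a: "agree ({5} \<times> UNIV) {(0, 2), (0, 11)} s' s2" by blast
      have "agree ({5} \<times> UNIV) {(0, 2), (0, 6), (0, 11)} s s2"
        by (rule agree_trans[OF conjunct1[OF I] a]) auto
      with 4 I p d show ?case by (auto simp: incr_def env_idxs_def agree_idx[OF a])
    qed (use I in \<open>auto simp: incr_def\<close>)
    with p show ?case by blast
  next
    case (3 p s')
    then have "p = S ^ k" by (auto split: if_splits)
    with 3 show ?case by auto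
  qed (use s dig in \<open>auto simp: env_idxs_def\<close>)
qed

section \<open>Floating point addition in the store\<close>

text \<open>The cells are parameters because \<open>float_add\<close> uses the same code for either
  operand.\<close>

lemma wp_align_code:
  assumes s: "env1 s" "num s (10, m) = of_nat (fst x)" "num s (10, e) = of_nat (snd x)"
      "num s (10, e') = of_nat e\<^sub>y"
    and cells: "10 \<le> m" "10 \<le> e" "m \<noteq> e" "m \<noteq> e'" "e \<noteq> e'"
    and le: "fst x < X" "snd x < X" "e\<^sub>y \<le> X"
    and Q: "\<And>s'. agree {(10, m), (10, e)} {} s s' \<Longrightarrow> env1 s' \<Longrightarrow>
      num s' (10, m) = of_nat (align B x e\<^sub>y) \<Longrightarrow> num s' (10, e) = of_nat (max (snd x) e\<^sub>y) \<Longrightarrow> Q s'"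
  shows "wp Bd (align_code (Cell 10 m) (Cell 10 e) (Cell 10 e')) Q s"
proof -
  have m: "(10, m) \<notin> fixed_nums" "(10, e) \<notin> fixed_nums"
    "m \<noteq> 0" "m \<noteq> Suc 0" "m \<noteq> 6" "e \<noteq> 0" "e \<noteq> Suc 0" "e \<noteq> 6"
    using cells by (auto simp: fixed_nums_def)
  have "fst x div B \<le> fst x" by simp
  then have le': "fst x div B < X" using le(1) by (rule le_less_trans)
  have f: "enc_len (of_nat (snd x) + 1) \<le> Bd" "enc_len (of_nat e\<^sub>y) \<le> Bd"
    "enc_len (of_nat (fst x) / of_nat B) \<le> Bd" "enc_len (of_nat (fst x div B)) \<le> Bd"
    "enc_len (of_nat (fst x div B) + 1) \<le> Bd"
    using le le' by (auto intro!: fits_Suc fits_nat fits_div)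
  have fl: "of_int \<lfloor>of_nat (fst x) / of_nat B :: rat\<rfloor> = (of_nat (fst x div B) :: rat)"
    by (simp add: floor_divide_of_nat_eq)
  consider "e\<^sub>y \<le> snd x" | "e\<^sub>y = Suc (snd x)" | "Suc (snd x) < e\<^sub>y" by linarith
  then show ?thesis
  proof cases
    case 1
    then show ?thesis
      unfolding align_code_def using s by (auto intro!: Q simp: align_def max_def)
  next
    case 2
    then show ?thesis
      unfolding align_code_def using s cells m f fl
      by (auto intro!: Q simp: align_def max_def of_nat_plus_1_less)
  next
    case 3
    then show ?thesis
      unfolding align_code_def using s cells m f
      by (auto intro!: Q simp: align_def max_def of_nat_plus_1_less)
  qed
qed

lemma wp_float_add:
  assumes s: "env1 s" "num s (10, 15) = of_nat (fst x)" "num s (10, 16) = of_nat (snd x)"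
      "num s (10, 17) = of_nat (fst y)" "num s (10, 18) = of_nat (snd y)"
    and x: "fnorm B x" "snd x < X" and y: "fnorm B y" "snd y < X"
    and Q: "\<And>s'. agree ({10} \<times> {15, 16, 17, 18}) {} s s' \<Longrightarrow> env1 s' \<Longrightarrow>
      num s' (10, 15) = of_nat (fst (fadd B x y)) \<Longrightarrow>
      num s' (10, 16) = of_nat (snd (fadd B x y)) \<Longrightarrow> Q s'"
  shows "wp Bd float_add Q s"
proof -
  have lt: "fst x < X" "fst y < X" using x(1) y(1) X_ge(1) by (auto simp: fnorm_def BB)
  define e where "e = max (snd x) (snd y)"
  define z where "z = align B x e + align B y e"
  \<comment> \<open>Aligning to an exponent that is not larger changes nothing, so
    \<open>snd y\<close> may be replaced by the maximum.\<close>
  have al: "align B x (snd y) = align B x e" by (auto simp: align_def e_def max_def)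
  have B0: "B > 0" using B_ge by simp
  have "align B x e < B * B \<or> B = 1" "align B y e < B * B \<or> B = 1"
    by (rule align_bounds(3)[OF B0 x(1)], simp add: e_def, rule align_bounds(3)[OF B0 y(1)], simp add: e_def)
  then have zX: "z < X" using X_ge(1) B_ge by (auto simp: z_def BB)
  have "z div B \<le> z" by simp
  then have zX': "z div B < X" using zX by (rule le_less_trans)
  have eX: "e < X" using x(2) y(2) by (simp add: e_def)
  have f: "enc_len (of_nat z) \<le> Bd" "enc_len (of_nat z / of_nat B) \<le> Bd" "enc_len (of_nat (z div B)) \<le> Bd"
    "enc_len (of_nat (z div B) + 1) \<le> Bd" "enc_len (of_nat e + 1) \<le> Bd"
    using zX zX' eX by (auto intro!: fits_Suc fits_nat fits_div)
  have fl: "of_int \<lfloor>of_nat z / of_nat B :: rat\<rfloor> = (of_nat (z div B) :: rat)"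
    by (simp add: floor_divide_of_nat_eq)
  have fa: "fadd B x y = (if BB \<le> z then (z div B + 1, e + 1) else (z, e))"
    by (simp add: fadd_def Let_def BB z_def e_def)
  show ?thesis
    unfolding float_add_def wp.simps
  proof (rule wp_align_code[where x = x and e\<^sub>y = "snd y"])
    fix s1 assume 1: "agree {(10, 15), (10, 16)} {} s s1" "env1 s1"
      "num s1 (10, 15) = of_nat (align B x (snd y))" "num s1 (10, 16) = of_nat (max (snd x) (snd y))"
    show "wp Bd (align_code (Cell 10 17) (Cell 10 18) (Cell 10 16))
        (\<lambda>s. enc_len (nval s (NAdd (Cell 10 15) (Cell 10 17))) \<le> Bd \<and>
          wp Bd normalise_code Q (set_num s (Cell 10 15) (nval s (NAdd (Cell 10 15) (Cell 10 17))))) s1"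
    proof (rule wp_align_code[where x = y and e\<^sub>y = e])
      fix s2 assume 2: "agree {(10, 17), (10, 18)} {} s1 s2" "env1 s2"
        "num s2 (10, 17) = of_nat (align B y e)"
      have a: "agree ({10} \<times> {15, 16, 17, 18}) {} s s2"
        using agree_mono[OF 1(1)] by (rule agree_trans[OF _ 2(1)]) auto
      have c: "num s2 (10, 15) + num s2 (10, 17) = of_nat z" "num s2 (10, 16) = of_nat e"
        using 1 2 agree_num[OF 2(1)] by (simp_all add: z_def al e_def)
      have "wp Bd normalise_code Q (set_num s2 (Cell 10 15) (of_nat z))"
        unfolding normalise_code_def using a 2(2) c f fl
        by (auto intro!: Q simp: fixed_nums_def fa)
      then show "enc_len (nval s2 (NAdd (Cell 10 15) (Cell 10 17))) \<le> Bd \<and>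
          wp Bd normalise_code Q (set_num s2 (Cell 10 15) (nval s2 (NAdd (Cell 10 15) (Cell 10 17))))"
        using f c by simp
    qed (use 1 s lt y eX agree_num[OF 1(1)] in \<open>auto simp: e_def\<close>)
  qed (use s lt x y in auto)
qed

lemma cost_float_add: "cost float_add = 18"
  by (simp add: float_add_def align_code_def normalise_code_def)

definition flt :: "store \<Rightarrow> nat \<times> nat \<Rightarrow> nat \<times> nat \<Rightarrow> nat \<Rightarrow> nat \<Rightarrow> bool" where
  "flt s l l' E v \<longleftrightarrow>
     (\<exists>x. num s l = of_nat (fst x) \<and> num s l' = of_nat (snd x) \<and> apx B E x v)"

lemma flt_cong: "num s' l = num s l \<Longrightarrow> num s' l' = num s l' \<Longrightarrow> flt s' l l' E v = flt s l l' E v"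
  by (simp add: flt_def)

lemma flt_fits:
  assumes "flt s l l' E v" and "E \<le> X"
  shows "enc_len (num s l) \<le> Bd" "enc_len (num s l') \<le> Bd"
  using assms X_ge(1) by (auto simp: flt_def apx_def fnorm_def BB intro!: fits_nat)

lemma run_test_step:
  assumes s: "env1 s" "num s (10, 14) = of_nat y" "y \<le> M"
    and c: "\<And>i. i < k \<Longrightarrow> num s (8, i) = of_nat (c i j) \<and> c i j \<le> M"
    and p: "\<And>i. i < k \<Longrightarrow> num s (5, i) = of_nat (digit S p i)"
    and q: "\<And>i. i < k \<Longrightarrow> num s (6, i) = of_nat (digit S q i)"
  shows "run Bd test_step s (k * 8 + 3) (\<lambda>s'. agree {(10, 11)} {(0, 2), (0, 12)} s s' \<and> env1 s' \<and>
    idx s' (0, 12) = (if step k S c j p y q then 1 else 0))"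
proof -
  let ?P = "\<lambda>i. y * c i j + digit S q i = digit S p i"
  let ?I = "\<lambda>i s'. agree {(10, 11)} {(0, 2), (0, 12)} s s' \<and> env1 s' \<and> idx s' (0, 2) = i \<and> i \<le> k \<and>
    idx s' (0, 12) = (if \<forall>l<i. ?P l then 1 else 0)"
  show ?thesis
    unfolding test_step_def
  proof (rule run_le, rule run_AssignI_Seq, rule run_AssignI_Seq,
      rule run_Loop[where I = ?I and N = k and T = 7], goal_cases)
    case (2 i s')
    then have i: "i < k" and I: "?I i s'" by auto
    note a = agree_num[OF conjunct1[OF I]]
    have v: "num s' (10, 14) = of_nat y" "num s' (8, i) = of_nat (c i j)"
      "num s' (5, i) = of_nat (digit S p i)" "num s' (6, i) = of_nat (digit S q i)"
      using s c[OF i] p[OF i] q[OF i] a by simp_all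
    have "digit S q i \<le> R" using digit_less[of S q i] by simp
    moreover have "y * c i j \<le> R" unfolding R using s(3) c[OF i] by (intro mult_le_mono) auto
    ultimately have "y * c i j \<le> X" "y * c i j + digit S q i \<le> X" using X_ge B_ge by linarith+
    then have f: "enc_len (of_nat (y * c i j)) \<le> Bd" "enc_len (of_nat (y * c i j + digit S q i)) \<le> Bd"
      by (auto intro!: fits_nat simp del: of_nat_mult of_nat_add)
    have lt: "of_nat y * of_nat (c i j) + of_nat (digit S q i) < (of_nat (digit S p i) :: rat) \<longleftrightarrow>
        y * c i j + digit S q i < digit S p i"
      "(of_nat (digit S p i) :: rat) < of_nat y * of_nat (c i j) + of_nat (digit S q i) \<longleftrightarrow>
        digit S p i < y * c i j + digit S q i"
      by (simp_all flip: of_nat_mult of_nat_add)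
    show ?case
      apply (rule conjI[OF i])
      apply (rule wp_runI)
       apply (use i I v f in \<open>auto simp: incr_def env_idxs_def fixed_nums_def less_Suc_eq lt\<close>)
      done
  qed (use s in \<open>auto simp: env_idxs_def step_def\<close>)
qed

section \<open>One step of the dynamic program\<close>

text \<open>\<open>V\<close> gives the exact values of which arrays 20 and 21 hold approximations of
  depth \<open>E\<close>.\<close>

definition tab :: "(nat \<Rightarrow> nat \<Rightarrow> nat) \<Rightarrow> nat \<Rightarrow> (nat \<Rightarrow> nat) \<Rightarrow> nat \<Rightarrow> store \<Rightarrow> bool" where
  "tab c j V E s \<longleftrightarrow> env1 s \<and> idx s (0, 6) = S ^ k \<and> (\<forall>i<k. num s (8, i) = of_nat (c i j)) \<and>
     (\<forall>q<S ^ k. flt s (20, q) (21, q) E (V q))"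

lemma tab_env1 [simp]: "tab c j V E s \<Longrightarrow> env1 s"
  and tab_idx [simp]: "tab c j V E s \<Longrightarrow> idx s (0, 6) = S ^ k"
  and tab_c: "tab c j V E s \<Longrightarrow> i < k \<Longrightarrow> num s (8, i) = of_nat (c i j)"
  and tab_flt: "tab c j V E s \<Longrightarrow> q < S ^ k \<Longrightarrow> flt s (20, q) (21, q) E (V q)"
  unfolding tab_def by blast+

lemma tab_agree:
  assumes t: "tab c j V E s" and a: "agree U W s s'"
    and d: "U \<inter> (fixed_nums \<union> {8, 20, 21} \<times> UNIV) = {}" "W \<inter> insert (0, 6) env_idxs = {}"
  shows "tab c j V E s'"
proof -
  have "U \<inter> fixed_nums = {}" "W \<inter> env_idxs = {}" using d by blast+
  then have "env1 s'" using env1_agree[OF tab_env1[OF t] a] by blast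
  moreover have "num s' (l, i) = num s (l, i)" if "l \<in> {8, 20, 21}" for l i
    using d(1) that by (intro agree_num[OF a]) blast
  moreover have "idx s' (0, 6) = idx s (0, 6)"
    using d(2) by (intro agree_idx[OF a]) blast
  ultimately show ?thesis using t unfolding tab_def flt_def by simp
qed

lemma tab_set_num [simp]:
  "addr s l \<notin> fixed_nums \<union> {8, 20, 21} \<times> UNIV \<Longrightarrow> tab c j V E s \<Longrightarrow> tab c j V E (set_num s l r)"
  by (erule tab_agree[where U = "{addr s l}" and W = "{}"]) auto

lemma tab_set_idx [simp]:
  "addr s l \<notin> insert (0, 6) env_idxs \<Longrightarrow> tab c j V E s \<Longrightarrow> tab c j V E (set_idx s l r)"
  by (erule tab_agree[where U = "{}" and W = "{addr s l}"]) auto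

lemma flt_mono: "flt s l l' E v \<Longrightarrow> E \<le> E' \<Longrightarrow> flt s l l' E' v"
  unfolding flt_def using apx_mono by blast

definition hits :: "(nat \<Rightarrow> nat \<Rightarrow> nat) \<Rightarrow> nat \<Rightarrow> nat \<Rightarrow> nat \<Rightarrow> nat \<Rightarrow> nat set" where
  "hits c j p y q = {q' \<in> {..<q}. step k S c j p y q'}"

lemma hits_0 [simp]: "hits c j p y 0 = {}"
  and finite_hits [simp]: "finite (hits c j p y q)"
  and not_in_hits [simp]: "q \<notin> hits c j p y q"
  by (simp_all add: hits_def)

lemma card_hits_le_1: "q \<le> S ^ k \<Longrightarrow> card (hits c j p y q) \<le> 1"
  unfolding hits_def by (rule card_step_le_1)

lemma hits_Suc: "hits c j p y (Suc q) = (if step k S c j p y q then insert q (hits c j p y q) else hits c j p y q)"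
  by (auto simp: hits_def less_Suc_eq)

text \<open>Although the loop tries \<open>S ^ k\<close> candidates, the nesting depth rises only by
  1, as at most one of them is a successor.\<close>

lemma run_add_matching:
  assumes s: "tab c j V E0 s" "num s (10, 14) = of_nat y" "y < M"
    and c: "\<And>i. i < k \<Longrightarrow> c i j \<le> M"
    and p: "\<And>i. i < k \<Longrightarrow> num s (5, i) = of_nat (digit S p i)"
    and q: "\<And>i. i < k \<Longrightarrow> num s (6, i) = 0"
    and acc: "flt s (10, 15) (10, 16) E v" and E: "E0 \<le> E" "Suc E < X"
  shows "run Bd add_matching s (S ^ k * (k * 14 + 29) + 2) (\<lambda>s'.
    agree ({6} \<times> UNIV \<union> {10} \<times> {11, 15, 16, 17, 18}) ({0} \<times> {2, 8, 11, 12}) s s' \<and>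
    tab c j V E0 s' \<and> (\<forall>i<k. num s' (6, i) = 0) \<and>
    flt s' (10, 15) (10, 16) (Suc E) (v + (\<Sum>q\<in>hits c j p y (S ^ k). V q)))"
proof -
  let ?U = "{6} \<times> UNIV \<union> {10} \<times> {11, 15, 16, 17, 18 :: nat}" and ?W = "{0} \<times> {2, 8, 11, 12 :: nat}"
  \<comment> \<open>The depth grows with the number of matches found so far rather than with the
    number of rounds.\<close>
  let ?F = "\<lambda>q s'. flt s' (10, 15) (10, 16) (E + card (hits c j p y q)) (v + (\<Sum>q\<in>hits c j p y q. V q))"
  let ?I = "\<lambda>q s'. agree ?U ?W s s' \<and> tab c j V E0 s' \<and> idx s' (0, 8) = q \<and> q \<le> S ^ k \<and>
    (\<forall>i<k. num s' (6, i) = of_nat (digit S q i)) \<and> ?F q s'"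
  show ?thesis
    unfolding add_matching_def
  proof (rule run_le, rule run_AssignI_Seq,
      rule run_Loop[where I = ?I and N = "S ^ k" and T = "(k * 8 + 3) + (21 + (k * 6 + 3 + 1))"], goal_cases)
    case (2 q s1)
    then have q: "q < S ^ k" and I: "?I q s1" by auto
    then have t1: "tab c j V E0 s1" and a1: "agree ?U ?W s s1" by blast+
    have "run Bd (test_step ;; Cond (LessI iZ iFlag)
          (AssignN nXm (NCopy (Elem 20 8)) ;; AssignN nXe (NCopy (Elem 21 8)) ;; float_add) Skip ;;
        odometer 6 ;; incr iQ) s1 ((k * 8 + 3) + (21 + (k * 6 + 3 + 1))) (?I (Suc q))"
    proof (rule run_Seq[OF run_test_step[where j = j and c = c and p = p and q = q and y = y]], goal_cases)
      case (7 s2)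
      then have a2: "agree {(10, 11)} {(0, 2), (0, 12)} s1 s2" and fl: "idx s2 (0, 12) = (if step k S c j p y q then 1 else 0)"
        by blast+
      have t2: "tab c j V E0 s2" by (rule tab_agree[OF t1 a2]) (auto simp: fixed_nums_def env_idxs_def)
      have a2': "agree ?U ?W s s2" by (rule agree_trans[OF a1 a2]) auto
      have F2: "?F q s2" using I by (subst flt_cong[where s = s1]) (auto simp: agree_num[OF a2])
      have q2: "idx s2 (0, 8) = q" "\<forall>i<k. num s2 (6, i) = of_nat (digit S q i)"
        using I by (auto simp: agree_num[OF a2] agree_idx[OF a2])
      let ?R = "\<lambda>s3. agree ?U ?W s s3 \<and> tab c j V E0 s3 \<and> idx s3 (0, 8) = q \<and>
         (\<forall>i<k. num s3 (6, i) = of_nat (digit S q i)) \<and> ?F (Suc q) s3"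
      have "wp Bd (Cond (LessI iZ iFlag)
          (AssignN nXm (NCopy (Elem 20 8)) ;; AssignN nXe (NCopy (Elem 21 8)) ;; float_add) Skip) ?R s2"
      proof (cases "step k S c j p y q")
        case False
        then show ?thesis using a2' t2 F2 q2 fl by (simp add: hits_Suc)
      next
        case True
        from tab_flt[OF t2 q] obtain z where z: "num s2 (20, q) = of_nat (fst z)"
          "num s2 (21, q) = of_nat (snd z)" "apx B E0 z (V q)" by (auto simp: flt_def)
        from F2 obtain x where x: "num s2 (10, 15) = of_nat (fst x)" "num s2 (10, 16) = of_nat (snd x)"
          "apx B (E + card (hits c j p y q)) x (v + (\<Sum>q\<in>hits c j p y q. V q))" by (auto simp: flt_def)
        have h: "hits c j p y (Suc q) = insert q (hits c j p y q)" using True by (simp add: hits_Suc)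
        \<comment> \<open>Successors are unique, so a match found now is the first one.\<close>
        have "card (hits c j p y (Suc q)) \<le> 1" using q by (intro card_hits_le_1) simp
        then have c0: "card (hits c j p y q) = 0" unfolding h by simp
        have le: "snd x < X" "snd z < X" using x z E c0 by (auto simp: apx_def)
        have fe: "enc_len (num s2 (20, q)) \<le> Bd" "enc_len (num s2 (21, q)) \<le> Bd"
          using E by (auto intro!: flt_fits[OF tab_flt[OF t2 q]])
        have "apx B (Suc E) (fadd B x z) ((v + (\<Sum>q\<in>hits c j p y q. V q)) + V q)"
          using x z E c0 B_ge by (intro apx_fadd) (auto intro: apx_mono)
        then have sum: "apx B (E + card (hits c j p y (Suc q))) (fadd B x z) (v + (\<Sum>q\<in>hits c j p y (Suc q). V q))"
          using c0 unfolding h by (simp add: algebra_simps)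
        let ?s = "set_num (set_num s2 nXm (of_nat (fst z))) nXe (of_nat (snd z))"
        have as: "agree ?U ?W s ?s" using a2' by simp
        have ts: "tab c j V E0 ?s" using t2 by (simp add: fixed_nums_def)
        have "wp Bd float_add ?R ?s"
        proof (rule wp_float_add[where x = x and y = z])
          fix s3 assume 3: "agree ({10} \<times> {15, 16, 17, 18}) {} ?s s3" "env1 s3"
            "num s3 (10, 15) = of_nat (fst (fadd B x z))" "num s3 (10, 16) = of_nat (snd (fadd B x z))"
          have "agree ?U ?W s s3" by (rule agree_trans[OF as 3(1)]) auto
          moreover have "tab c j V E0 s3"
            by (rule tab_agree[OF ts 3(1)]) (auto simp: fixed_nums_def)
          moreover have "idx s3 (0, 8) = q" "\<forall>i<k. num s3 (6, i) = of_nat (digit S q i)"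
            using q2 by (simp_all add: agree_num[OF 3(1)] agree_idx[OF 3(1)])
          moreover have "?F (Suc q) s3" using 3 sum by (auto simp: flt_def)
          ultimately show "?R s3" by blast
        qed (use ts x z le in \<open>auto simp: apx_def\<close>)
        then show ?thesis using True q2 fl z t2 fe by simp
      qed
      from run_le[OF wp_run[OF this]] have r: "run Bd (Cond (LessI iZ iFlag)
          (AssignN nXm (NCopy (Elem 20 8)) ;; AssignN nXe (NCopy (Elem 21 8)) ;; float_add) Skip) s2 21 ?R"
        by (simp add: cost_float_add)
      show ?case
      proof (rule run_Seq[OF r], rule run_Seq_wp[OF run_odometer[where p = q]], goal_cases)
        case (4 s3 s4)
        then have R: "?R s3" and a4: "agree ({6} \<times> UNIV) {(0, 2), (0, 11)} s3 s4"
          and d4: "\<forall>i<k. num s4 (6, i) = of_nat (digit S (Suc q) i)" by blast+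
        have "agree ?U ?W s s4" by (rule agree_trans[OF conjunct1[OF R] a4]) auto
        moreover have "tab c j V E0 s4"
          using R by (intro tab_agree[OF _ a4]) (auto simp: fixed_nums_def env_idxs_def)
        moreover have "?F (Suc q) s4" using R by (subst flt_cong[where s = s3]) (auto simp: agree_num[OF a4])
        moreover have "idx s4 (0, 8) = q" using R by (simp add: agree_idx[OF a4])
        ultimately show ?case using d4 q by (simp add: incr_def env_idxs_def flt_def)
      qed (auto simp: incr_def)
    qed (use I s c p in \<open>auto simp: agree_num[OF a1] tab_c\<close>)
    with q show ?case by blast
  next
    case (3 q s')
    then have q: "q = S ^ k" and I: "?I q s'" by auto
    have le: "E + card (hits c j p y (S ^ k)) \<le> Suc E" using card_hits_le_1[of "S ^ k" c j p y] by simp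
    have "?F q s' \<Longrightarrow> flt s' (10, 15) (10, 16) (Suc E) (v + (\<Sum>q\<in>hits c j p y (S ^ k). V q))"
      unfolding q by (erule flt_mono[OF _ le])
    with I q show ?case by auto
  qed (use s acc q in \<open>auto simp: env_idxs_def flt_def\<close>)
qed

text \<open>There are \<open>M\<close> values of \<open>y\<close> with at most one addition each,
  hence the depth \<open>E + M\<close>.\<close>

lemma run_new_entry:
  assumes s: "tab c j V E s"
    and c: "\<And>i. i < k \<Longrightarrow> c i j \<le> M"
    and p: "\<And>i. i < k \<Longrightarrow> num s (5, i) = of_nat (digit S p i)"
    and q: "\<And>i. i < k \<Longrightarrow> num s (6, i) = 0"
    and E: "Suc (E + M) < X"
  shows "run Bd new_entry s (M * (S ^ k * (k * 14 + 29) + 4) + 4) (\<lambda>s'.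
    agree ({6} \<times> UNIV \<union> {10} \<times> {11, 14, 15, 16, 17, 18}) ({0} \<times> {2, 8, 11, 12}) s s' \<and>
    tab c j V E s' \<and> (\<forall>i<k. num s' (6, i) = 0) \<and>
    flt s' (10, 15) (10, 16) (E + M) (\<Sum>y<M. \<Sum>q\<in>hits c j p y (S ^ k). V q))"
proof -
  let ?U = "{6} \<times> UNIV \<union> {10} \<times> {11, 14, 15, 16, 17, 18 :: nat}" and ?W = "{0} \<times> {2, 8, 11, 12 :: nat}"
  let ?I = "\<lambda>y s'. agree ?U ?W s s' \<and> tab c j V E s' \<and> num s' (10, 14) = of_nat y \<and> y \<le> M \<and>
    (\<forall>i<k. num s' (6, i) = 0) \<and>
    flt s' (10, 15) (10, 16) (E + y) (\<Sum>y<y. \<Sum>q\<in>hits c j p y (S ^ k). V q)"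
  have f0: "flt s' (10, 15) (10, 16) E 0" if "num s' (10, 15) = 0" "num s' (10, 16) = 0" for s'
    unfolding flt_def using that B_ge by (intro exI[of _ "(0, 0)"]) (auto intro!: apx_0)
  show ?thesis
    unfolding new_entry_def
  proof (rule run_le, rule run_AssignN_Seq, rule run_AssignN_Seq, rule run_AssignN_Seq,
      rule run_Loop[where I = ?I and N = M and T = "S ^ k * (k * 14 + 29) + 2 + 1"], goal_cases)
    case (2 y s1)
    then have I: "?I y s1" and y: "y < M" by auto
    then have a1: "agree ?U ?W s s1" by blast
    have r: "run Bd add_matching s1 (S ^ k * (k * 14 + 29) + 2) (\<lambda>s'.
        agree ({6} \<times> UNIV \<union> {10} \<times> {11, 15, 16, 17, 18}) ({0} \<times> {2, 8, 11, 12}) s1 s' \<and>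
        tab c j V E s' \<and> (\<forall>i<k. num s' (6, i) = 0) \<and>
        flt s' (10, 15) (10, 16) (Suc (E + y))
          ((\<Sum>y<y. \<Sum>q\<in>hits c j p y (S ^ k). V q) + (\<Sum>q\<in>hits c j p y (S ^ k). V q)))"
      by (rule run_add_matching) (use I y c p q E in \<open>auto simp: agree_num[OF a1]\<close>)
    have "run Bd (add_matching ;; AssignN nY (NAdd nY nOne)) s1 (S ^ k * (k * 14 + 29) + 2 + 1) (?I (Suc y))"
    proof (rule run_Seq_wp[OF r], elim conjE, goal_cases)
      case (1 s2)
      have "agree ?U ?W s s2" by (rule agree_trans[OF a1 1(1)]) auto
      moreover have "enc_len (of_nat y + 1) \<le> Bd" using y X_ge by (intro fits_Suc) linarith
      moreover have "num s2 (10, 14) = of_nat y" using I by (simp add: agree_num[OF 1(1)])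
      ultimately show ?case using 1 y by (simp add: fixed_nums_def flt_def)
    qed simp
    with y show ?case by blast
  qed (use s q f0 in \<open>auto simp: fixed_nums_def distrib_left\<close>)
qed

lemma run_new_table:
  assumes s: "tab c j V E s"
    and c: "\<And>i. i < k \<Longrightarrow> c i j \<le> M"
    and d: "\<And>i. i < k \<Longrightarrow> num s (5, i) = 0" "\<And>i. i < k \<Longrightarrow> num s (6, i) = 0"
    and E: "Suc (E + M) < X"
  shows "run Bd new_table s (S ^ k * (M * (S ^ k * (k * 14 + 29) + 4) + k * 6 + 11) + 2) (\<lambda>s'.
    agree ({5, 6, 22, 23} \<times> UNIV \<union> {10} \<times> {11, 14, 15, 16, 17, 18}) ({0} \<times> {2, 7, 8, 11, 12}) s s' \<and>
    tab c j V E s' \<and> (\<forall>i<k. num s' (5, i) = 0) \<and> (\<forall>i<k. num s' (6, i) = 0) \<and>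
    (\<forall>p<S ^ k. flt s' (22, p) (23, p) (E + M) (\<Sum>y<M. \<Sum>q\<in>hits c j p y (S ^ k). V q)))"
proof -
  let ?U = "{5, 6, 22, 23} \<times> UNIV \<union> {10} \<times> {11, 14, 15, 16, 17, 18 :: nat}"
  let ?W = "{0} \<times> {2, 7, 8, 11, 12 :: nat}"
  let ?V = "\<lambda>p. \<Sum>y<M. \<Sum>q\<in>hits c j p y (S ^ k). V q"
  let ?I = "\<lambda>p s'. agree ?U ?W s s' \<and> tab c j V E s' \<and> idx s' (0, 7) = p \<and> p \<le> S ^ k \<and>
    (\<forall>i<k. num s' (5, i) = of_nat (digit S p i)) \<and> (\<forall>i<k. num s' (6, i) = 0) \<and>
    (\<forall>l<p. flt s' (22, l) (23, l) (E + M) (?V l))"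
  show ?thesis
    unfolding new_table_def
  proof (rule run_le, rule run_AssignI_Seq, rule run_Loop[where I = ?I and N = "S ^ k" and
      T = "(M * (S ^ k * (k * 14 + 29) + 4) + 4) + (2 + (k * 6 + 3 + 1))"], goal_cases)
    case (2 p s1)
    then have I: "?I p s1" and p: "p < S ^ k" by auto
    then have a1: "agree ?U ?W s s1" by blast
    have r: "run Bd new_entry s1 (M * (S ^ k * (k * 14 + 29) + 4) + 4) (\<lambda>s'.
      agree ({6} \<times> UNIV \<union> {10} \<times> {11, 14, 15, 16, 17, 18}) ({0} \<times> {2, 8, 11, 12}) s1 s' \<and>
      tab c j V E s' \<and> (\<forall>i<k. num s' (6, i) = 0) \<and> flt s' (10, 15) (10, 16) (E + M) (?V p))"
      by (rule run_new_entry) (use I c E in auto)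
    have "run Bd (new_entry ;; AssignN (Elem 22 7) (NCopy nAm) ;; AssignN (Elem 23 7) (NCopy nAe) ;;
        odometer 5 ;; incr iP) s1 ((M * (S ^ k * (k * 14 + 29) + 4) + 4) + (2 + (k * 6 + 3 + 1))) (?I (Suc p))"
    proof (rule run_Seq[OF r], elim conjE, goal_cases)
      case (1 s2)
      let ?s = "set_num (set_num s2 (Elem 22 7) (num s2 (10, 15))) (Elem 23 7) (num s2 (10, 16))"
      have ix: "idx s2 (0, 7) = p" using I by (simp add: agree_idx[OF 1(1)])
      have "E + M \<le> X" using E by simp
      then have f: "enc_len (num s2 (10, 15)) \<le> Bd" "enc_len (num s2 (10, 16)) \<le> Bd"
        using flt_fits[OF 1(4)] by blast+
      have a2: "agree ?U ?W s s2" by (rule agree_trans[OF a1 1(1)]) auto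
      then have as: "agree ?U ?W s ?s" using ix by simp
      have ts: "tab c j V E ?s" using 1(2) ix by (simp add: fixed_nums_def)
      have d5: "num ?s (5, i) = of_nat (digit S p i)" if "i < k" for i
        using I that by (simp add: agree_num[OF 1(1)])
      have d6: "num ?s (6, i) = 0" if "i < k" for i using 1(3) that by simp
      have fl: "flt ?s (22, l) (23, l) (E + M) (?V l)" if "l < Suc p" for l
      proof (cases "l = p")
        case True
        then show ?thesis using 1(4) ix by (simp add: flt_def)
      next
        case False
        with that I have "flt s1 (22, l) (23, l) (E + M) (?V l)" by simp
        then show ?thesis using False ix by (simp add: flt_def agree_num[OF 1(1)])
      qed
      have "run Bd (odometer 5 ;; incr iP) ?s (k * 6 + 3 + 1) (?I (Suc p))"
      proof (rule run_Seq_wp[OF run_odometer[where p = p]], goal_cases)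
        case (4 s3)
        then have a3: "agree ({5} \<times> UNIV) {(0, 2), (0, 11)} ?s s3"
          and dd: "\<forall>i<k. num s3 (5, i) = of_nat (digit S (Suc p) i)" by blast+
        have "agree ?U ?W s s3" by (rule agree_trans[OF as a3]) auto
        moreover have "tab c j V E s3"
          by (rule tab_agree[OF ts a3]) (auto simp: fixed_nums_def env_idxs_def)
        moreover have "num s3 (6, i) = 0" if "i < k" for i
          using d6[OF that] by (simp add: agree_num[OF a3])
        moreover have "flt s3 (22, l) (23, l) (E + M) (?V l)" if "l < Suc p" for l
        proof -
          have e: "num s3 (22, l) = num ?s (22, l)" "num s3 (23, l) = num ?s (23, l)"
            by (rule agree_num[OF a3], simp)+
          show ?thesis using fl[OF that] flt_cong[OF e] by blast
        qed
        moreover have "idx s3 (0, 7) = p" using ix by (simp add: agree_idx[OF a3])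
        ultimately show ?case using dd p by (simp add: incr_def env_idxs_def flt_def)
      qed (use ts d5 in \<open>auto simp: incr_def\<close>)
      then have "run Bd (AssignN (Elem 22 7) (NCopy nAm) ;; AssignN (Elem 23 7) (NCopy nAe) ;;
        odometer 5 ;; incr iP) s2 (Suc (Suc (k * 6 + 3 + 1))) (?I (Suc p))"
        using f by (intro run_AssignN_Seq) simp_all
      then show ?case by (rule run_le) simp
    qed
    with p show ?case by blast
  qed (use s d in \<open>auto simp: env_idxs_def distrib_left\<close>)
qed

lemma run_copy_table:
  assumes s: "env1 s" "idx s (0, 6) = S ^ k"
    and t: "\<And>p. p < S ^ k \<Longrightarrow> flt s (22, p) (23, p) E (V p)" and E: "E \<le> X"
  shows "run Bd copy_table s (S ^ k * 4 + 2) (\<lambda>s'.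
    agree ({20, 21} \<times> UNIV) {(0, 7)} s s' \<and> env1 s' \<and>
    (\<forall>p<S ^ k. flt s' (20, p) (21, p) E (V p)))"
proof -
  let ?I = "\<lambda>p s'. agree ({20, 21} \<times> UNIV) {(0, 7)} s s' \<and> env1 s' \<and> idx s' (0, 7) = p \<and> p \<le> S ^ k \<and>
    (\<forall>l<p. flt s' (20, l) (21, l) E (V l))"
  show ?thesis
    unfolding copy_table_def
  proof (rule run_le, rule run_AssignI_Seq,
      rule run_Loop[where I = ?I and N = "S ^ k" and T = 3], goal_cases)
    case (2 p s1)
    then have I: "?I p s1" by auto
    then have a1: "agree ({20, 21} \<times> UNIV) {(0, 7)} s s1" by blast
    have p: "p < S ^ k" using 2 s(2) agree_idx[OF a1, of "(0, 6)"] by auto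
    note f = flt_fits[OF t[OF p] E]
    show ?case
      apply (rule conjI[OF p])
      apply (rule wp_runI)
       apply (use I p f t[OF p] in \<open>auto simp: incr_def env_idxs_def fixed_nums_def less_Suc_eq flt_def agree_num[OF a1]\<close>)
      done
  next
    case (3 p s1)
    then have a1: "agree ({20, 21} \<times> UNIV) {(0, 7)} s s1" by blast
    have "p = S ^ k" using 3 s(2) agree_idx[OF a1, of "(0, 6)"] by auto
    with 3 show ?case by auto
  qed (use s in \<open>auto simp: env_idxs_def\<close>)
qed

lemma run_init_table:
  assumes s: "env1 s" "idx s (0, 6) = S ^ k"
  shows "run Bd init_table s (S ^ k * 4 + 2) (\<lambda>s'.
    agree ({20, 21} \<times> UNIV) {(0, 7)} s s' \<and> env1 s' \<and>
    (\<forall>p<S ^ k. flt s' (20, p) (21, p) 0 1))"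
proof -
  let ?I = "\<lambda>p s'. agree ({20, 21} \<times> UNIV) {(0, 7)} s s' \<and> env1 s' \<and> idx s' (0, 7) = p \<and> p \<le> S ^ k \<and>
    (\<forall>l<p. num s' (20, l) = 1 \<and> num s' (21, l) = 0)"
  have f: "flt s' l l' 0 1" if "num s' l = 1" "num s' l' = 0" for s' l l'
    unfolding flt_def using that B_ge apx_1[of B] by (intro exI[of _ "(1, 0)"]) auto
  show ?thesis
    unfolding init_table_def
  proof (rule run_le, rule run_AssignI_Seq,
      rule run_Loop[where I = ?I and N = "S ^ k" and T = 3], goal_cases)
    case (2 p s1)
    then have I: "?I p s1" by auto
    then have a1: "agree ({20, 21} \<times> UNIV) {(0, 7)} s s1" by blast
    have p: "p < S ^ k" using 2 s(2) agree_idx[OF a1, of "(0, 6)"] by auto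
    show ?case
      apply (rule conjI[OF p])
      apply (rule wp_runI)
       apply (use I p in \<open>auto simp: incr_def env_idxs_def fixed_nums_def less_Suc_eq\<close>)
      done
  next
    case (3 p s1)
    then have a1: "agree ({20, 21} \<times> UNIV) {(0, 7)} s s1" by blast
    have "p = S ^ k" using 3 s(2) agree_idx[OF a1, of "(0, 6)"] by auto
    with 3 f show ?case by auto
  qed (use s in \<open>auto simp: env_idxs_def\<close>)
qed

section \<open>Scaling factors and rounded coefficients\<close>

text \<open>The minimum is either 1 or a single quotient of an entry of \<open>b\<close> by an entry
  of \<open>A\<close>, so its denominator stays at most \<open>H\<close>.\<close>

primrec ubound :: "nat \<Rightarrow> nat \<Rightarrow> rat" where
  "ubound j 0 = 1"
| "ubound j (Suc i) = (if 0 < A i j \<and> of_int (b i) / of_int (A i j) < ubound j i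
     then of_int (b i) / of_int (A i j) else ubound j i)"

abbreviation "u j \<equiv> ubound j k"

text \<open>If no pair is bad, a row with right-hand side 0 has only zero entries; division by zero
  then gives it zero coefficients, a void constraint.\<close>

definition coef :: "nat \<Rightarrow> nat \<Rightarrow> nat" where
  "coef i j = nat \<lfloor>of_nat M * of_int (A i j) * u j / of_int (b i)\<rfloor>"

lemma b_nonneg: "i < k \<Longrightarrow> 0 \<le> b i"
  using good[of i 0] n by (simp add: bad_def)

lemma b_pos: "i < k \<Longrightarrow> j < n \<Longrightarrow> 0 < A i j \<Longrightarrow> 0 < b i"
  using good[of i j] by (auto simp: bad_def)

text \<open>Two of these facts carry the resource bounds: \<open>u j\<close> is at least
  \<open>1 / H\<close>, which limits the doublings in \<open>weight\<close>, and its denominator is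
  at most \<open>H\<close>, which keeps exact intermediate values short.\<close>

lemma ubound_bounds:
  assumes j: "j < n" and "i \<le> k"
  shows "0 < ubound j i \<and> ubound j i \<le> 1 \<and> 1 \<le> ubound j i * of_nat H \<and>
    (\<exists>y. 0 < y \<and> y \<le> H \<and> ubound j i * of_nat y \<in> \<int>)"
  using assms(2)
proof (induction i)
  case 0
  have "0 < (1::nat) \<and> 1 \<le> H \<and> ubound j 0 * of_nat 1 \<in> \<int>" using H by simp
  then show ?case using H by (auto simp del: of_nat_1)
next
  case (Suc i)
  then have IH: "0 < ubound j i" "ubound j i \<le> 1" and i: "i < k" by auto
  show ?case
  proof (cases "0 < A i j \<and> of_int (b i) / of_int (A i j) < ubound j i")
    case True
    have bp: "1 \<le> b i" using b_pos[OF i j] True by simp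
    define y where "y = nat (A i j)"
    have y: "A i j = int y" "0 < y" "y \<le> H" using True A[OF i j] by (auto simp: y_def)
    have "of_nat y \<le> (of_nat H :: rat)" using y by simp
    also have "\<dots> \<le> of_int (b i) * of_nat H" using bp H by simp
    finally have "(1::rat) \<le> of_int (b i) / of_int (A i j) * of_nat H"
      using y by (simp add: field_simps)
    moreover have "of_int (b i) / of_int (A i j) * of_nat y \<in> (\<int> :: rat set)"
      using y by simp
    moreover have "of_int (b i) / of_int (A i j) \<le> (1 :: rat)" using True IH by linarith
    moreover have "0 < (of_int (b i) / of_int (A i j) :: rat)" using bp True by simp
    moreover have "ubound j (Suc i) = of_int (b i) / of_int (A i j)" using True by simp
    ultimately show ?thesis using y(2,3) by metis
  next
    case False
    with Suc show ?thesis by (simp only: ubound.simps if_False)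
  qed
qed

lemma ubound_mono: "i \<le> i' \<Longrightarrow> ubound j i' \<le> ubound j i"
proof (induction rule: dec_induct)
  case (step m)
  then show ?case by auto
qed simp

lemma A_times_u:
  assumes "i < k" "j < n"
  shows "of_int (A i j) * u j \<le> of_int (b i)"
proof (cases "A i j = 0")
  case True
  then show ?thesis using b_nonneg[OF assms(1)] by simp
next
  case False
  then have p: "0 < A i j" using A[OF assms] by simp
  have "u j \<le> ubound j (Suc i)" using assms by (intro ubound_mono) simp
  also have "\<dots> \<le> of_int (b i) / of_int (A i j)" using p by auto
  finally show ?thesis using p by (simp add: field_simps)
qed

lemma coef_le: "i < k \<Longrightarrow> j < n \<Longrightarrow> coef i j \<le> M"
proof -
  assume ij: "i < k" "j < n"
  have "of_nat M * of_int (A i j) * u j / of_int (b i) \<le> (of_nat M :: rat)"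
  proof (cases "b i = 0")
    case False
    then have "0 < b i" using b_nonneg[OF ij(1)] by simp
    then show ?thesis using A_times_u[OF ij] by (simp add: field_simps mult_left_mono)
  qed simp
  then have "\<lfloor>of_nat M * of_int (A i j) * u j / of_int (b i) :: rat\<rfloor> \<le> int M"
    by (simp add: floor_le_iff)
  then show ?thesis by (simp add: coef_def)
qed

lemma coef_nonneg_arg:
  assumes "i < k" "j < n"
  shows "0 \<le> of_nat M * of_int (A i j) * u j / (of_int (b i) :: rat)"
  using assms A ubound_bounds[of j k] b_nonneg by (auto intro!: divide_nonneg_nonneg mult_nonneg_nonneg)

lemma run_upper_bound:
  assumes s: "env1 s" and j: "j < n" and col: "\<And>i. i < k \<Longrightarrow> num s (7, i) = of_int (A i j)"
  shows "run Bd upper_bound s (k * 6 + 3) (\<lambda>s'.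
    agree {(10, 10), (10, 11)} {(0, 2)} s s' \<and> env1 s' \<and> num s' (10, 10) = u j)"
proof -
  let ?I = "\<lambda>i s'. agree {(10, 10), (10, 11)} {(0, 2)} s s' \<and> env1 s' \<and> idx s' (0, 2) = i \<and> i \<le> k \<and>
    num s' (10, 10) = ubound j i"
  show ?thesis
    unfolding upper_bound_def
  proof (rule run_le, rule run_AssignN_Seq, rule run_AssignI_Seq,
      rule run_Loop[where I = ?I and N = k and T = 5], goal_cases)
    case (2 i s1)
    then have I: "?I i s1" and i: "i < k" by auto
    have c: "num s1 (7, i) = of_int (A i j)"
      using col[OF i] agree_num[OF conjunct1[OF I]] by simp
    have f: "enc_len (of_int (b i) / of_int (A i j)) \<le> Bd" if "0 < A i j"
    proof (rule fits[of "nat (A i j)"])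
      show "0 < nat (A i j)" using that by simp
      show "nat (A i j) \<le> X" using A[OF i j] H unfolding nat_le_iff by linarith
      show "of_int (b i) / of_int (A i j) * of_nat (nat (A i j)) \<in> (\<int> :: rat set)"
        using that by simp
      have "\<bar>of_int (b i) / of_int (A i j)\<bar> \<le> (of_int \<bar>b i\<bar> / 1 :: rat)"
        unfolding abs_divide of_int_abs using that by (intro divide_left_mono) auto
      also have "\<dots> \<le> of_int (int X)" using b[OF i] H by (simp only: of_int_le_iff div_by_1)
      finally show "\<bar>of_int (b i) / of_int (A i j)\<bar> \<le> (of_nat X :: rat)" by simp
    qed
    show ?case
      apply (rule conjI[OF i])
      apply (rule wp_runI)
       apply (use I i c f in \<open>auto simp: incr_def env_idxs_def fixed_nums_def\<close>)
      done
  qed (use s in \<open>auto simp: env_idxs_def fixed_nums_def\<close>)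
qed

lemma run_round_column:
  assumes s: "env1 s" "num s (10, 10) = u j" and j: "j < n"
    and col: "\<And>i. i < k \<Longrightarrow> num s (7, i) = of_int (A i j)"
  shows "run Bd round_column s (k * 6 + 2) (\<lambda>s'.
    agree ({8} \<times> UNIV) {(0, 2)} s s' \<and> env1 s' \<and> (\<forall>i<k. num s' (8, i) = of_nat (coef i j)))"
proof -
  let ?I = "\<lambda>i s'. agree ({8} \<times> UNIV) {(0, 2)} s s' \<and> env1 s' \<and> idx s' (0, 2) = i \<and> i \<le> k \<and>
    (\<forall>l<i. num s' (8, l) = of_nat (coef l j))"
  have u: "0 < u j" "u j \<le> 1" using ubound_bounds[OF j] by auto
  obtain y where y: "0 < y" "y \<le> H" "u j * of_nat y \<in> \<int>" using ubound_bounds[OF j] by blast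
  show ?thesis
    unfolding round_column_def
  proof (rule run_le, rule run_AssignI_Seq, rule run_Loop[where I = ?I and N = k and T = 5], goal_cases)
    case (2 i s1)
    then have I: "?I i s1" and i: "i < k" by auto
    have c: "num s1 (7, i) = of_int (A i j)" "num s1 (10, 10) = u j"
      using col[OF i] s agree_num[OF conjunct1[OF I]] by simp_all
    define m where "m = M * nat (A i j)"
    have mA: "of_nat M * of_int (A i j) = (of_nat m :: rat)" using A[OF i j] by (simp add: m_def)
    have "m \<le> M * H" unfolding m_def using A[OF i j] by (intro mult_le_mono2) (simp add: nat_le_iff)
    then have mX: "m \<le> X" using X by (simp add: mult.commute)
    have r0: "0 \<le> of_nat m * u j" using u by simp
    have r1: "of_nat m * u j \<le> (of_nat X :: rat)"
    proof -
      have "of_nat m * u j \<le> of_nat m * 1" using u by (intro mult_left_mono) auto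
      also have "\<dots> \<le> of_nat X" using mX by simp
      finally show ?thesis .
    qed
    have f1: "enc_len (of_nat m) \<le> Bd" using mX by (rule fits_nat)
    have f2: "enc_len (of_nat m * u j) \<le> Bd"
    proof (rule fits[of y])
      show "of_nat m * u j * of_nat y \<in> \<int>" unfolding mult.assoc using y(3) by (rule Ints_mult[rotated]) simp
    qed (use y H r0 r1 in auto)
    have f3: "enc_len (of_nat m * u j / of_int (b i)) \<le> Bd"
    proof (cases "b i = 0")
      case False
      then have bp: "1 \<le> b i" using b_nonneg[OF i] by simp
      show ?thesis
      \<comment> \<open>\<open>y\<close> clears the denominator of \<open>u j\<close>, and
        \<open>b i\<close> is the new divisor.\<close>
      proof (rule fits[of "y * nat (b i)"])
        have "y * nat (b i) \<le> H * H" using y b[OF i] by (intro mult_le_mono) auto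
        then show "y * nat (b i) \<le> X" using X by simp
        have "\<bar>of_nat m * u j / of_int (b i)\<bar> \<le> of_nat m * u j / 1"
          unfolding abs_divide using bp r0 by (subst abs_of_nonneg[OF r0], intro divide_left_mono) auto
        then show "\<bar>of_nat m * u j / of_int (b i)\<bar> \<le> of_nat X" using r1 by simp
        have "of_nat m * (u j * of_nat y) \<in> \<int>" using y(3) by (rule Ints_mult[rotated]) simp
        then show "of_nat m * u j / of_int (b i) * of_nat (y * nat (b i)) \<in> \<int>"
          using bp by (simp add: mult.assoc)
      qed (use y bp in auto)
    qed simp
    have co: "of_int \<lfloor>of_nat m * u j / of_int (b i)\<rfloor> = (of_nat (coef i j) :: rat)"
      using coef_nonneg_arg[OF i j] by (simp add: coef_def mA)
    have f4: "enc_len (of_nat (coef i j)) \<le> Bd"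
      using coef_le[OF i j] X_ge by (intro fits_nat) linarith
    show ?case
      apply (rule conjI[OF i])
      apply (rule wp_runI)
       apply (use I i c f1 f2 f3 f4 co in \<open>auto simp: incr_def env_idxs_def fixed_nums_def less_Suc_eq mA\<close>)
      done
  qed (use s in \<open>auto simp: env_idxs_def\<close>)
qed

section \<open>The volume of a grid cell\<close>

text \<open>Doubling while the value is below \<open>B\<close> ends between \<open>B\<close> and
  \<open>2 * B\<close>, where passing to the next integer costs at most a factor
  \<open>1 + 1 / B\<close>. Each coordinate contributes one such factor.\<close>

lemma run_weight:
  fixes z :: nat and e :: int
  assumes s: "env1 s" "num s (10, 10) = u j" "num s (10, 12) = of_nat z" "num s (10, 13) = of_int e"
    and j: "j < n" and z: "1 \<le> z" "z \<le> 2 * B" and e: "\<bar>e\<bar> + int D \<le> int X"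
  shows "run Bd weight s (D * 3 + 5) (\<lambda>s'. agree {(10, 12), (10, 13)} {} s s' \<and> env1 s' \<and>
    (\<exists>z' e'. num s' (10, 12) = of_nat z' \<and> num s' (10, 13) = of_int e' \<and> 1 \<le> z' \<and> z' \<le> 2 * B \<and>
      \<bar>e'\<bar> \<le> \<bar>e\<bar> + int D \<and>
      real z * 2 powi e * (real_of_rat (u j) / M) \<le> real z' * 2 powi e' \<and>
      real z' * 2 powi e' \<le> (1 + 1 / B) * (real z * 2 powi e * (real_of_rat (u j) / M))))"
proof -
  define r where "r = of_nat z * u j / of_nat M"
  have u: "0 < u j" "u j \<le> 1" "1 \<le> u j * of_nat H" using ubound_bounds[OF j] by auto
  obtain y where y: "0 < y" "y \<le> H" "u j * of_nat y \<in> \<int>" using ubound_bounds[OF j] by blast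
  have M0: "0 < M" using M by simp
  have zu: "0 \<le> of_nat z * u j" "of_nat z * u j \<le> 2 * of_nat B"
  proof -
    show "0 \<le> of_nat z * u j" using u by simp
    have "of_nat z \<le> (of_nat (2 * B) :: rat)" using z(2) unfolding of_nat_le_iff .
    then have "of_nat z * u j \<le> of_nat (2 * B) * 1" using u by (intro mult_mono) auto
    then show "of_nat z * u j \<le> 2 * of_nat B" by simp
  qed
  have r0: "0 \<le> r" using zu by (simp add: r_def)
  have B0: "0 < (of_nat B :: rat)" using B_ge by simp
  \<comment> \<open>The mantissa is below \<open>2 * B\<close> before any doubling, and doubling
    happens only below \<open>B\<close>, so the bound persists.\<close>
  have r2: "r < 2 * of_nat B"
  proof -
    have "r \<le> 2 * of_nat B / of_nat M" unfolding r_def using zu by (intro divide_right_mono) auto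
    also have "\<dots> < 2 * of_nat B" using B0 M by (simp add: field_simps)
    finally show ?thesis .
  qed
  have X2: "2 * of_nat B \<le> (of_nat X :: rat)"
  proof -
    have "of_nat (2 * B) \<le> (of_nat X :: rat)" using X_ge(2) by (simp only: of_nat_le_iff)
    then show ?thesis by simp
  qed
  have yM: "y * M \<le> X" "y \<le> X"
    using mult_le_mono1[OF y(2), of M] X(2) y(2) H by linarith+
  have fr: "enc_len (r * 2 ^ i) \<le> Bd" if "r * 2 ^ i < 2 * of_nat B" for i
  proof (rule fits[of "y * M"])
    have "of_nat z * (u j * of_nat y) * 2 ^ i \<in> \<int>" by (rule Ints_mult[OF Ints_mult[OF _ y(3)]]) auto
    moreover have "r * 2 ^ i * of_nat (y * M) = (r * of_nat M) * (of_nat y * 2 ^ i)"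
      by (simp only: of_nat_mult mult_ac)
    moreover have "r * of_nat M = of_nat z * u j" using M0 by (simp add: r_def)
    ultimately show "r * 2 ^ i * of_nat (y * M) \<in> \<int>" by (simp only: mult_ac)
    show "\<bar>r * 2 ^ i\<bar> \<le> of_nat X" using that r0 X2 by simp
  qed (use y M0 yM in auto)
  have fz: "enc_len (of_nat z * u j) \<le> Bd"
  proof (rule fits[of y])
    show "of_nat z * u j * of_nat y \<in> \<int>" unfolding mult.assoc using y(3) by (rule Ints_mult[rotated]) simp
  qed (use y yM zu X2 in auto)
  have fe: "enc_len (of_int (e - int i)) \<le> Bd" if "i \<le> D" for i
    using that e by (intro fits_int) simp
  let ?I = "\<lambda>i s'. agree {(10, 12), (10, 13)} {} s s' \<and> env1 s' \<and> num s' (10, 12) = r * 2 ^ i \<and>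
    num s' (10, 13) = of_int (e - int i) \<and> i \<le> D \<and> r * 2 ^ i < 2 * of_nat B"
  let ?s = "set_num (set_num s nZm (of_nat z * u j)) nZm r"
  let ?R = "\<lambda>s'. \<exists>i. ?I i s' \<and> of_nat B \<le> r * 2 ^ i"
  have loop: "run Bd (Loop (LessN nZm nB) (AssignN nZm (NMul nZm nTwo) ;; AssignN nZe (NSub nZe nOne))) ?s
    (D * (2 + 1) + 1) ?R"
  proof (rule run_Loop[where I = ?I], goal_cases)
    case 1
    then show ?case using s r2 by (simp add: fixed_nums_def)
  next
    case (2 i s')
    then have I: "?I i s'" and lt: "r * 2 ^ i < of_nat B" by auto
    \<comment> \<open>Since \<open>r\<close> is at least \<open>1 / (M * H)\<close>, the guard
      \<open>r * 2 ^ i < B\<close> forces \<open>2 ^ i < B * M * H\<close>, hence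
      \<open>i < D\<close>.\<close>
    have "1 * 1 \<le> of_nat z * (u j * of_nat H)" using z u by (intro mult_mono) auto
    also have "\<dots> = r * of_nat (M * H)" using M0 by (simp add: r_def)
    finally have "2 ^ i * 1 \<le> 2 ^ i * (r * of_nat (M * H))" by (intro mult_left_mono) auto
    also have "\<dots> = (r * 2 ^ i) * of_nat (M * H)" by simp
    also have "\<dots> < of_nat B * of_nat (M * H)" using lt M0 H by (intro mult_strict_right_mono) auto
    also have "\<dots> \<le> of_nat (2 ^ D)"
      using D unfolding of_nat_mult[symmetric] of_nat_le_iff by (simp only: mult.assoc)
    finally have "(2::rat) ^ i < 2 ^ D" by simp
    then have i: "i < D" using power_strict_increasing_iff[of "2::rat" i D] by simp
    have "r * 2 ^ Suc i < 2 * of_nat B" using lt by simp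
    from fr[OF this] have f1: "enc_len (r * 2 ^ i * 2) \<le> Bd" by (simp only: power_Suc2 mult.assoc)
    have f2: "enc_len (of_int (e - int i) - 1) \<le> Bd" using fe[of "Suc i"] i by (simp add: algebra_simps)
    show ?case
      apply (rule conjI[OF i])
      apply (rule wp_runI)
       apply (use I i f1 f2 lt in \<open>auto simp: fixed_nums_def simp del: of_int_diff\<close>)
      done
  next
    case (3 i s')
    then show ?case by auto
  qed
  have fin: "wp Bd (AssignN nZm (NFloor nZm) ;; AssignN nZm (NAdd nZm nOne))
     (\<lambda>s'. agree {(10, 12), (10, 13)} {} s s' \<and> env1 s' \<and>
    (\<exists>z' e'. num s' (10, 12) = of_nat z' \<and> num s' (10, 13) = of_int e' \<and> 1 \<le> z' \<and> z' \<le> 2 * B \<and>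
      \<bar>e'\<bar> \<le> \<bar>e\<bar> + int D \<and>
      real z * 2 powi e * (real_of_rat (u j) / M) \<le> real z' * 2 powi e' \<and>
      real z' * 2 powi e' \<le> (1 + 1 / B) * (real z * 2 powi e * (real_of_rat (u j) / M)))) s1"
    if "?R s1" for s1
  proof -
    from that obtain i where I: "?I i s1" and ge: "of_nat B \<le> r * 2 ^ i" by blast
    define v where "v = r * 2 ^ i"
    define f where "f = nat \<lfloor>v\<rfloor>"
    have v: "0 \<le> v" "of_nat B \<le> v" "v < 2 * of_nat B" using r0 ge I by (auto simp: v_def)
    have f: "of_int \<lfloor>v\<rfloor> = (of_nat f :: rat)" using v by (simp add: f_def)
    have fv: "of_nat f \<le> v" "v < of_nat f + 1" unfolding f[symmetric] by linarith+
    have "of_nat f < (of_nat (2 * B) :: rat)" using fv v by simp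
    then have f2: "f < 2 * B" unfolding of_nat_less_iff .
    have ff: "enc_len (of_nat f) \<le> Bd" "enc_len (of_nat f + 1) \<le> Bd"
      using f2 X_ge by (auto intro!: fits_nat fits_Suc)
    define w where "w = real z * 2 powi e * (real_of_rat (u j) / M)"
    have rv: "real_of_rat v * 2 powi (e - int i) = w"
      by (simp add: v_def r_def w_def of_rat_mult of_rat_divide of_rat_power power_int_diff field_simps)
    have p0: "0 < (2::real) powi (e - int i)" by simp
    have "real_of_rat v < real_of_rat (of_nat f + 1)" using fv(2) unfolding of_rat_less .
    then have lo: "real_of_rat v \<le> real (Suc f)" by (simp add: of_rat_add)
    have "real_of_rat (of_nat f) \<le> real_of_rat v" using fv(1) unfolding of_rat_less_eq .
    moreover have "real_of_rat (of_nat B) \<le> real_of_rat v" using v(2) unfolding of_rat_less_eq .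
    then have "1 \<le> real_of_rat v / B" using B_ge by (simp add: le_divide_eq)
    \<comment> \<open>\<open>Suc f\<close> exceeds \<open>v\<close> by at most 1, and 1 is at most
      \<open>v / B\<close>.\<close>
    ultimately have hi: "real (Suc f) \<le> (1 + 1 / B) * real_of_rat v"
      by (simp add: distrib_right)
    have "real_of_rat v * 2 powi (e - int i) \<le> real (Suc f) * 2 powi (e - int i)"
      using lo p0 by (intro mult_right_mono) auto
    moreover have "real (Suc f) * 2 powi (e - int i) \<le> (1 + 1 / B) * real_of_rat v * 2 powi (e - int i)"
      using hi p0 by (intro mult_right_mono) auto
    ultimately have res: "w \<le> real (Suc f) * 2 powi (e - int i)"
      "real (Suc f) * 2 powi (e - int i) \<le> (1 + 1 / B) * w" using rv by (simp_all add: mult.assoc)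
    have ex: "\<exists>z' e'. of_nat f + 1 = (of_nat z' :: rat) \<and> (of_int (e - int i) :: rat) = of_int e' \<and> 1 \<le> z' \<and> z' \<le> 2 * B \<and>
      \<bar>e'\<bar> \<le> \<bar>e\<bar> + int D \<and> w \<le> real z' * 2 powi e' \<and> real z' * 2 powi e' \<le> (1 + 1 / B) * w"
      using res f2 I by (intro exI[of _ "Suc f"] exI[of _ "e - int i"] conjI) auto
    show ?thesis
      unfolding w_def[symmetric] using I ff ex by (simp add: fixed_nums_def f flip: v_def)
  qed
  have rr: "of_nat z * u j / of_nat M = r" by (simp add: r_def)
  have fr0: "enc_len r \<le> Bd" using fr[of 0] r2 by simp
  show ?thesis
    unfolding weight_def
    apply (rule run_le)
     apply (rule run_AssignN_Seq)
      apply (rule run_AssignN_Seq)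
       apply (rule run_Seq[OF _ wp_run[OF fin]])
        apply (use loop s fz fr0 rr in simp)
       apply assumption
    using s fz fr0 rr by simp_all
qed

abbreviation "T j p \<equiv> tally k S M coef j p"

text \<open>The volume of one grid cell in the first \<open>j\<close> coordinates.\<close>

definition box_weight :: "nat \<Rightarrow> real" where
  "box_weight j = (\<Prod>l<j. real_of_rat (u l) / M)"

section \<open>Assembly of the counting phase\<close>

text \<open>Each coordinate adds \<open>M\<close> to the nesting depth of the counts, one rounding
  to the weight, and at most \<open>D\<close> to the modulus of its exponent. Both odometers stand
  at 0 between stages.\<close>

definition stage_inv :: "nat \<Rightarrow> store \<Rightarrow> bool" where
  "stage_inv j s \<longleftrightarrow> env1 s \<and> idx s (0, 6) = S ^ k \<and> idx s (0, 3) = j \<and> j \<le> n \<and>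
     (\<forall>i<k. num s (5, i) = 0) \<and> (\<forall>i<k. num s (6, i) = 0) \<and>
     (\<forall>p<S ^ k. flt s (20, p) (21, p) (j * M) (T j p)) \<and>
     (\<exists>z e. num s (10, 12) = of_nat z \<and> num s (10, 13) = of_int e \<and> 1 \<le> z \<and> z \<le> 2 * B \<and>
        \<bar>e\<bar> \<le> int (j * D) \<and> box_weight j \<le> real z * 2 powi e \<and>
        real z * 2 powi e \<le> (1 + 1 / B) ^ j * box_weight j)"

text \<open>Bracketed like \<open>stage\<close>, as \<open>run_Seq\<close> matches step bounds
  syntactically.\<close>

definition stage_time :: nat where
  "stage_time = (k * (3 * n + 5) + 3) + ((k * 6 + 3) + ((k * 6 + 2) + ((D * 3 + 5) +
     ((S ^ k * (M * (S ^ k * (k * 14 + 29) + 4) + k * 6 + 11) + 2) + ((S ^ k * 4 + 2) + 1)))))"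

lemma nM_D_le_X:
  "Suc (n * M) < X" "n * D \<le> X"
proof -
  have "n * M \<le> R" unfolding R using M by (intro mult_le_mono1)
  then show "Suc (n * M) < X" using X_ge B_ge by linarith
  show "n * D \<le> X" using X by linarith
qed

lemma box_weight_nonneg: "j \<le> n \<Longrightarrow> 0 \<le> box_weight j"
  unfolding box_weight_def using ubound_bounds
  by (intro prod_nonneg divide_nonneg_nonneg) (auto simp: less_imp_le)

lemma run_stage:
  assumes j: "j < n" and inv: "stage_inv j s"
  shows "run Bd stage s stage_time (stage_inv (Suc j))"
proof -
  let ?U = "{7, 8} \<times> UNIV \<union> {10} \<times> {10, 11, 12, 13 :: nat}" and ?W = "{0} \<times> {2, 4, 5 :: nat}"
  have s: "env1 s" "idx s (0, 6) = S ^ k" "idx s (0, 3) = j"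
    "\<And>i. i < k \<Longrightarrow> num s (5, i) = 0" "\<And>i. i < k \<Longrightarrow> num s (6, i) = 0"
    "\<And>p. p < S ^ k \<Longrightarrow> flt s (20, p) (21, p) (j * M) (T j p)"
    using inv by (auto simp: stage_inv_def)
  obtain z e where z: "num s (10, 12) = of_nat z" "num s (10, 13) = of_int e" "1 \<le> z" "z \<le> 2 * B"
    "\<bar>e\<bar> \<le> int (j * D)" "box_weight j \<le> real z * 2 powi e"
    "real z * 2 powi e \<le> (1 + 1 / B) ^ j * box_weight j"
    using inv unfolding stage_inv_def by blast
  have jn: "Suc j \<le> n" using j by simp
  have jD: "j * D + D \<le> n * D" using mult_le_mono1[OF jn, of D] by simp
  have jM: "j * M + M \<le> n * M" using mult_le_mono1[OF jn, of M] by simp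
  have eX: "\<bar>e\<bar> + int D \<le> int X"
  proof -
    have "int (j * D) + int D \<le> int X" unfolding of_nat_add[symmetric] of_nat_le_iff
      using jD nM_D_le_X(2) by linarith
    with z(5) show ?thesis by linarith
  qed
  let ?P = "\<lambda>s'. \<exists>z' e'. num s' (10, 12) = of_nat z' \<and> num s' (10, 13) = of_int e' \<and> 1 \<le> z' \<and> z' \<le> 2 * B \<and>
      \<bar>e'\<bar> \<le> \<bar>e\<bar> + int D \<and>
      real z * 2 powi e * (real_of_rat (u j) / M) \<le> real z' * 2 powi e' \<and>
      real z' * 2 powi e' \<le> (1 + 1 / B) * (real z * 2 powi e * (real_of_rat (u j) / M))"
  have w: "0 \<le> real_of_rat (u j) / M" using ubound_bounds[OF j] by (auto simp: less_imp_le)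
  have P_weight: "\<exists>z e. num s' (10, 12) = of_nat z \<and> num s' (10, 13) = of_int e \<and> 1 \<le> z \<and> z \<le> 2 * B \<and>
        \<bar>e\<bar> \<le> int (Suc j * D) \<and> box_weight (Suc j) \<le> real z * 2 powi e \<and>
        real z * 2 powi e \<le> (1 + 1 / B) ^ Suc j * box_weight (Suc j)" if P: "?P s'" for s'
  proof -
    from P obtain z' e' where z': "num s' (10, 12) = of_nat z'" "num s' (10, 13) = of_int e'" "1 \<le> z'" "z' \<le> 2 * B"
      "\<bar>e'\<bar> \<le> \<bar>e\<bar> + int D" "real z * 2 powi e * (real_of_rat (u j) / M) \<le> real z' * 2 powi e'"
      "real z' * 2 powi e' \<le> (1 + 1 / B) * (real z * 2 powi e * (real_of_rat (u j) / M))" by blast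
    have S: "box_weight (Suc j) = box_weight j * (real_of_rat (u j) / M)" by (simp add: box_weight_def)
    have "box_weight (Suc j) \<le> real z * 2 powi e * (real_of_rat (u j) / M)"
      unfolding S using z(6) w by (rule mult_right_mono)
    then have lo: "box_weight (Suc j) \<le> real z' * 2 powi e'" using z'(6) by (rule order_trans)
    have "real z * 2 powi e * (real_of_rat (u j) / M) \<le> ((1 + 1 / B) ^ j * box_weight j) * (real_of_rat (u j) / M)"
      using z(7) w by (rule mult_right_mono)
    then have "(1 + 1 / B) * (real z * 2 powi e * (real_of_rat (u j) / M))
        \<le> (1 + 1 / B) * (((1 + 1 / B) ^ j * box_weight j) * (real_of_rat (u j) / M))"
      by (rule mult_left_mono) simp
    also have "\<dots> = (1 + 1 / B) ^ Suc j * box_weight (Suc j)" by (simp only: S power_Suc mult.assoc)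
    finally have hi: "real z' * 2 powi e' \<le> (1 + 1 / B) ^ Suc j * box_weight (Suc j)" using z'(7) by linarith
    have "\<bar>e'\<bar> \<le> int (Suc j * D)" using z'(5) z(5) by simp
    with z' lo hi show ?thesis by blast
  qed
  have "run Bd (new_table ;; copy_table ;; incr iJ) s4
     ((S ^ k * (M * (S ^ k * (k * 14 + 29) + 4) + k * 6 + 11) + 2) + ((S ^ k * 4 + 2) + 1)) (stage_inv (Suc j))"
    if a4: "agree ?U ?W s s4" and e4: "env1 s4" and c4: "\<And>i. i < k \<Longrightarrow> num s4 (8, i) = of_nat (coef i j)"
      and P4: "?P s4" for s4
  proof -
    have t4: "tab coef j (T j) (j * M) s4"
      unfolding tab_def using s e4 c4 by (auto simp: agree_idx[OF a4] agree_num[OF a4] flt_def)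
    have dd: "\<And>i. i < k \<Longrightarrow> num s4 (5, i) = 0" "\<And>i. i < k \<Longrightarrow> num s4 (6, i) = 0"
      using s by (simp_all add: agree_num[OF a4])
    have E: "Suc (j * M + M) < X" using jM nM_D_le_X(1) by linarith
    show ?thesis
    proof (rule run_Seq[OF run_new_table[OF t4 coef_le[OF _ j] dd E]], assumption+, elim conjE, goal_cases)
      case (1 s5)
      note a5 = 1(1) and t5 = 1(2)
      have V: "T (Suc j) p = (\<Sum>y<M. \<Sum>q\<in>hits coef j p y (S ^ k). T j q)" for p
        unfolding hits_def by (rule tally_Suc) simp
      have fl5: "flt s5 (22, p) (23, p) (Suc j * M) (T (Suc j) p)" if "p < S ^ k" for p
        using 1(5) that by (simp add: V add.commute)
      have E5: "Suc j * M \<le> X" using E by simp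
      show ?case
      proof (rule run_Seq_wp[OF run_copy_table[OF tab_env1[OF t5] tab_idx[OF t5] fl5 E5]],
          assumption, elim conjE, goal_cases)
        case (1 s6)
        note a6 = 1(1)
        have "idx s6 (0, 3) = j" using s by (simp add: agree_idx[OF a6] agree_idx[OF a5] agree_idx[OF a4])
        moreover have "idx s6 (0, 6) = S ^ k" using s by (simp add: agree_idx[OF a6] agree_idx[OF a5] agree_idx[OF a4])
        moreover have "num s6 (5, i) = 0" "num s6 (6, i) = 0" if "i < k" for i
          using that \<open>\<forall>i<k. num s5 (5, i) = 0\<close> \<open>\<forall>i<k. num s5 (6, i) = 0\<close>
          by (simp_all add: agree_num[OF a6])
        moreover have "?P s6" using P4 by (simp add: agree_num[OF a6] agree_num[OF a5])
        ultimately show ?case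
          using 1(2,3) P_weight[of s6] jn by (simp add: stage_inv_def incr_def env_idxs_def flt_def)
      qed (simp add: incr_def)
    qed
  qed
  note rest = this
  show ?thesis
    unfolding stage_def stage_time_def
  proof (rule run_Seq[OF run_get_column[where j = j]], goal_cases)
    case (4 s1)
    then have a1: "agree ({7} \<times> UNIV) {(0, 2), (0, 4), (0, 5)} s s1"
      and col: "\<And>i. i < k \<Longrightarrow> num s1 (7, i) = of_int (A i j)" by auto
    have e1: "env1 s1" by (rule env1_agree[OF s(1) a1]) (auto simp: fixed_nums_def env_idxs_def)
    have a1': "agree ?U ?W s s1" by (rule agree_mono[OF a1]) auto
    show ?case
    proof (rule run_Seq[OF run_upper_bound[OF e1 j col]], assumption, elim conjE, goal_cases)
      case (1 s2)
      note a2 = 1(1)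
      have a2': "agree ?U ?W s s2" by (rule agree_trans[OF a1' a2]) auto
      have col2: "num s2 (7, i) = of_int (A i j)" if "i < k" for i
        using col[OF that] by (simp add: agree_num[OF a2])
      show ?case
      proof (rule run_Seq[OF run_round_column[OF 1(2,3) j col2]], assumption, elim conjE, goal_cases)
        case (1 s3)
        note a3 = 1(1)
        have a3': "agree ?U ?W s s3" by (rule agree_trans[OF a2' a3]) auto
        have s3: "num s3 (10, 10) = u j" "num s3 (10, 12) = of_nat z" "num s3 (10, 13) = of_int e"
          using \<open>num s2 (10, 10) = u j\<close> z(1,2)
          by (simp_all add: agree_num[OF a3] agree_num[OF a2] agree_num[OF a1])
        show ?case
        proof (rule run_Seq[OF run_weight[OF 1(2) s3 j z(3,4) eX]], elim conjE, goal_cases)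
          case (1 s4)
          have "agree ?U ?W s s4" by (rule agree_trans[OF a3' 1(1)]) auto
          moreover have "num s4 (8, i) = of_nat (coef i j)" if "i < k" for i
            using that \<open>\<forall>i<k. num s3 (8, i) = of_nat (coef i j)\<close> by (simp add: agree_num[OF 1(1)])
          ultimately show ?case using 1(2,3) by (intro rest)
        qed
      qed
    qed
  qed (use s j in auto)
qed

text \<open>The exponents of the error add up: \<open>2 * (n * M)\<close> from the nested additions
  and \<open>n\<close> from the roundings of the weight. Multiplying the exponent of the count by
  \<open>p\<^sub>B\<close> converts it from base \<open>B\<close> to base 2.\<close>

lemma run_finish:
  assumes inv: "stage_inv n s"
  shows "run Bd finish s 5 (\<lambda>s'. \<exists>Z. outputs s' Z \<and> T n (S ^ k - 1) * box_weight n \<le> Z \<and>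
    Z \<le> (1 + 1 / B) ^ (2 * (n * M) + n) * (T n (S ^ k - 1) * box_weight n))"
proof -
  define p where "p = S ^ k - 1"
  have p: "p < S ^ k" by (simp add: p_def)
  have s: "env1 s" "idx s (0, 6) = S ^ k" "flt s (20, p) (21, p) (n * M) (T n p)"
    using inv p by (auto simp: stage_inv_def)
  obtain x where x: "num s (20, p) = of_nat (fst x)" "num s (21, p) = of_nat (snd x)" "apx B (n * M) x (T n p)"
    using s(3) by (auto simp: flt_def)
  obtain z e where z: "num s (10, 12) = of_nat z" "num s (10, 13) = of_int e" "1 \<le> z" "z \<le> 2 * B"
    "\<bar>e\<bar> \<le> int (n * D)" "box_weight n \<le> real z * 2 powi e"
    "real z * 2 powi e \<le> (1 + 1 / B) ^ n * box_weight n"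
    using inv unfolding stage_inv_def by blast
  have lx: "fst x \<le> BB" "snd x \<le> n * M" using x(3) by (auto simp: apx_def fnorm_def BB)
  have "fst x * z \<le> BB * (2 * B)" using lx z by (intro mult_le_mono)
  then have f1: "enc_len (of_nat (fst x) * of_nat z) \<le> Bd"
    using fits_nat[of "fst x * z"] X(1) by simp
  have pe: "p\<^sub>B * snd x \<le> p\<^sub>B * (n * M)" using lx by simp
  then have "p\<^sub>B * snd x \<le> X" using X(4) by linarith
  from fits_nat[OF this] have f2: "enc_len (of_nat p\<^sub>B * of_nat (snd x)) \<le> Bd" by simp
  have "\<bar>int (p\<^sub>B * snd x) + e\<bar> \<le> int (p\<^sub>B * snd x) + int (n * D)" using z(5) by linarith
  also have "\<dots> \<le> int X" unfolding of_nat_add[symmetric] of_nat_le_iff using pe X(4) by linarith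
  finally have f3: "enc_len (of_nat p\<^sub>B * of_nat (snd x) + of_int e) \<le> Bd"
    using fits_int[of "int (p\<^sub>B * snd x) + e"] by simp
  define Z where "Z = fval B x * (real z * 2 powi e)"
  have w0: "0 \<le> box_weight n" by (simp add: box_weight_nonneg)
  have fx: "T n p \<le> fval B x" "fval B x \<le> (1 + 1 / B) ^ (2 * (n * M)) * T n p" "0 \<le> fval B x"
    using x(3) by (auto simp: apx_def fval_def)
  have Z1: "T n p * box_weight n \<le> Z"
    unfolding Z_def by (rule mult_mono[OF fx(1) z(6) fx(3) w0])
  have "Z \<le> ((1 + 1 / B) ^ (2 * (n * M)) * T n p) * ((1 + 1 / B) ^ n * box_weight n)"
    unfolding Z_def by (rule mult_mono[OF fx(2) z(7)]) simp_all
  then have Z2: "Z \<le> (1 + 1 / B) ^ (2 * (n * M) + n) * (T n p * box_weight n)"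
    by (simp only: power_add mult_ac)
  have "real B = 2 powi int p\<^sub>B" by (simp add: B(1))
  then have "real B ^ snd x = 2 powi (int p\<^sub>B * int (snd x))" by (simp add: B(1) flip: power_mult of_nat_mult)
  then have Z3: "Z = real_of_rat (of_nat (fst x) * of_nat z) * 2 powi (int p\<^sub>B * int (snd x) + e)"
    by (simp add: Z_def fval_def power_int_add of_rat_mult)
  have pd: "S ^ k - Suc 0 = p" by (simp add: p_def)
  have "wp Bd finish (\<lambda>s'. num s' (3, 0) = of_nat (fst x) * of_nat z \<and>
      num s' (3, Suc 0) = of_int (int p\<^sub>B * int (snd x) + e)) s"
    unfolding finish_def using s x z f1 f2 f3 by (simp add: env_idxs_def fixed_nums_def pd)
  from wp_run[OF this] show ?thesis
  proof (rule run_mono)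
    show "cost finish \<le> 5" by (simp add: finish_def)
    fix s' :: store assume s': "num s' (3, 0) = of_nat (fst x) * of_nat z \<and>
      num s' (3, Suc 0) = of_int (int p\<^sub>B * int (snd x) + e)"
    then have "outputs s' Z"
      unfolding outputs_def Z3 by (intro exI[of _ "int p\<^sub>B * int (snd x) + e"]) simp
    with Z1 Z2 show "\<exists>Z. outputs s' Z \<and> T n (S ^ k - 1) * box_weight n \<le> Z \<and>
        Z \<le> (1 + 1 / B) ^ (2 * (n * M) + n) * (T n (S ^ k - 1) * box_weight n)"
      unfolding p_def by blast
  qed
qed

definition count_time :: nat where
  "count_time = (S ^ k * (k * 6 + 5) + 3) + ((S ^ k * 4 + 2) + (3 + ((n * (stage_time + 1) + 1) + 5)))"

lemma run_count_program:
  assumes s: "env1 s" and d: "\<And>i. i < k \<Longrightarrow> num s (5, i) = 0" "\<And>i. i < k \<Longrightarrow> num s (6, i) = 0"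
  shows "run Bd count_program s count_time (\<lambda>s'. \<exists>Z. outputs s' Z \<and> T n (S ^ k - 1) * box_weight n \<le> Z \<and>
    Z \<le> (1 + 1 / B) ^ (2 * (n * M) + n) * (T n (S ^ k - 1) * box_weight n))"
    (is "run _ _ _ _ ?Q")
  unfolding count_program_def count_time_def
proof (rule run_Seq[OF run_count_states[OF s d(1)]], assumption, elim conjE, goal_cases)
  case (1 s1)
  note a1 = 1(1) and d5 = 1(3)
  show ?case
  proof (rule run_Seq[OF run_init_table[OF 1(2,4)]], elim conjE, goal_cases)
    case (1 s2)
    note a2 = 1(1)
    let ?s = "set_idx (set_num (set_num s2 nZm 1) nZe 0) iJ 0"
    have "idx s2 (0, 6) = S ^ k" using \<open>idx s1 (0, 6) = S ^ k\<close> by (simp add: agree_idx[OF a2])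
    moreover have "num s2 (5, i) = 0" "num s2 (6, i) = 0" if "i < k" for i
      using d5 d(2) that by (simp_all add: agree_num[OF a2] agree_num[OF a1])
    ultimately have "stage_inv 0 ?s"
      using 1 B_ge unfolding stage_inv_def
      by (auto simp: fixed_nums_def env_idxs_def flt_def box_weight_def intro!: exI[of _ "Suc 0"] exI[of _ "0::int"])
    then have "run Bd (Loop (LessI iJ iN) stage) ?s (n * (stage_time + 1) + 1) (stage_inv n)"
    proof (rule run_Loop[where I = stage_inv], goal_cases)
      case (1 j s3)
      then have "j < n" by (auto simp: stage_inv_def)
      with run_stage 1 show ?case by blast
    next
      case (2 j s3)
      then have "j = n" by (auto simp: stage_inv_def)
      with 2 show ?case by blast
    qed
    then have "run Bd (Loop (LessI iJ iN) stage ;; finish) ?s ((n * (stage_time + 1) + 1) + 5) ?Q"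
      by (rule run_Seq) (rule run_finish)
    then have "run Bd (AssignN nZm (NCopy nOne) ;; AssignN nZe (NCopy nZero) ;; AssignI iJ (IConst 0) ;;
        Loop (LessI iJ iN) stage ;; finish) s2 (Suc (Suc (Suc ((n * (stage_time + 1) + 1) + 5)))) ?Q"
      using 1 by (intro run_AssignN_Seq run_AssignI_Seq) simp_all
    then show ?case by (rule run_le) simp
  qed
qed

section \<open>From the count to the volume\<close>

lemma T_full: "T n (S ^ k - 1) = card {y \<in> {..<n} \<rightarrow>\<^sub>E {..<M}. \<forall>i<k. (\<Sum>j<n. coef i j * y j) \<le> M\<^sup>2}"
  unfolding tally_def by (simp add: digit_power_minus_1[simplified] R power2_eq_square)

text \<open>The program computes with rationals, \<open>vol_approx_by_count\<close> with reals; its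
  hypotheses are carried over by \<open>of_rat\<close>. The geometric ingredient is that
  \<open>u j\<close> bounds coordinate \<open>j\<close> on the whole polytope, since one nonnegative
  term of a row is at most the row sum.\<close>

lemma T_full_bounds:
  shows "vol n (polytope_in_cube k n A b) \<le> T n (S ^ k - 1) * box_weight n"
    and "T n (S ^ k - 1) * box_weight n \<le> (1 + 3 * n / M) ^ n * vol n (polytope_in_cube k n A b)"
proof -
  have ub: "0 < real_of_rat (u j) \<and> real_of_rat (u j) \<le> 1" if "j < n" for j
    using ubound_bounds[OF that, of k] by simp
  have Au: "real_of_int (A i j) * real_of_rat (u j) \<le> real_of_int (b i)" if "i < k" "j < n" for i j
  proof -
    have "real_of_rat (of_int (A i j) * u j) \<le> real_of_rat (of_int (b i))"
      using A_times_u[OF that] unfolding of_rat_less_eq .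
    then show ?thesis by (simp add: of_rat_mult)
  qed
  have Pu: "x j \<le> real_of_rat (u j)" if x: "x \<in> polytope_in_cube k n A b" and j: "j < n" for x j
  proof -
    have x01: "0 \<le> x l" "x l \<le> 1" if "l < n" for l
      using x that by (auto simp: polytope_in_cube_def PiE_def Pi_def)
    have "x j \<le> real_of_rat (ubound j i)" if "i \<le> k" for i
      using that
    proof (induction i)
      case 0
      then show ?case using x01[OF j] by simp
    next
      case (Suc i)
      have "x j \<le> real_of_int (b i) / real_of_int (A i j)" if "0 < A i j"
      proof -
        have "real_of_int (A i j) * x j \<le> (\<Sum>l<n. real_of_int (A i l) * x l)"
          using A Suc.prems j x01 by (intro member_le_sum) auto
        also have "\<dots> \<le> b i" using x Suc.prems by (auto simp: polytope_in_cube_def)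
        finally show ?thesis using that by (simp add: field_simps)
      qed
      with Suc show ?case by (simp add: of_rat_divide)
    qed
    then show ?thesis by simp
  qed
  have co: "real (coef i j) \<le> real M * real_of_int (A i j) * real_of_rat (u j) / real_of_int (b i)
      \<and> real M * real_of_int (A i j) * real_of_rat (u j) / real_of_int (b i) < real (coef i j) + 1"
    if "i < k" "j < n" for i j
  proof -
    let ?q = "of_nat M * of_int (A i j) * u j / of_int (b i) :: rat"
    have "of_nat (coef i j) = (of_int \<lfloor>?q\<rfloor> :: rat)" using coef_nonneg_arg[OF that] by (simp add: coef_def)
    then have "of_nat (coef i j) \<le> ?q" "?q < of_nat (coef i j) + 1" by linarith+
    then have "real_of_rat (of_nat (coef i j)) \<le> real_of_rat ?q"
      "real_of_rat ?q < real_of_rat (of_nat (coef i j) + 1)"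
      unfolding of_rat_less_eq of_rat_less by blast+
    then show ?thesis by (simp add: of_rat_mult of_rat_divide of_rat_add)
  qed
  have A0: "\<forall>i<k. \<forall>j<n. 0 \<le> A i j" using A by blast
  have b0: "\<forall>i<k. 0 \<le> b i" using b_nonneg by blast
  have M1: "1 \<le> M" using M by simp
  show "vol n (polytope_in_cube k n A b) \<le> T n (S ^ k - 1) * box_weight n"
    unfolding T_full box_weight_def
    by (rule vol_approx_by_count(1)[where u = "\<lambda>j. real_of_rat (u j)" and c = coef and k = k and n = n
        and A = A and b = b and M = M], rule A0, rule b0, rule M1, erule ub, erule (1) Au, erule (1) Pu,
        erule (1) co)
  show "T n (S ^ k - 1) * box_weight n \<le> (1 + 3 * n / M) ^ n * vol n (polytope_in_cube k n A b)"
    unfolding T_full box_weight_def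
    by (rule vol_approx_by_count(2)[where u = "\<lambda>j. real_of_rat (u j)" and c = coef and k = k and n = n
        and A = A and b = b and M = M], rule A0, rule b0, rule M1, erule ub, erule (1) Au, erule (1) Pu,
        erule (1) co)
qed

section \<open>The number of steps of the counting phase\<close>

text \<open>With \<open>N\<close> the number of states, \<open>k\<close>, \<open>n\<close>,
  \<open>M\<close> and \<open>R\<close> are all at most \<open>N\<close>, so nested loops cost a
  fixed power of \<open>N\<close>. Only the doublings, through \<open>D\<close>, bring in
  \<open>l\<close>, and they do so linearly.\<close>

lemma count_time_le:
  assumes N: "N = S ^ k" and D': "D \<le> 4 * N + l"
  shows "count_time \<le> 148 * (1 + l) * N ^ 6" and "k \<le> N" and "R \<le> N"
proof -
  have "S ^ 1 \<le> S ^ k" using k by (intro power_increasing) auto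
  then show R: "R \<le> N" by (simp add: N)
  have "(2::nat) ^ k \<le> S ^ k" using B_ge by (intro power_mono) auto
  then show kN: "k \<le> N" using less_exp[of k] N by linarith
  have N1: "1 \<le> N" using R B_ge by linarith
  have pw: "1 \<le> N ^ 6" "N \<le> N ^ 6" "N * N \<le> N ^ 6" "N * N ^ 5 = N ^ 6"
    "1 \<le> N ^ 5" "N \<le> N ^ 5" "N * N \<le> N ^ 5" "N * (N * (N * N)) \<le> N ^ 5"
  proof -
    have *: "N ^ i \<le> N ^ j" if "i \<le> j" for i j using that N1 by (intro power_increasing)
    show "1 \<le> N ^ 6" "N \<le> N ^ 6" "N * N \<le> N ^ 6" "1 \<le> N ^ 5" "N \<le> N ^ 5" "N * N \<le> N ^ 5"
        "N * (N * (N * N)) \<le> N ^ 5"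
      using *[of 0 6] *[of 1 6] *[of 2 6] *[of 0 5] *[of 1 5] *[of 2 5] *[of 4 5]
      by (simp_all add: numeral_eq_Suc)
    show "N * N ^ 5 = N ^ 6" by (simp add: numeral_eq_Suc)
  qed
  have MN: "M \<le> N" "n \<le> N" using R B_ge(3) M by linarith+
  have t1: "k * (3 * n + 5) \<le> N * (8 * N)" using kN MN N1 by (intro mult_le_mono) linarith+
  have "N * (k * 14 + 29) \<le> N * (43 * N)" using kN N1 by (intro mult_le_mono2) linarith
  moreover have "N * (43 * N) = 43 * (N * N)" by simp
  moreover have "1 \<le> N * N" using N1 by simp
  ultimately have "N * (k * 14 + 29) + 4 \<le> 47 * (N * N)" by linarith
  then have "M * (N * (k * 14 + 29) + 4) \<le> N * (47 * (N * N))" using MN by (intro mult_le_mono)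
  moreover have "k * 6 + 11 \<le> 17 * (N * (N * N))"
  proof -
    have "N * 1 \<le> N * (N * N)" using N1 by (intro mult_le_mono2) simp
    with kN N1 show ?thesis by linarith
  qed
  ultimately have "M * (N * (k * 14 + 29) + 4) + k * 6 + 11 \<le> 64 * (N * (N * N))" by simp
  then have "N * (M * (N * (k * 14 + 29) + 4) + k * 6 + 11) \<le> N * (64 * (N * (N * N)))"
    by (rule mult_le_mono2)
  also have "\<dots> = 64 * (N * (N * (N * N)))" by simp
  also have "\<dots> \<le> 64 * N ^ 5" using pw(8) by simp
  finally have t2: "N * (M * (N * (k * 14 + 29) + 4) + k * 6 + 11) \<le> 64 * N ^ 5" .
  have l: "l \<le> l * N ^ 5" using pw(5) by simp
  have "stage_time \<le> 118 * N ^ 5 + 3 * (l * N ^ 5)"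
    unfolding stage_time_def N[symmetric] using t1 t2 l kN D' pw(5-7) by linarith
  then have "stage_time + 1 \<le> 119 * ((1 + l) * N ^ 5)" using pw(5) by (simp add: algebra_simps)
  then have "n * (stage_time + 1) \<le> N * (119 * ((1 + l) * N ^ 5))" using MN by (intro mult_le_mono)
  also have "\<dots> = 119 * (1 + l) * N ^ 6" unfolding pw(4)[symmetric] by (simp only: mult_ac)
  finally have t3: "n * (stage_time + 1) \<le> 119 * (1 + l) * N ^ 6" .
  have t4: "N * (k * 6 + 5) \<le> N * (11 * N)" using kN N1 by (intro mult_le_mono2) linarith
  have "count_time \<le> 29 * N ^ 6 + 119 * (1 + l) * N ^ 6"
    unfolding count_time_def N[symmetric] using t3 t4 pw(1-3) by linarith
  also have "\<dots> \<le> 148 * (1 + l) * N ^ 6" by (simp add: algebra_simps)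
  finally show "count_time \<le> 148 * (1 + l) * N ^ 6" .
qed

end

section \<open>Choice of the parameters\<close>

lemma enc_len_of_int: "enc_len (of_int a) = \<lceil>log 2 (real_of_int (\<bar>a\<bar> + 1))\<rceil> + 1"
  by (simp add: enc_len_def)

lemma abs_le_two_power_enc_len:
  assumes "enc_len (of_int a) \<le> int l"
  shows "\<bar>a\<bar> \<le> int (2 ^ l)"
proof -
  have "log 2 (real_of_int (\<bar>a\<bar> + 1)) \<le> real l"
    using assms unfolding enc_len_of_int by linarith
  then have "real_of_int (\<bar>a\<bar> + 1) \<le> 2 powr real l" by (subst (asm) log_le_iff) auto
  then have "real_of_int (\<bar>a\<bar> + 1) \<le> real_of_int (2 ^ l)" by (simp add: powr_realpow)
  then show ?thesis unfolding of_int_le_iff by simp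
qed

section \<open>The error budget\<close>

text \<open>The dilation contributes at most the exponential of \<open>3 * n * n / M\<close>. The
  floating point exponent is at most \<open>3 * n * M\<close>, which divided by \<open>B\<close> is
  again at most \<open>3 * n * n / M\<close>. By the choice of \<open>M\<close> each is at most
  \<open>3 / 16 * \<delta>\<close>, and the exponential of \<open>3 / 8 * \<delta>\<close> leaves
  enough room for its quadratic term below \<open>1 + \<delta>\<close>.\<close>

lemma error_le:
  fixes \<delta> :: real
  assumes n: "1 \<le> n" and M: "16 * real n * real n \<le> \<delta> * M" "0 < M" and B: "M * M \<le> B" and \<delta>: "0 < \<delta>" "\<delta> \<le> 1/2"
  shows "(1 + 1 / real B) ^ (2 * (n * M) + n) * (1 + 3 * real n / real M) ^ n \<le> 1 + \<delta>"
proof -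
  have M0: "0 < real M" using M by simp
  have "real (M * M) \<le> real B" using B by (simp only: of_nat_le_iff)
  then have B': "real M * real M \<le> real B" by simp
  then have B0: "0 < real B" using M0 by (smt (verit) mult_pos_pos)
  have pw: "(1 + x) ^ m \<le> exp (real m * x)" if "0 \<le> x" for x :: real and m
    using power_mono[OF exp_ge_add_one_self[of x], of m] that by (simp add: exp_of_nat_mult)
  have "2 * (n * M) + n \<le> 3 * (n * M)" using M(2) by simp
  then have "real (2 * (n * M) + n) \<le> real (3 * (n * M))" by (simp only: of_nat_le_iff)
  then have "real (2 * (n * M) + n) * (1 / real B) \<le> (3 * real n * real M) * (1 / (real M * real M))"
    using B' M0 B0 by (intro mult_mono divide_left_mono mult_pos_pos) auto
  also have "\<dots> \<le> 3 * real n * real n / real M" using M0 n by (simp add: field_simps)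
  finally have e1: "real (2 * (n * M) + n) * (1 / real B) \<le> 3 * real n * real n / real M" .
  have e0: "3 * real n * real n / real M \<le> 3 / 16 * \<delta>" using M M0 by (simp add: field_simps)
  then have e: "real (2 * (n * M) + n) * (1 / real B) + real n * (3 * real n / real M) \<le> 3 / 8 * \<delta>"
  proof -
    have "real n * (3 * real n / real M) = 3 * real n * real n / real M" by simp
    with e0 e1 show ?thesis by linarith
  qed
  have "(1 + 1 / real B) ^ (2 * (n * M) + n) * (1 + 3 * real n / real M) ^ n
      \<le> exp (real (2 * (n * M) + n) * (1 / real B)) * exp (real n * (3 * real n / real M))"
    using pw[of "1 / B" "2 * (n * M) + n"] pw[of "3 * real n / real M" n] by (intro mult_mono) auto
  also have "\<dots> = exp (real (2 * (n * M) + n) * (1 / real B) + real n * (3 * real n / real M))"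
    by (rule exp_add[symmetric])
  also have "\<dots> \<le> exp (3 / 8 * \<delta>)" using e by simp
  also have "\<dots> \<le> 1 + 3 / 8 * \<delta> + (3 / 8 * \<delta>)\<^sup>2" using \<delta> by (intro exp_bound) auto
  also have "(3 / 8 * \<delta>)\<^sup>2 \<le> 5 / 8 * \<delta>"
  proof -
    have "(3 / 8 * \<delta>) * (3 / 8 * \<delta>) \<le> (3 / 8 * \<delta>) * 1" using \<delta> by (intro mult_left_mono) auto
    then show ?thesis using \<delta> by (simp add: power2_eq_square)
  qed
  finally show ?thesis by simp
qed

context volume_program
begin

section \<open>The whole program\<close>

lemma run_volume_code:
  assumes A0: "\<forall>i<k. \<forall>j<n. 0 \<le> A i j"
    and q: "(1/2) ^ Suc q \<le> \<epsilon>" "\<And>l. l < q \<Longrightarrow> \<epsilon> < (1/2) ^ Suc l"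
    and M_eq: "M = 16 * n * n * 2 ^ Suc q"
    and p: "\<And>l. l < p \<Longrightarrow> 2 ^ l < M * M" "M * M \<le> 2 ^ p"
    and D: "2 ^ p * M * H \<le> 2 ^ D" "D \<le> 4 * Suc (M * M) ^ k + l"
    and X: "4 * (2 ^ p * 2 ^ p) * 2 ^ p \<le> X" "H * M \<le> X" "H * H \<le> X" "p * (n * M) + n * D \<le> X"
  defines "P \<equiv> polytope_in_cube k n A b"
  shows "run Bd volume_code (input_store k n A b \<epsilon>) (256 * (1 + l) * (Suc (M * M) ^ k) ^ 6)
    (\<lambda>s'. \<exists>Z. outputs s' Z \<and> vol n P \<le> Z \<and>
      Z \<le> (1 + 1 / real (2 ^ p)) ^ (2 * (n * M) + n) * (1 + 3 * real n / real M) ^ n * vol n P)"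
proof -
  define N where "N = Suc (M * M) ^ k"
  define E where "E = (1 + 1 / real (2 ^ p)) ^ (2 * (n * M) + n) * (1 + 3 * real n / real M) ^ n"
  have D2: "D \<le> 4 * N + l" using D(2) by (simp add: N_def)
  let ?Q = "\<lambda>s'. \<exists>Z. outputs s' Z \<and> vol n P \<le> Z \<and> Z \<le> E * vol n P"
  let ?T = "q * 2 + 2 + (n * 3 + 3 + (5 + (p * 3 + 4 + 148 * (1 + l) * N ^ 6)))"
  have n2: "n \<le> n * n" "1 \<le> n * n" using n by simp_all
  have nM: "16 * (n * n) \<le> M" "2 ^ Suc q \<le> M" using n2 unfolding M_eq by simp_all
  have M16: "16 \<le> M" "n \<le> M" "M \<le> M * M" using nM n2 by linarith+ simp
  have "Suc (M * M) ^ 1 \<le> Suc (M * M) ^ k" using k by (intro power_increasing) auto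
  then have MN: "M * M \<le> N" by (simp add: N_def)
  have X1: "2 ^ p * 2 ^ p \<le> X"
  proof -
    have "(2::nat) ^ p * 2 ^ p * 1 \<le> 2 ^ p * 2 ^ p * (4 * 2 ^ p)" by (intro mult_le_mono2) simp
    also have "\<dots> \<le> X" using X(1) by (simp only: mult_ac)
    finally show ?thesis by simp
  qed
  have "2 ^ p * 1 \<le> (2::nat) ^ p * 2 ^ p" by (intro mult_le_mono2) simp
  then have MX: "M * M \<le> X" using p(2) X1 by linarith
  then have qX: "2 ^ Suc q \<le> X" "n \<le> X" using nM M16 by linarith+

  define s0 where "s0 = set_num (set_num (input_store k n A b \<epsilon>) nOne 1) nTwo 2"
  have "i * n + j < k * n" if "i < k" "j < n" for i j
  proof -
    have "i * n + j < Suc i * n" using that by simp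
    also have "\<dots> \<le> k * n" using that by (intro mult_le_mono1) simp
    finally show ?thesis .
  qed
  then have s0: "env s0" unfolding env_def s0_def by (auto simp: input_store_def)
  have z0: "idx s0 (0, 10) = 0" "num s0 (0, 0) = \<epsilon>" "num s0 (3, 0) = 0" "num s0 (3, Suc 0) = 0"
    "\<And>i. num s0 (5, i) = 0" "\<And>i. num s0 (6, i) = 0"
    by (simp_all add: s0_def input_store_def)

  have main: "run Bd (Cond (LessI iZ iBad) Skip
       (set_accuracy ;; set_dimension ;; set_scale ;; set_base ;; count_program)) s1 (?T + 1) ?Q"
    if a1: "agree ({7} \<times> UNIV) ({0} \<times> {2, 3, 4, 5, 10}) s0 s1" and e1: "env s1"
      and bad: "idx s1 (0, 10) = (if \<exists>j<n. \<exists>i<k. bad A b i j then 1 else 0)" for s1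
  proof (rule run_Cond)
    assume "holds s1 (LessI iZ iBad)"
    then obtain i j where ij: "i < k" "j < n" "bad A b i j" using e1 bad by (auto split: if_splits)
    then have "vol n P = 0"
      unfolding P_def bad_def using vol_eq_0_if_negative[OF A0] vol_eq_0_if_flat[OF A0] by blast
    \<comment> \<open>The frame of the scan leaves array 3 with its initial zeros.\<close>
    moreover have "outputs s1 0"
      unfolding outputs_def using z0 by (intro exI[of _ 0]) (simp add: agree_num[OF a1])
    ultimately show "run Bd Skip s1 ?T ?Q" by (intro run_Skip exI[of _ 0]) simp
  next
    assume "\<not> holds s1 (LessI iZ iBad)"
    then have good: "\<And>i j. i < k \<Longrightarrow> j < n \<Longrightarrow> \<not> bad A b i j" using e1 bad by (auto split: if_splits)
    interpret counting_program k n A b H X Bd M "M * M" "2 ^ p" "2 ^ p * 2 ^ p" p D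
      by standard (use p(2) M16 good D X in auto)
    have ct: "count_time \<le> 148 * (1 + l) * N ^ 6"
      by (rule count_time_le(1)[OF N_def]) (rule D2)
    show "run Bd (set_accuracy ;; set_dimension ;; set_scale ;; set_base ;; count_program) s1 ?T ?Q"
    proof (rule run_Seq[OF run_set_accuracy[OF e1 _ q qX(1)]], goal_cases)
      case 1
      then show ?case using z0 by (simp add: agree_num[OF a1])
    next
      case (3 s2)
      then have a2: "agree {(10, 3)} {} s1 s2" and s2: "env s2" "num s2 (10, 3) = (1/2) ^ Suc q" by blast+
      show ?case
      proof (rule run_Seq[OF run_set_dimension[OF s2(1) qX(2)]], elim conjE, goal_cases)
        case (1 s3)
        note a3 = 1(1)
        have d3: "num s3 (10, 3) = (1/2) ^ Suc q" using s2 by (simp add: agree_num[OF a3])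
        show ?case
        proof (rule run_Seq[OF run_set_scale[OF 1(2,3) d3 M_eq MX]], elim conjE, goal_cases)
          case (1 s4)
          note a4 = 1(1)
          show ?case
          proof (rule run_Seq[OF run_set_base[OF 1(2,4) p X1]], assumption, elim conjE, goal_cases)
            case (1 s5)
            note a5 = 1(1)
            have "num s5 (10, 5) = of_nat M" "num s5 (10, 8) = of_nat (M * M)"
              using \<open>num s4 (10, 5) = of_nat M\<close> \<open>num s4 (10, 8) = of_nat (M * M)\<close>
              by (simp_all add: agree_num[OF a5])
            then have e5: "env1 s5" unfolding env1_def using 1 by blast
            have d5: "num s5 (5, i) = 0" "num s5 (6, i) = 0" for i
              using z0 by (simp_all add: agree_num[OF a5] agree_num[OF a4] agree_num[OF a3] agree_num[OF a2] agree_num[OF a1])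
            from run_count_program[OF e5 d5] show ?case
            proof (rule run_mono[OF _ ct], goal_cases)
              case (1 s6)
              then obtain Z where Z: "outputs s6 Z" "T n (S ^ k - 1) * box_weight n \<le> Z"
                "Z \<le> (1 + 1 / real (2 ^ p)) ^ (2 * (n * M) + n) * (T n (S ^ k - 1) * box_weight n)"
                by blast
              have "vol n P \<le> Z" using T_full_bounds(1) Z(2) unfolding P_def by linarith
              moreover have "Z \<le> E * vol n P"
              proof -
                have "(1 + 1 / real (2 ^ p)) ^ (2 * (n * M) + n) * (T n (S ^ k - 1) * box_weight n)
                    \<le> (1 + 1 / real (2 ^ p)) ^ (2 * (n * M) + n) * ((1 + 3 * real n / real M) ^ n * vol n P)"
                  using T_full_bounds(2) unfolding P_def by (intro mult_left_mono) auto
                with Z(3) show ?thesis unfolding E_def by (simp only: mult.assoc)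
              qed
              ultimately show ?case using Z(1) by blast
            qed
          qed
        qed
      qed
    qed
  qed
  have "run Bd (scan ;; Cond (LessI iZ iBad) Skip
       (set_accuracy ;; set_dimension ;; set_scale ;; set_base ;; count_program)) s0
       ((n * (k * (3 * n + 5) + k * 7 + 7) + 2) + (?T + 1)) ?Q"
    by (rule run_Seq[OF run_scan[OF s0 z0(1)]], elim conjE, rule main)
  then have r: "run Bd volume_code (input_store k n A b \<epsilon>)
      (Suc (Suc ((n * (k * (3 * n + 5) + k * 7 + 7) + 2) + (?T + 1)))) ?Q"
    unfolding volume_code_def s0_def using fits_nat[of 1] fits_nat[of 2] M16 MX H
    by (intro run_AssignN_Seq) simp_all
  have "(2::nat) ^ k \<le> Suc (M * M) ^ k" using M16 by (intro power_mono) auto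
  then have kN: "k \<le> N" using less_exp[of k] unfolding N_def by linarith
  have nN: "n \<le> N" and N1: "1 \<le> N" using M16 MN by linarith+
  have "q < 2 ^ Suc q" using less_exp[of "Suc q"] by simp
  then have qN: "q \<le> N" using nM M16 MN by linarith
  have pN: "p \<le> N"
  proof (cases p)
    case (Suc p')
    then have "2 ^ p' < M * M" using p(1) by simp
    then show ?thesis using less_exp[of p'] MN Suc by linarith
  qed simp
  have "k * (3 * n + 5) \<le> N * (8 * N)" using kN nN N1 by (intro mult_le_mono) linarith+
  moreover have "k * 7 + 7 \<le> 14 * (N * N)"
  proof -
    have "N * 1 \<le> N * N" using N1 by (intro mult_le_mono2)
    with kN N1 show ?thesis by linarith
  qed
  ultimately have "k * (3 * n + 5) + k * 7 + 7 \<le> 22 * (N * N)" by simp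
  with nN have "n * (k * (3 * n + 5) + k * 7 + 7) \<le> N * (22 * (N * N))" by (rule mult_le_mono)
  moreover have *: "N ^ i \<le> N ^ 6" if "i \<le> 6" for i using that N1 by (intro power_increasing)
  moreover have "N * (22 * (N * N)) = 22 * N ^ 3" by (simp add: power3_eq_cube)
  ultimately have t: "n * (k * (3 * n + 5) + k * 7 + 7) \<le> 22 * N ^ 3" by simp
  have "N ^ 3 \<le> N ^ 6" "N \<le> N ^ 6" "1 \<le> N ^ 6" using *[of 3] *[of 1] *[of 0] by simp_all
  with t have "Suc (Suc ((n * (k * (3 * n + 5) + k * 7 + 7) + 2) + (?T + 1)))
      \<le> 60 * N ^ 6 + 148 * (1 + l) * N ^ 6"
    using nN qN pN by linarith
  also have "\<dots> \<le> 256 * (1 + l) * N ^ 6" by (simp add: algebra_simps)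
  finally show ?thesis
    unfolding N_def[symmetric] E_def[symmetric] by (rule run_le[OF r])
qed

end

section \<open>Running time and choice of the constants\<close>

text \<open>The bound on \<open>M\<close> gives at most
  \<open>2 ^ 11 * n ^ 4 / \<delta>\<^sup>2\<close> for the base of the power, which is raised to
  \<open>6 * k\<close>. Powers of 2 are paid for by \<open>2 \<le> \<Lambda>\<close>: 8 for the
  factor 256 and \<open>66 * k\<close> for the base; together with one more for \<open>1 + l\<close>
  they make at most \<open>75 * k\<close>.\<close>

lemma time_le:
  fixes \<delta> \<Lambda> :: real
  assumes k: "1 \<le> k" and n: "1 \<le> n" and \<delta>: "0 < \<delta>" and \<Lambda>: "2 \<le> \<Lambda>" "1 + real l \<le> \<Lambda>"
    and M: "1 \<le> M" "real M \<le> 32 * real n ^ 2 / \<delta>"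
    and t: "t \<le> 256 * (1 + l) * (Suc (M * M) ^ k) ^ 6"
  shows "real t \<le> real n ^ (24 * k^2) * \<Lambda> ^ (75 * k) / \<delta> ^ (12 * k)"
proof -
  have "M * M \<ge> 1" using M by simp
  then have "real (Suc (M * M)) \<le> real (2 * (M * M))" by (simp only: of_nat_le_iff)
  also have "\<dots> = 2 * (real M * real M)" by simp
  also have "\<dots> \<le> 2 * ((32 * real n ^ 2 / \<delta>) * (32 * real n ^ 2 / \<delta>))"
    using M by (intro mult_left_mono mult_mono) auto
  also have "\<dots> = 2 ^ 11 * real n ^ 4 / \<delta> ^ 2" by (simp add: power2_eq_square numeral_eq_Suc)
  finally have "real (Suc (M * M)) ^ (6 * k) \<le> (2 ^ 11 * real n ^ 4 / \<delta> ^ 2) ^ (6 * k)"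
    by (rule power_mono) simp
  also have "\<dots> = 2 ^ (11 * (6 * k)) * real n ^ (4 * (6 * k)) / \<delta> ^ (2 * (6 * k))"
    by (simp only: power_mult_distrib power_divide power_mult)
  also have "\<dots> = 2 ^ (66 * k) * real n ^ (24 * k) / \<delta> ^ (12 * k)" by simp
  finally have S: "real (Suc (M * M)) ^ (6 * k) \<le> 2 ^ (66 * k) * real n ^ (24 * k) / \<delta> ^ (12 * k)" .
  have "real t \<le> real (256 * (1 + l) * (Suc (M * M) ^ k) ^ 6)" using t by (simp only: of_nat_le_iff)
  also have "\<dots> = (2 ^ 8 * (1 + real l)) * real (Suc (M * M)) ^ (6 * k)"
    by (simp add: power_mult[symmetric] mult.commute)
  also have "\<dots> \<le> (\<Lambda> ^ 8 * \<Lambda>) * (2 ^ (66 * k) * real n ^ (24 * k) / \<delta> ^ (12 * k))"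
    using \<Lambda> S by (intro mult_mono power_mono) auto
  also have "\<dots> \<le> \<Lambda> ^ (9 * k) * (\<Lambda> ^ (66 * k) * real n ^ (24 * k^2) / \<delta> ^ (12 * k))"
  proof (intro mult_mono divide_right_mono)
    have "\<Lambda> ^ 8 * \<Lambda> = \<Lambda> ^ 9" by (simp add: numeral_eq_Suc)
    also have "\<dots> \<le> \<Lambda> ^ (9 * k)" using \<Lambda> k by (intro power_increasing) auto
    finally show "\<Lambda> ^ 8 * \<Lambda> \<le> \<Lambda> ^ (9 * k)" .
    show "2 ^ (66 * k) \<le> \<Lambda> ^ (66 * k)" using \<Lambda> by (intro power_mono) auto
    \<comment> \<open>The linear exponent is weakened here to the quadratic one of the
      claim.\<close>
    show "real n ^ (24 * k) \<le> real n ^ (24 * k^2)"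
      using n k by (intro power_increasing) (auto simp: power2_eq_square)
  qed (use \<Lambda> \<delta> in auto)
  also have "\<dots> = real n ^ (24 * k^2) * \<Lambda> ^ (75 * k) / \<delta> ^ (12 * k)"
    by (simp add: power_add[symmetric] mult.assoc[symmetric] algebra_simps)
  finally show ?thesis .
qed

text \<open>A power of 1/2 below \<epsilon> exists by the Archimedean property. The least such
  \<open>q\<close> is the number of halvings made by \<open>set_accuracy\<close>.\<close>

lemma accuracy_exponent:
  fixes \<epsilon> :: rat
  assumes "0 < \<epsilon>"
  obtains q where "(1/2) ^ Suc q \<le> \<epsilon>" "\<And>l. l < q \<Longrightarrow> \<epsilon> < (1/2) ^ Suc l"
proof -
  obtain m where m: "inverse (of_nat (Suc m)) < \<epsilon>" using reals_Archimedean[OF assms] by blast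
  have "Suc m \<le> 2 ^ Suc m" using less_exp[of "Suc m"] by (rule less_imp_le)
  then have "of_nat (Suc m) \<le> (of_nat (2 ^ Suc m) :: rat)" by (simp only: of_nat_le_iff)
  then have "inverse (of_nat (2 ^ Suc m)) \<le> inverse (of_nat (Suc m) :: rat)"
    by (rule le_imp_inverse_le) simp
  moreover have "inverse (of_nat (2 ^ Suc m)) = ((1/2) ^ Suc m :: rat)"
    by (simp add: power_one_over inverse_eq_divide)
  ultimately have ex: "(1/2) ^ Suc m \<le> \<epsilon>" using m by simp
  define q where "q = (LEAST q. (1/2) ^ Suc q \<le> \<epsilon>)"
  have "(1/2) ^ Suc q \<le> \<epsilon>" unfolding q_def using ex by (rule LeastI)
  moreover have "\<epsilon> < (1/2) ^ Suc l" if "l < q" for l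
    using not_less_Least[OF that[unfolded q_def]] by simp
  ultimately show thesis by (rule that)
qed

theorem theorem1p4:
  shows "\<exists>(prog :: com) (c1 :: nat) (c2 :: nat) (c3 :: nat) (c4 :: nat).
    \<forall>(k :: nat) (n :: nat) (A :: nat \<Rightarrow> nat \<Rightarrow> int) (b :: nat \<Rightarrow> int) (\<epsilon> :: rat).
      1 \<le> k \<longrightarrow> 1 \<le> n \<longrightarrow> (\<forall>i<k. \<forall>j<n. 0 \<le> A i j) \<longrightarrow> 0 < \<epsilon> \<longrightarrow>
      (let P = polytope_in_cube k n A b;
           L = real_of_int (max_enc_len k n A b);
           \<delta> = min (real_of_rat \<epsilon>) (1/2);
           \<Lambda> = log 2 (real n / \<delta>) + L
       in \<exists>(t :: nat) (s :: store) (Z' :: real).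
            exec (real c4 * (L * \<Lambda>)) prog (input_store k n A b \<epsilon>) t s
            \<and> real t \<le> real n ^ (c1 * k^2) * \<Lambda> ^ (c2 * k) / \<delta> ^ (c3 * k)
            \<and> outputs s Z'
            \<and> vol n P \<le> Z' \<and> Z' \<le> (1 + real_of_rat \<epsilon>) * vol n P)"
proof (rule exI[of _ volume_code], rule exI[of _ 24], rule exI[of _ 75], rule exI[of _ 12],
    rule exI[of _ 200], unfold Let_def, intro allI impI)
  fix k n :: nat and A :: "nat \<Rightarrow> nat \<Rightarrow> int" and b :: "nat \<Rightarrow> int" and \<epsilon> :: rat
  assume k: "1 \<le> k" and n: "1 \<le> n" and A0: "\<forall>i<k. \<forall>j<n. 0 \<le> A i j" and \<epsilon>: "0 < \<epsilon>"
  define P where "P = polytope_in_cube k n A b"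
  define L where "L = max_enc_len k n A b"
  define \<delta> where "\<delta> = min (real_of_rat \<epsilon>) (1/2)"
  define g where "g = log 2 (real n / \<delta>)"
  define \<Lambda> where "\<Lambda> = g + real_of_int L"
  define l where "l = nat L"

  let ?E = "(\<lambda>(i, j). enc_len (of_int (A i j))) ` ({..<k} \<times> {..<n}) \<union> (\<lambda>i. enc_len (of_int (b i))) ` {..<k}"
  have E: "e \<le> L" if "e \<in> ?E" for e
    unfolding L_def max_enc_len_def using that by (intro Max_ge) auto
  have EA: "enc_len (of_int (A i j)) \<le> L" if "i < k" "j < n" for i j
    using that by (intro E UnI1 image_eqI[of _ _ "(i, j)"]) auto
  have Eb: "enc_len (of_int (b i)) \<le> L" if "i < k" for i
    using that by (intro E UnI2 image_eqI[of _ _ i]) auto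
  have "0 \<le> \<lceil>log 2 (real_of_int (\<bar>A 0 0\<bar> + 1))\<rceil>" by (simp add: le_ceiling_iff zero_le_log_cancel_iff order_less_le_trans[of "-1" 0])
  \<comment> \<open>The denominator 1 of an integer already has length 1.\<close>
  then have L1: "1 \<le> L" using EA[of 0 0] k n unfolding enc_len_of_int by linarith
  then have Ll: "L = int l" by (simp add: l_def)

  have \<delta>: "0 < \<delta>" "\<delta> \<le> 1/2" "\<delta> \<le> real_of_rat \<epsilon>" using \<epsilon> by (auto simp: \<delta>_def)
  have n\<delta>: "2 \<le> real n / \<delta>"
  proof -
    have "2 * \<delta> \<le> real n" using \<delta> n by simp
    then show ?thesis using \<delta> by (simp add: le_divide_eq)
  qed
  \<comment> \<open>Here the cap of 1/2 on \<open>\<delta>\<close> pays off: a logarithm of at least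
    1 absorbs additive constants.\<close>
  then have g1: "1 \<le> g" unfolding g_def by (subst le_log_iff) (use \<delta> in auto)
  have \<Lambda>: "2 \<le> \<Lambda>" "1 + real l \<le> \<Lambda>" "g \<le> \<Lambda>" using g1 L1 by (auto simp: \<Lambda>_def Ll)

  obtain q where q: "(1/2) ^ Suc q \<le> \<epsilon>" "\<And>l. l < q \<Longrightarrow> \<epsilon> < (1/2) ^ Suc l"
    using accuracy_exponent[OF \<epsilon>] by blast
  have q1: "1 \<le> \<delta> * 2 ^ Suc q"
  proof -
    have "real_of_rat ((1/2) ^ Suc q) \<le> real_of_rat \<epsilon>" using q(1) unfolding of_rat_less_eq .
    then have "(1/2) ^ Suc q \<le> real_of_rat \<epsilon>" by (simp add: of_rat_power of_rat_mult of_rat_divide)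
    moreover have "(1/2::real) ^ Suc q \<le> 1/2" using power_decreasing[of 1 "Suc q" "1/2::real"] by simp
    ultimately have "(1/2) ^ Suc q \<le> \<delta>" by (simp add: \<delta>_def)
    then have "(1/2) ^ Suc q * 2 ^ Suc q \<le> \<delta> * 2 ^ Suc q" by (rule mult_right_mono) simp
    then show ?thesis by (simp add: power_one_over)
  qed
  \<comment> \<open>For positive \<open>q\<close>, minimality gives that
    \<open>\<delta> * 2 ^ q\<close> is at most 1.\<close>
  have q2: "2 ^ Suc q \<le> 2 / \<delta>"
  proof (cases q)
    case 0
    then show ?thesis using \<delta> by (simp add: field_simps)
  next
    case (Suc q')
    have "real_of_rat \<epsilon> < real_of_rat ((1/2) ^ q)" using q(2)[of q'] Suc unfolding of_rat_less by simp
    then have "\<delta> < (1/2) ^ q" using \<delta>(3) by (simp add: of_rat_power of_rat_divide)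
    then have "\<delta> * 2 ^ q \<le> 1" by (simp add: power_one_over field_simps)
    then show ?thesis using \<delta> by (simp add: field_simps)
  qed

  \<comment> \<open>By \<open>q1\<close> and \<open>q2\<close>, \<open>M\<close> is at least
    \<open>16 * n\<^sup>2 / \<delta>\<close>, as the error budget demands, and at most twice that,
    as the running time requires.\<close>
  define M where "M = 16 * n * n * 2 ^ Suc q"
  have rM: "real M = 16 * real n ^ 2 * 2 ^ Suc q" by (simp add: M_def power2_eq_square)
  have M1: "16 * real n * real n \<le> \<delta> * real M"
    using mult_left_mono[OF q1, of "16 * real n * real n"] by (simp add: rM power2_eq_square mult_ac)
  have M2: "real M \<le> 32 * real n ^ 2 / \<delta>"
    using mult_left_mono[OF q2, of "16 * real n ^ 2"] by (simp add: rM)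
  have M0: "1 \<le> M" "2 \<le> M" using n by (simp_all add: M_def)
  have M3: "real M \<le> 32 * (real n / \<delta>) ^ 2"
  proof -
    have "real n ^ 2 / \<delta> \<le> real n ^ 2 / \<delta> ^ 2"
      using \<delta> by (intro divide_left_mono) (auto simp: power2_eq_square)
    with M2 show ?thesis by (simp add: power_divide)
  qed

  define p where "p = (LEAST p. M * M \<le> 2 ^ p)"
  have "M * M \<le> 2 ^ (M * M)" using less_exp[of "M * M"] by (rule less_imp_le)
  then have p1: "M * M \<le> 2 ^ p" unfolding p_def by (rule LeastI)
  have p2: "2 ^ i < M * M" if "i < p" for i
    using not_less_Least[OF that[unfolded p_def]] by simp
  have "2 * 2 \<le> M * M" using M0 by (intro mult_le_mono)
  then obtain p' where p': "p = Suc p'" using p1 by (cases p) auto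
  then have pM: "2 ^ p < 2 * (M * M)" using p2[of p'] by simp
  have "2 ^ p' < M * M" using p2[of p'] p' by simp
  then have "p \<le> M * M" using less_exp[of p'] p' by linarith
  moreover have "Suc (M * M) ^ 1 \<le> Suc (M * M) ^ k" using k by (intro power_increasing) auto
  ultimately have pN: "p \<le> Suc (M * M) ^ k" by simp
  \<comment> \<open>From \<open>2 ^ p < 2 * (M * M)\<close> and the bound on \<open>M\<close>
    follows that \<open>p\<close> is at most \<open>11 + 4 * g\<close>, and \<open>g\<close> is at
    least 1.\<close>
  have pg: "real p \<le> 15 * g"
  proof -
    have "real (2 ^ p) \<le> real (2 * (M * M))" using pM by (simp only: of_nat_le_iff less_imp_le)
    also have "\<dots> = 2 * (real M * real M)" by simp
    also have "\<dots> \<le> 2 * ((32 * (real n / \<delta>) ^ 2) * (32 * (real n / \<delta>) ^ 2))"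
      using M3 by (intro mult_left_mono mult_mono) auto
    also have "\<dots> = 2 ^ 11 * (real n / \<delta>) ^ 4" by (simp add: numeral_eq_Suc)
    finally have "log 2 (2 ^ p) \<le> log 2 (2 ^ 11 * (real n / \<delta>) ^ 4)"
      using n \<delta> by (subst log_le_cancel_iff) (auto intro!: mult_pos_pos zero_less_power)
    also have "\<dots> = 11 + 4 * g"
    proof -
      have "0 < real n / \<delta>" using n\<delta> by linarith
      then have "log 2 (2 ^ 11 * (real n / \<delta>) ^ 4) = log 2 (2 ^ 11) + log 2 ((real n / \<delta>) ^ 4)"
        using n \<delta> by (intro log_mult_pos) auto
      also have "log 2 ((real n / \<delta>) ^ 4) = 4 * g"
        unfolding g_def using \<open>0 < real n / \<delta>\<close> by (subst log_nat_power) auto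
      also have "log 2 (2 ^ 11 :: real) = 11" by (subst log_nat_power) auto
      finally show ?thesis .
    qed
    also have "log 2 (2 ^ p) = real p" by (subst log_nat_power) auto
    finally show ?thesis using g1 by linarith
  qed

  \<comment> \<open>With \<open>B = 2 ^ p\<close> and \<open>H = 2 ^ l\<close>, the part
    \<open>3 * p + 2\<close> covers \<open>4 * B * B * B\<close> and the part \<open>2 * l\<close>
    covers \<open>H * H\<close>. \<open>D\<close> is the exponent for \<open>B * M * H\<close>,
    using that \<open>M\<close> is at most \<open>2 ^ p\<close>.\<close>
  define x where "x = 3 * p + 2 * l + 2"
  define D where "D = 2 * p + l"
  have le2: "i \<le> j \<Longrightarrow> (2::nat) ^ i \<le> 2 ^ j" for i j by (rule power_increasing) auto
  have "M \<le> M * M" by simp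
  then have Mp: "M \<le> 2 ^ p" using p1 by linarith
  have "1 \<le> n * (2 ^ Suc q * 16)" using n by simp
  then have "n * 1 \<le> n * (n * (2 ^ Suc q * 16))" by (rule mult_le_mono2)
  then have nM: "n \<le> M" by (simp add: M_def mult_ac)
  have nMp: "n * M \<le> 2 ^ p" using mult_le_mono1[OF nM, of M] p1 by linarith
  have X1: "4 * (2 ^ p * 2 ^ p) * 2 ^ p \<le> (2::nat) ^ x"
  proof -
    have "4 * (2 ^ p * 2 ^ p) * 2 ^ p = (2::nat) ^ (p + p + p + 2)" by (simp add: power_add)
    then show ?thesis using le2[of "p + p + p + 2" x] by (simp add: x_def)
  qed
  have X2: "2 ^ l * M \<le> 2 ^ x"
  proof -
    have "2 ^ l * M \<le> 2 ^ l * 2 ^ p" using Mp by (rule mult_le_mono2)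
    also have "\<dots> = 2 ^ (l + p)" by (simp add: power_add)
    finally show ?thesis using le2[of "l + p" x] by (simp add: x_def)
  qed
  have X3: "2 ^ l * 2 ^ l \<le> (2::nat) ^ x"
    unfolding power_add[symmetric] by (intro le2) (simp add: x_def)
  have X4: "p * (n * M) + n * D \<le> 2 ^ x"
  proof -
    have "p * (n * M) \<le> 2 ^ p * 2 ^ p" using less_exp[of p] nMp by (intro mult_le_mono) auto
    also have "\<dots> \<le> 2 ^ (3 * p + l)" unfolding power_add[symmetric] by (intro le2) simp
    finally have 1: "p * (n * M) \<le> 2 ^ (3 * p + l)" .
    have "n * D \<le> 2 ^ p * 2 ^ D" using nM Mp less_exp[of D] by (intro mult_le_mono) auto
    also have "\<dots> \<le> 2 ^ (3 * p + l)" unfolding power_add[symmetric] by (intro le2) (simp add: D_def)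
    finally have "p * (n * M) + n * D \<le> 2 ^ Suc (3 * p + l)" using 1 by simp
    then show ?thesis using le2[of "Suc (3 * p + l)" x] by (simp add: x_def)
  qed
  have D1: "2 ^ p * M * 2 ^ l \<le> 2 ^ D"
  proof -
    have "2 ^ p * M * 2 ^ l \<le> 2 ^ p * 2 ^ p * 2 ^ l" using Mp by (intro mult_le_mono) auto
    also have "\<dots> = 2 ^ D" by (simp add: D_def power_add mult_2)
    finally show ?thesis .
  qed
  have D2: "D \<le> 4 * Suc (M * M) ^ k + l" using pN by (simp add: D_def)

  let ?B = "real 200 * (real_of_int L * \<Lambda>)"
  \<comment> \<open>By \<open>pg\<close>, \<open>9 * p\<close> is at most \<open>135 * g\<close>, so
    that with \<open>6 * l + 8\<close> the sum stays below \<open>200 * \<Lambda>\<close>. The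
    numbers thus have length of order log(n/\<delta>) + L, and the further factor \<open>L\<close>
    is slack.\<close>
  have B: "3 * real x + 2 \<le> ?B"
  proof -
    have "3 * real x + 2 = 9 * real p + 6 * real l + 8" by (simp add: x_def)
    also have "\<dots> \<le> 200 * \<Lambda>" using pg \<Lambda> g1 by linarith
    also have "\<dots> \<le> 200 * (real_of_int L * \<Lambda>)"
      using mult_right_mono[of 1 "real_of_int L" \<Lambda>] L1 \<Lambda> by simp
    finally show ?thesis by simp
  qed
  interpret volume_program k n A b "2 ^ l" "2 ^ x" ?B
  proof
    show "0 \<le> A i j \<and> A i j \<le> int (2 ^ l)" if "i < k" "j < n" for i j
      using abs_le_two_power_enc_len[of "A i j" l] EA[OF that] A0 that by (simp add: Ll)
    show "\<bar>b i\<bar> \<le> int (2 ^ l)" if "i < k" for i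
      using abs_le_two_power_enc_len[of "b i" l] Eb[OF that] by (simp add: Ll)
    show "(2::nat) ^ l \<le> 2 ^ x" by (intro le2) (simp add: x_def)
    show "real_of_int (enc_len r) \<le> ?B"
      if "0 < y" "y \<le> 2 ^ x" "\<bar>r\<bar> \<le> of_nat (2 ^ x)" "r * of_nat y \<in> \<int>" for r y
    proof -
      have "enc_len r \<le> 3 * int x + 2" using that by (intro enc_len_le[of y]) auto
      then have "real_of_int (enc_len r) \<le> real_of_int (3 * int x + 2)" unfolding of_int_le_iff .
      with B show ?thesis by simp
    qed
  qed (use k n in auto)
  from run_volume_code[OF A0 q M_def p2 p1 D1 D2 X1 X2 X3 X4]
  obtain t s Z where ex: "exec ?B volume_code (input_store k n A b \<epsilon>) t s"
    and t: "t \<le> 256 * (1 + l) * (Suc (M * M) ^ k) ^ 6" and out: "outputs s Z" and lo: "vol n P \<le> Z"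
    and hi: "Z \<le> (1 + 1 / real (2 ^ p)) ^ (2 * (n * M) + n) * (1 + 3 * real n / real M) ^ n * vol n P"
    unfolding run_def P_def by blast
  have "0 \<le> vol n P" by (simp add: vol_def)
  then have "Z \<le> (1 + \<delta>) * vol n P"
    using hi error_le[OF n M1 _ p1 \<delta>(1,2)] M0 mult_right_mono order_trans by (metis Suc_le_eq One_nat_def)
  also have "\<dots> \<le> (1 + real_of_rat \<epsilon>) * vol n P"
    using \<delta>(3) \<open>0 \<le> vol n P\<close> by (intro mult_right_mono) auto
  finally have hi': "Z \<le> (1 + real_of_rat \<epsilon>) * vol n P" .
  have "real t \<le> real n ^ (24 * k^2) * \<Lambda> ^ (75 * k) / \<delta> ^ (12 * k)"
    by (rule time_le[OF k n \<delta>(1) \<Lambda>(1,2) M0(1) M2 t])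
  with ex out lo hi'
  show "\<exists>t s Z'.
       exec (real 200 * (real_of_int (max_enc_len k n A b) *
          (log 2 (real n / min (real_of_rat \<epsilon>) (1 / 2)) + real_of_int (max_enc_len k n A b))))
        volume_code (input_store k n A b \<epsilon>) t s \<and>
       real t \<le> real n ^ (24 * k\<^sup>2) *
         (log 2 (real n / min (real_of_rat \<epsilon>) (1 / 2)) + real_of_int (max_enc_len k n A b)) ^ (75 * k) /
         min (real_of_rat \<epsilon>) (1 / 2) ^ (12 * k) \<and>
       outputs s Z' \<and> vol n (polytope_in_cube k n A b) \<le> Z' \<and>
       Z' \<le> (1 + real_of_rat \<epsilon>) * vol n (polytope_in_cube k n A b)"
    unfolding \<Lambda>_def g_def \<delta>_def L_def P_def by blast
qed

end
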